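(* Let $B$ be a block of $\mathcal{O}G$ with defect group $P$, and let $C$ be the block of $\mathcal{O}N_G(P)$ which is the Brauer correspondent of $B$. Let $j\in C^P$ and $i\in B^P$ be source idempotents of $C$ and $B$, respectively. Suppose that there is a bijection $g : \mathrm{Irr}_{p'}(iBi)\cong \mathrm{Irr}_{p'}(jCj)$ satisfying $\dim_K(g(W))\leq \dim_K(W)$ for any simple $iKGi$-module $W$ of dimension prime to $p$ with isomorphism class in $\mathrm{Irr}_{p'}(iBi)$ (simple $K\otimes_{\mathcal O}iBi$-module). Then the bijection $f :\mathrm{Irr}_0(B)\to \mathrm{Irr}_0(C)$ induced by $g$ and the standard Morita equivalences between $B$ and $iBi$ and between $C$ and $jCj$ satisfies $f(\chi)(1)\leq \chi(1)$ for all $\chi\in \mathrm{Irr}_0(B)$.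
   Context: Let $p$ be a prime, $\mathcal{O}$ a complete discrete valuation ring with algebraically closed residue field $k$ of characteristic $p$ and field of fractions $K$ of characteristic $0$. $G$ is a finite group. It is assumed that $K$ is a splitting field for $K\otimes_{\mathcal{O}}B$, $K\otimes_{\mathcal{O}}C$ and related blocks. $\mathrm{Irr}(B)$ is the set of characters of the simple $K\otimes_{\mathcal{O}}B$-modules, and $\mathrm{Irr}_0(B)$ is the subset of height zero characters, i.e. those $\chi$ such that the $p$-part of $\chi(1)$ equals the $p$-part of $|G:P|$; similarly for $C$. $B^P$ denotes the subalgebra of elements of $B$ fixed under conjugation by $P$; $\mathrm{Br}_P:(\mathcal{O}G)^P\to kC_G(P)$ is the Brauer homomorphism (truncation to $C_G(P)$ followed by reduction modulo $J(\mathcal{O})$). A source idempotent of $B$ is a primitive idempotent $i\in B^P$ with $\mathrm{Br}_P(i)\neq 0$; $iBi$ is then a source algebra of $B$. Likewise for $C$ (which also has defect group $P$). For an $\mathcal{O}$-free $\mathcal{O}$-algebra $A$ of finite $\mathcal{O}$-rank, $\mathrm{Irr}_{p'}(A)$ is the set of isomorphism classes of simple $K\otimes_{\mathcal{O}}A$-modules of $K$-dimension prime to $p$ (the same letter is used for an isomorphism class and a representative). The standard Morita equivalence between $B$ and $iBi$ is given by the bimodules $Bi$ and $iB$; it sends a simple $K\otimes_{\mathcal{O}}B$-module $X$ to the simple $K\otimes_{\mathcal{O}}iBi$-module $iX$, and induces a bijection $\mathrm{Irr}_0(B)\cong\mathrm{Irr}_{p'}(iBi)$. Similarly $Y\mapsto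 jY$ induces a bijection $\mathrm{Irr}_0(C)\cong\mathrm{Irr}_{p'}(jCj)$. The bijection $f$ induced by $g$ is thus determined as follows: if $\chi\in\mathrm{Irr}_0(B)$ is the character of $X$, then $f(\chi)$ is the character of the simple $K\otimes_{\mathcal{O}}C$-module $Y$ with $jY\cong g(iX)$. *)

theory Defs
  imports
    "HOL-Algebra.Group_Action"
    "HOL-Algebra.Left_Coset"
    "HOL-Algebra.Ideal_Product"
    "HOL-Algebra.Ring_Divisibility"
    "HOL-Algebra.Algebraic_Closure_Type"
    "HOL-Library.Function_Algebras"
begin

section \<open>Complete discrete valuation rings\<close>

text \<open>The ring \<open>\<O>\<close> is given by its underlying set \<open>S\<close>, a subring of the field \<open>'k\<close>.\<close>

definition subring_record :: "'k::ring_1 set \<Rightarrow> 'k ring" where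
  "subring_record S = ring_of_type_algebra\<lparr>carrier := S\<rparr>"

definition is_dvr :: "'a ring \<Rightarrow> bool" where
  "is_dvr R \<longleftrightarrow> principal_domain R \<and> \<not> Ring.field R \<and> (\<exists>!M. maximalideal M R)"

definition the_maximal_ideal :: "'a ring \<Rightarrow> 'a set" where
  "the_maximal_ideal R = (THE M. maximalideal M R)"

fun ideal_power :: "'a ring \<Rightarrow> 'a set \<Rightarrow> nat \<Rightarrow> 'a set" where
  "ideal_power R M 0 = carrier R"
| "ideal_power R M (Suc n) = ideal_prod R M (ideal_power R M n)"

text \<open>Completeness in the adic topology of the maximal ideal: every coherent sequence of
  residues modulo the powers of the maximal ideal comes from an element of the ring.\<close>

definition adically_complete :: "'a ring \<Rightarrow> 'a set \<Rightarrow> bool" where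
  "adically_complete R M \<longleftrightarrow>
     (\<forall>x :: nat \<Rightarrow> 'a.
        (\<forall>n. x n \<in> carrier R) \<and> (\<forall>n. x (Suc n) \<ominus>\<^bsub>R\<^esub> x n \<in> ideal_power R M n) \<longrightarrow>
        (\<exists>l\<in>carrier R. \<forall>n. l \<ominus>\<^bsub>R\<^esub> x n \<in> ideal_power R M n))"

definition complete_dvr :: "'a ring \<Rightarrow> bool" where
  "complete_dvr R \<longleftrightarrow> is_dvr R \<and> adically_complete R (the_maximal_ideal R)"

definition is_fraction_field_of :: "'k::field set \<Rightarrow> bool" where
  "is_fraction_field_of S \<longleftrightarrow> (\<forall>x::'k. \<exists>a\<in>S. \<exists>d\<in>S. d \<noteq> 0 \<and> x = a / d)"

text \<open>A surjective ring homomorphism from a local ring onto a field has the maximal ideal as its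
  kernel, so the following exhibits the field \<open>'r\<close> as the residue field.\<close>

definition is_residue_map :: "'k::field set \<Rightarrow> ('k \<Rightarrow> 'r::field) \<Rightarrow> bool" where
  "is_residue_map S res \<longleftrightarrow>
     res \<in> ring_hom (subring_record S) (ring_of_type_algebra :: 'r ring) \<and> res ` S = UNIV"


section \<open>Idempotents in rings\<close>

definition center :: "('a, 'm) ring_scheme \<Rightarrow> 'a set" where
  "center A = {z \<in> carrier A. \<forall>a\<in>carrier A. z \<otimes>\<^bsub>A\<^esub> a = a \<otimes>\<^bsub>A\<^esub> z}"

definition primitive_idempotent :: "('a, 'm) ring_scheme \<Rightarrow> 'a \<Rightarrow> bool" where
  "primitive_idempotent A e \<longleftrightarrow>
     e \<in> carrier A \<and> e \<otimes>\<^bsub>A\<^esub> e = e \<and> e \<noteq> \<zero>\<^bsub>A\<^esub> \<and>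
     (\<forall>e1\<in>carrier A. \<forall>e2\<in>carrier A.
        e1 \<otimes>\<^bsub>A\<^esub> e1 = e1 \<and> e2 \<otimes>\<^bsub>A\<^esub> e2 = e2 \<and>
        e1 \<otimes>\<^bsub>A\<^esub> e2 = \<zero>\<^bsub>A\<^esub> \<and> e2 \<otimes>\<^bsub>A\<^esub> e1 = \<zero>\<^bsub>A\<^esub> \<and> e = e1 \<oplus>\<^bsub>A\<^esub> e2 \<longrightarrow>
        e1 = \<zero>\<^bsub>A\<^esub> \<or> e2 = \<zero>\<^bsub>A\<^esub>)"

text \<open>\<open>eAe\<close>, with unit element \<open>e\<close>; it equals \<open>Ae\<close> if \<open>e\<close> is central.\<close>

definition corner :: "('a, 'm) ring_scheme \<Rightarrow> 'a \<Rightarrow> ('a, 'm) ring_scheme" where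
  "corner A e = A\<lparr>carrier := {e \<otimes>\<^bsub>A\<^esub> a \<otimes>\<^bsub>A\<^esub> e | a. a \<in> carrier A}, one := e\<rparr>"


section \<open>Group algebras\<close>

text \<open>Elements of the group algebra are coefficient functions that vanish outside the group, so
  that \<open>SG\<close> for a subring \<open>S\<close> of \<open>'k\<close> and \<open>SH\<close> for a subgroup \<open>H\<close> of \<open>G\<close> are literally
  subsets of \<open>KG\<close>.\<close>

definition conv :: "('g, 'm) monoid_scheme \<Rightarrow> ('g \<Rightarrow> 'k::comm_ring_1) \<Rightarrow> ('g \<Rightarrow> 'k) \<Rightarrow> 'g \<Rightarrow> 'k"
  where
  "conv G a b = (\<lambda>x. if x \<in> carrier G
                     then \<Sum>y\<in>carrier G. a y * b (inv\<^bsub>G\<^esub> y \<otimes>\<^bsub>G\<^esub> x) else 0)"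

definition grp_elt :: "'g \<Rightarrow> 'g \<Rightarrow> 'k::comm_ring_1" where
  "grp_elt u = (\<lambda>x. if x = u then 1 else 0)"

definition group_ring :: "'k::comm_ring_1 set \<Rightarrow> ('g, 'm) monoid_scheme \<Rightarrow> ('g \<Rightarrow> 'k) ring" where
  "group_ring S G =
     \<lparr>carrier = {a. (\<forall>x\<in>carrier G. a x \<in> S) \<and> (\<forall>x. x \<notin> carrier G \<longrightarrow> a x = 0)},
      monoid.mult = conv G, one = grp_elt \<one>\<^bsub>G\<^esub>, zero = 0, add = (+)\<rparr>"

definition conj_act :: "('g, 'm) monoid_scheme \<Rightarrow> 'g \<Rightarrow> ('g \<Rightarrow> 'k::comm_ring_1) \<Rightarrow> 'g \<Rightarrow> 'k" where
  "conj_act G u a = conv G (conv G (grp_elt u) a) (grp_elt (inv\<^bsub>G\<^esub> u))"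

definition fixed_points ::
  "('g, 'm) monoid_scheme \<Rightarrow> 'g set \<Rightarrow> ('g \<Rightarrow> 'k::comm_ring_1) ring \<Rightarrow> ('g \<Rightarrow> 'k) ring" where
  "fixed_points G P A = A\<lparr>carrier := {a \<in> carrier A. \<forall>u\<in>P. conj_act G u a = a}\<rparr>"

text \<open>The relative trace map from the \<open>P\<close>-fixed points to the \<open>G\<close>-fixed points. On
  \<open>P\<close>-fixed points the choice of coset representatives does not matter.\<close>

definition rel_trace ::
  "('g, 'm) monoid_scheme \<Rightarrow> 'g set \<Rightarrow> ('g \<Rightarrow> 'k::comm_ring_1) \<Rightarrow> 'g \<Rightarrow> 'k" where
  "rel_trace G P a = (\<Sum>D\<in>lcosets\<^bsub>G\<^esub> P. conj_act G (SOME x. x \<in> D) a)"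

definition centralizer :: "('g, 'm) monoid_scheme \<Rightarrow> 'g set \<Rightarrow> 'g set" where
  "centralizer G P = {x \<in> carrier G. \<forall>u\<in>P. x \<otimes>\<^bsub>G\<^esub> u = u \<otimes>\<^bsub>G\<^esub> x}"

abbreviation normalizer_group :: "('g, 'm) monoid_scheme \<Rightarrow> 'g set \<Rightarrow> ('g, 'm) monoid_scheme" where
  "normalizer_group G P \<equiv> G\<lparr>carrier := normalizer G P\<rparr>"

definition brauer_map ::
  "('g, 'm) monoid_scheme \<Rightarrow> 'g set \<Rightarrow> ('k \<Rightarrow> 'r::zero) \<Rightarrow> ('g \<Rightarrow> 'k) \<Rightarrow> 'g \<Rightarrow> 'r" where
  "brauer_map G P res a = (\<lambda>x. if x \<in> centralizer G P then res (a x) else 0)"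


section \<open>Blocks, defect groups, source idempotents\<close>

definition block_idempotent ::
  "'k::comm_ring_1 set \<Rightarrow> ('g, 'm) monoid_scheme \<Rightarrow> ('g \<Rightarrow> 'k) \<Rightarrow> bool" where
  "block_idempotent S G b \<longleftrightarrow>
     primitive_idempotent ((group_ring S G)\<lparr>carrier := center (group_ring S G)\<rparr>) b"

definition block_algebra ::
  "'k::comm_ring_1 set \<Rightarrow> ('g, 'm) monoid_scheme \<Rightarrow> ('g \<Rightarrow> 'k) \<Rightarrow> ('g \<Rightarrow> 'k) ring" where
  "block_algebra S G b = corner (group_ring S G) b"

definition rel_projective ::
  "'k::comm_ring_1 set \<Rightarrow> ('g, 'm) monoid_scheme \<Rightarrow> ('g \<Rightarrow> 'k) \<Rightarrow> 'g set \<Rightarrow> bool" where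
  "rel_projective S G b Q \<longleftrightarrow>
     b \<in> rel_trace G Q ` carrier (fixed_points G Q (group_ring S G))"

text \<open>Of the equivalent definitions of a defect group this is the one by relative projectivity; that
  \<open>P\<close> is a \<open>p\<close>-group is a consequence.\<close>

definition defect_group ::
  "'k::comm_ring_1 set \<Rightarrow> ('g, 'm) monoid_scheme \<Rightarrow> ('g \<Rightarrow> 'k) \<Rightarrow> 'g set \<Rightarrow> bool" where
  "defect_group S G b P \<longleftrightarrow>
     subgroup P G \<and> rel_projective S G b P \<and>
     (\<forall>Q. subgroup Q G \<and> Q \<subset> P \<longrightarrow> \<not> rel_projective S G b Q)"

text \<open>The Brauer correspondent of the block of \<open>b\<close> is the block of \<open>N\<^sub>G(P)\<close> with defect group
  \<open>P\<close> and the same image under the Brauer homomorphism; note that \<open>N\<^sub>G(P)\<close> contains the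
  centralizer of \<open>P\<close> in \<open>G\<close>.\<close>

definition brauer_correspondent ::
  "'k::comm_ring_1 set \<Rightarrow> ('k \<Rightarrow> 'r::zero) \<Rightarrow> ('g, 'm) monoid_scheme \<Rightarrow> 'g set \<Rightarrow>
   ('g \<Rightarrow> 'k) \<Rightarrow> ('g \<Rightarrow> 'k) \<Rightarrow> bool" where
  "brauer_correspondent S res G P b c \<longleftrightarrow>
     block_idempotent S (normalizer_group G P) c \<and>
     defect_group S (normalizer_group G P) c P \<and>
     brauer_map (normalizer_group G P) P res c = brauer_map G P res b"

definition source_idempotent ::
  "('k::comm_ring_1 \<Rightarrow> 'r::zero) \<Rightarrow> ('g, 'm) monoid_scheme \<Rightarrow> 'g set \<Rightarrow> ('g \<Rightarrow> 'k) ring \<Rightarrow>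
   ('g \<Rightarrow> 'k) \<Rightarrow> bool" where
  "source_idempotent res G P B i \<longleftrightarrow>
     primitive_idempotent (fixed_points G P B) i \<and> brauer_map G P res i \<noteq> (\<lambda>_. 0)"


section \<open>Modules\<close>

definition fscale :: "'k::field \<Rightarrow> ('a \<Rightarrow> 'k) \<Rightarrow> 'a \<Rightarrow> 'k" where
  "fscale c v = (\<lambda>x. c * v x)"

global_interpretation fvec: vector_space "fscale :: 'k::field \<Rightarrow> ('a \<Rightarrow> 'k) \<Rightarrow> 'a \<Rightarrow> 'k"
  by unfold_locales (auto simp: fscale_def fun_eq_iff algebra_simps)

text \<open>All modules here are finite-dimensional over \<open>K\<close>. They are realised on subspaces of one
  fixed space \<open>nat \<Rightarrow> K\<close>, which contains a copy of every finite-dimensional space; isomorphism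
  classes are then sets of such modules. Only the action of the algebra at hand on the underlying
  subspace is meaningful.\<close>

record ('g, 'k) amodule =
  mspace :: "(nat \<Rightarrow> 'k) set"
  maction :: "('g \<Rightarrow> 'k) \<Rightarrow> (nat \<Rightarrow> 'k) \<Rightarrow> (nat \<Rightarrow> 'k)"

text \<open>Here \<open>A\<close> is a finite-dimensional \<open>K\<close>-algebra contained in the space \<open>'g \<Rightarrow> K\<close>.\<close>

definition is_module :: "('g \<Rightarrow> 'k::field) ring \<Rightarrow> ('g, 'k) amodule \<Rightarrow> bool" where
  "is_module A V \<longleftrightarrow>
     (\<exists>F. finite F \<and> mspace V = fvec.span F) \<and>
     (\<forall>a\<in>carrier A. \<forall>v\<in>mspace V. maction V a v \<in> mspace V) \<and>
     (\<forall>a\<in>carrier A. \<forall>v\<in>mspace V. \<forall>w\<in>mspace V.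
        maction V a (v + w) = maction V a v + maction V a w) \<and>
     (\<forall>a\<in>carrier A. \<forall>b\<in>carrier A. \<forall>v\<in>mspace V.
        maction V (a \<oplus>\<^bsub>A\<^esub> b) v = maction V a v + maction V b v) \<and>
     (\<forall>a\<in>carrier A. \<forall>b\<in>carrier A. \<forall>v\<in>mspace V.
        maction V (a \<otimes>\<^bsub>A\<^esub> b) v = maction V a (maction V b v)) \<and>
     (\<forall>v\<in>mspace V. maction V \<one>\<^bsub>A\<^esub> v = v) \<and>
     (\<forall>c. \<forall>a\<in>carrier A. \<forall>v\<in>mspace V. maction V (fscale c a) v = fscale c (maction V a v))"

definition mdim :: "('g, 'k::field) amodule \<Rightarrow> nat" where
  "mdim V = fvec.dim (mspace V)"

definition is_submodule ::
  "('g \<Rightarrow> 'k::field) ring \<Rightarrow> (nat \<Rightarrow> 'k) set \<Rightarrow> ('g, 'k) amodule \<Rightarrow> bool" where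
  "is_submodule A U V \<longleftrightarrow>
     fvec.subspace U \<and> U \<subseteq> mspace V \<and> (\<forall>a\<in>carrier A. \<forall>v\<in>U. maction V a v \<in> U)"

definition simple_module :: "('g \<Rightarrow> 'k::field) ring \<Rightarrow> ('g, 'k) amodule \<Rightarrow> bool" where
  "simple_module A V \<longleftrightarrow>
     is_module A V \<and> mspace V \<noteq> {0} \<and>
     (\<forall>U. is_submodule A U V \<longrightarrow> U = {0} \<or> U = mspace V)"

definition module_hom_on ::
  "('g \<Rightarrow> 'k::field) ring \<Rightarrow> ('g, 'k) amodule \<Rightarrow> ('g, 'k) amodule \<Rightarrow>
   ((nat \<Rightarrow> 'k) \<Rightarrow> (nat \<Rightarrow> 'k)) \<Rightarrow> bool" where
  "module_hom_on A V Y h \<longleftrightarrow>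
     (\<forall>v\<in>mspace V. h v \<in> mspace Y) \<and>
     (\<forall>v\<in>mspace V. \<forall>w\<in>mspace V. h (v + w) = h v + h w) \<and>
     (\<forall>c. \<forall>v\<in>mspace V. h (fscale c v) = fscale c (h v)) \<and>
     (\<forall>a\<in>carrier A. \<forall>v\<in>mspace V. h (maction V a v) = maction Y a (h v))"

definition module_iso ::
  "('g \<Rightarrow> 'k::field) ring \<Rightarrow> ('g, 'k) amodule \<Rightarrow> ('g, 'k) amodule \<Rightarrow> bool" where
  "module_iso A V Y \<longleftrightarrow> (\<exists>h. module_hom_on A V Y h \<and> bij_betw h (mspace V) (mspace Y))"

definition iso_class ::
  "('g \<Rightarrow> 'k::field) ring \<Rightarrow> ('g, 'k) amodule \<Rightarrow> ('g, 'k) amodule set" where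
  "iso_class A V = {Y. is_module A Y \<and> module_iso A V Y}"

text \<open>\<open>K\<close> is a splitting field for \<open>A\<close>: the endomorphisms of each simple module are scalars.\<close>

definition split_algebra :: "('g \<Rightarrow> 'k::field) ring \<Rightarrow> bool" where
  "split_algebra A \<longleftrightarrow>
     (\<forall>V h. simple_module A V \<and> module_hom_on A V V h \<longrightarrow>
        (\<exists>c. \<forall>v\<in>mspace V. h v = fscale c v))"

text \<open>For an \<open>\<O>\<close>-subalgebra \<open>A\<close> of \<open>\<O>G\<close>, the scalar extension of \<open>A\<close> to \<open>K\<close> is the
  \<open>K\<close>-linear span of \<open>A\<close> in \<open>KG\<close>: elements of \<open>A\<close> that are linearly independent over \<open>\<O>\<close>
  are so over its field of fractions \<open>K\<close>.\<close>

definition scalar_ext :: "('g \<Rightarrow> 'k::field) ring \<Rightarrow> ('g \<Rightarrow> 'k) ring" where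
  "scalar_ext A = A\<lparr>carrier := fvec.span (carrier A)\<rparr>"

definition irr_p' :: "nat \<Rightarrow> ('g \<Rightarrow> 'k::field) ring \<Rightarrow> ('g, 'k) amodule set set" where
  "irr_p' p A = {iso_class (scalar_ext A) V | V.
     simple_module (scalar_ext A) V \<and> coprime p (mdim V)}"

text \<open>\<open>V \<mapsto> iV\<close>, where the action is to be restricted to the corner algebra at \<open>i\<close>.\<close>

definition cut_module :: "('g \<Rightarrow> 'k) \<Rightarrow> ('g, 'k) amodule \<Rightarrow> ('g, 'k) amodule" where
  "cut_module i V = V\<lparr>mspace := maction V i ` mspace V\<rparr>"


section \<open>Characters\<close>

definition lin_trace :: "(nat \<Rightarrow> 'k::field) set \<Rightarrow> ((nat \<Rightarrow> 'k) \<Rightarrow> (nat \<Rightarrow> 'k)) \<Rightarrow> 'k" where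
  "lin_trace V T =
     (let E = (SOME E. \<not> fvec.dependent E \<and> fvec.span E = V)
      in \<Sum>e\<in>E. fvec.representation E (T e) e)"

text \<open>A module over the scalar extension of a block algebra \<open>B\<close> with unit element \<open>b\<close> is a
  \<open>KG\<close>-module on which \<open>x \<in> G\<close> acts as \<open>bx\<close>.\<close>

definition character ::
  "('g, 'm) monoid_scheme \<Rightarrow> ('g \<Rightarrow> 'k::field) ring \<Rightarrow> ('g, 'k) amodule \<Rightarrow> 'g \<Rightarrow> 'k" where
  "character G B V = (\<lambda>x. if x \<in> carrier G
     then lin_trace (mspace V) (maction V (\<one>\<^bsub>B\<^esub> \<otimes>\<^bsub>B\<^esub> grp_elt x)) else 0)"

definition irr_chars ::
  "('g, 'm) monoid_scheme \<Rightarrow> ('g \<Rightarrow> 'k::field) ring \<Rightarrow> ('g \<Rightarrow> 'k) set" where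
  "irr_chars G B = {character G B V | V. simple_module (scalar_ext B) V}"

text \<open>The value of a character at the unit element, which is the image of a natural number in
  the field \<open>K\<close> of characteristic zero, as that natural number.\<close>

definition char_degree :: "('g, 'm) monoid_scheme \<Rightarrow> ('g \<Rightarrow> 'k::field_char_0) \<Rightarrow> nat" where
  "char_degree G \<chi> = (THE n. \<chi> \<one>\<^bsub>G\<^esub> = of_nat n)"

definition p_part :: "nat \<Rightarrow> nat \<Rightarrow> nat" where
  "p_part p n = p ^ multiplicity p n"

definition irr_chars_ht0 ::
  "nat \<Rightarrow> ('g, 'm) monoid_scheme \<Rightarrow> 'g set \<Rightarrow> ('g \<Rightarrow> 'k::field_char_0) ring \<Rightarrow> ('g \<Rightarrow> 'k) set" where
  "irr_chars_ht0 p G P B =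
     {\<chi> \<in> irr_chars G B. p_part p (char_degree G \<chi>) = p_part p (card (rcosets\<^bsub>G\<^esub> P))}"

text \<open>\<open>f\<close> is the bijection between the height zero characters of \<open>B\<close> (a block of \<open>G\<close>) and \<open>C\<close>
  (a block of \<open>H\<close>) induced by \<open>g\<close> and the Morita equivalences \<open>V \<mapsto> iV\<close> and \<open>Y \<mapsto> jY\<close>:
  if \<open>V\<close> has character \<open>\<chi>\<close>, then \<open>f \<chi>\<close> is the character of a simple \<open>Y\<close> such that \<open>jY\<close>
  belongs to the value of \<open>g\<close> at the isomorphism class \<open>w\<close> of \<open>iV\<close>.\<close>

definition induced_bijection ::
  "nat \<Rightarrow> ('g, 'm) monoid_scheme \<Rightarrow> ('g, 'm) monoid_scheme \<Rightarrow> 'g set \<Rightarrow>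
   ('g \<Rightarrow> 'k::field_char_0) ring \<Rightarrow> ('g \<Rightarrow> 'k) ring \<Rightarrow> ('g \<Rightarrow> 'k) \<Rightarrow> ('g \<Rightarrow> 'k) \<Rightarrow>
   (('g, 'k) amodule set \<Rightarrow> ('g, 'k) amodule set) \<Rightarrow> (('g \<Rightarrow> 'k) \<Rightarrow> ('g \<Rightarrow> 'k)) \<Rightarrow> bool" where
  "induced_bijection p G H P B C i j g f \<longleftrightarrow>
     bij_betw f (irr_chars_ht0 p G P B) (irr_chars_ht0 p H P C) \<and>
     (\<forall>V. simple_module (scalar_ext B) V \<and> character G B V \<in> irr_chars_ht0 p G P B \<longrightarrow>
        (\<exists>w\<in>irr_p' p (corner B i). cut_module i V \<in> w \<and>
           (\<exists>Y. simple_module (scalar_ext C) Y \<and> character H C Y = f (character G B V) \<and>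
                cut_module j Y \<in> g w)))"

end

theory Submission
  imports Defs "HOL-Algebra.Sylow"
begin

text \<open>
  Let \<open>\<chi>\<close> be the character of \<open>V\<close> and \<open>f \<chi>\<close> that of \<open>Y\<close>. The hypothesis on \<open>g\<close> says that
  \<open>dim jY \<le> dim iV\<close>, and the degrees are the dimensions of \<open>Y\<close> and \<open>V\<close>; so the theorem is the
  implication from \<open>dim jY \<le> dim iV\<close> to \<open>dim Y \<le> dim V\<close>. Roughly, \<open>dim Y = m dim jY\<close>, where \<open>m\<close> is
  the number of summands in a decomposition of \<open>c\<close> into primitive orthogonal idempotents of \<open>C\<^sup>P\<close>,
  and \<open>dim V \<ge> m dim iV\<close>, because \<open>b\<close> is central and the products of \<open>b\<close> with these \<open>m\<close> summands are
  orthogonal idempotents of \<open>B\<^sup>P\<close>.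

  The proof keeps to the inequalities that this picture needs. For every idempotent \<open>e\<close> of \<open>C\<^sup>P\<close> one has
  \<open>dim eY \<le> dim (be)V\<close>, and for \<open>e = c\<close> this gives \<open>dim Y \<le> dim (bc)V \<le> dim V\<close>
  (\<open>dim_le_if_source_dim_le\<close>). Both sides are additive on orthogonal idempotents, so \<open>e\<close> may be taken
  primitive in \<open>C\<^sup>P\<close>. As \<open>P\<close> is normal in \<open>N = N\<^sub>G(P)\<close>, the kernel of the Brauer homomorphism on
  \<open>(\<O>N)\<^sup>P\<close> has no nonzero idempotents (\<open>idempotent_in_brauer_kernel\<close>). Hence \<open>e\<close> has a nonzero
  image there, and so has \<open>be\<close>, since \<open>b\<close> and \<open>c\<close> have the same image. Now
  \<open>dim eY \<le> dim jY \<le> dim iV \<le> dim (be)V\<close>, where the outer inequalities come from one statement about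
  fixed point algebras, applied in \<open>\<O>N\<close> and in \<open>\<O>G\<close> (\<open>primitive_factors_through\<close>): below the block
  \<open>c\<close>, a primitive idempotent \<open>i\<close> outside the Brauer kernel factors as \<open>i = g e h\<close> through any
  idempotent \<open>e\<close> outside the Brauer kernel.

  That statement replaces the conjugacy of source idempotents. Its reason is that \<open>c\<close> is primitive in
  \<open>Z(\<O>N)\<close> and lies in the image of the trace \<open>Tr\<^sub>P\<^sup>N\<close>. Let \<open>T\<close> be the ideal generated by the
  \<open>N\<close>-conjugates of \<open>e\<close>. Modulo the radical, \<open>T\<close> has an identity \<open>\<epsilon>\<close>, which is then \<open>N\<close>-stable. If
  \<open>c = Tr(a)\<close>, the element \<open>Tr(\<epsilon>a)\<close> lies in \<open>T\<close>, agrees with \<open>\<epsilon>c\<close> modulo the radical, and modulo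
  the Brauer kernel comes from the local ring \<open>Z(\<O>N)c\<close>. If it comes from a unit there, then \<open>T\<close>
  contains \<open>c\<close> modulo the Brauer kernel, and Rosenberg's lemma applies to \<open>i\<close>. If it comes from a
  non-unit, then \<open>\<epsilon>c\<close> and hence \<open>e\<close> vanish modulo the radical, which is impossible
  (\<open>primitive_divides_conjugate\<close>).

  Completeness of \<open>\<O>\<close> enters through the lifting of idempotents, which shows that all algebras
  concerned have enough idempotents (\<open>semipotent_if_fitting\<close>, \<open>semipotent_fixalg\<close>).
\<close>

section \<open>Idempotents in complete filtered rings\<close>

definition idem :: "'a::ring_1 \<Rightarrow> bool" where
  "idem e \<longleftrightarrow> e * e = e"

definition prim_idem :: "'a::ring_1 set \<Rightarrow> 'a \<Rightarrow> bool" where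
  "prim_idem R i \<longleftrightarrow> i \<in> R \<and> idem i \<and> i \<noteq> 0 \<and>
     (\<forall>e\<in>R. idem e \<and> e * i = e \<and> i * e = e \<longrightarrow> e = 0 \<or> e = i)"

locale subring_1 =
  fixes R :: "'a::ring_1 set"
  assumes one_mem: "1 \<in> R"
    and diff_mem: "a \<in> R \<Longrightarrow> b \<in> R \<Longrightarrow> a - b \<in> R"
    and mult_mem: "a \<in> R \<Longrightarrow> b \<in> R \<Longrightarrow> a * b \<in> R"
begin

lemma zero_mem: "0 \<in> R"
  using diff_mem[OF one_mem one_mem] by simp

lemma uminus_mem: "a \<in> R \<Longrightarrow> - a \<in> R"
  using diff_mem[OF zero_mem] by force

lemma add_mem: "a \<in> R \<Longrightarrow> b \<in> R \<Longrightarrow> a + b \<in> R"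
  using diff_mem[OF _ uminus_mem] by force

lemma power_mem: "a \<in> R \<Longrightarrow> a ^ n \<in> R"
  by (induction n) (auto intro: one_mem mult_mem)

lemma sum_mem: "(\<And>x. x \<in> S \<Longrightarrow> h x \<in> R) \<Longrightarrow> sum h S \<in> R"
  by (induction S rule: infinite_finite_induct) (auto intro: zero_mem add_mem)

lemmas mem_intros = one_mem diff_mem mult_mem zero_mem uminus_mem add_mem power_mem sum_mem

end

text \<open>A form of Fitting's lemma: an idempotent of \<open>yRy\<close> splits off so much of \<open>y\<close> that the rest of \<open>y\<close> is
quasi-regular on one side. Two consequences are used below. If \<open>i\<close> is primitive, the idempotent for
\<open>y \<in> iRi\<close> is \<open>0\<close> or \<open>i\<close>, which makes \<open>iRi\<close> local. If an ideal contains no nonzero idempotent, it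
lies in the radical.\<close>

definition semipotent :: "'a::ring_1 set \<Rightarrow> bool" where
  "semipotent R \<longleftrightarrow> (\<forall>y\<in>R. \<exists>e\<in>R. \<exists>r\<in>R. \<exists>z\<in>R. idem e \<and> e = y * r * y \<and> z * (1 - y + e * y) = 1)"

lemma geometric_sum_left: "(\<Sum>k<n. a ^ k) * (1 - a) = 1 - a ^ n" for a :: "'a::ring_1"
proof (induction n)
  case (Suc n)
  have "(\<Sum>k<Suc n. a ^ k) * (1 - a) = (\<Sum>k<n. a ^ k) * (1 - a) + a ^ n * (1 - a)"
    by (simp add: distrib_right)
  thus ?case unfolding Suc by (simp add: right_diff_distrib power_commutes)
qed simp

lemma geometric_sum_right: "(1 - a) * (\<Sum>k<n. a ^ k) = 1 - a ^ n" for a :: "'a::ring_1"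
proof (induction n)
  case (Suc n)
  have "(1 - a) * (\<Sum>k<Suc n. a ^ k) = (1 - a) * (\<Sum>k<n. a ^ k) + (1 - a) * a ^ n"
    by (simp add: distrib_left)
  thus ?case unfolding Suc by (simp add: left_diff_distrib)
qed simp

text \<open>The filtration stands for the powers of the maximal ideal times \<open>R\<close>. It is kept abstract because it
occurs both for \<open>\<O>\<close> itself and for fixed point algebras in the group algebra.\<close>

locale complete_filtered_ring = subring_1 R for R :: "'a::ring_1 set" +
  fixes F :: "nat \<Rightarrow> 'a set"
  assumes F_0: "F 0 = R"
    and F_diff: "a \<in> F n \<Longrightarrow> b \<in> F n \<Longrightarrow> a - b \<in> F n"
    and F_mult: "a \<in> F m \<Longrightarrow> b \<in> F n \<Longrightarrow> a * b \<in> F (m + n)"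
    and F_Suc: "F (Suc n) \<subseteq> F n"
    and zero_F: "0 \<in> F n"
    and separated: "(\<And>n. z \<in> F n) \<Longrightarrow> z = 0"
    and complete: "(\<And>n. x n \<in> R) \<Longrightarrow> (\<And>n. x (Suc n) - x n \<in> F n) \<Longrightarrow>
        \<exists>l\<in>R. \<forall>n. l - x n \<in> F n"
begin

lemma F_antimono: "m \<le> n \<Longrightarrow> F n \<subseteq> F m"
  by (rule lift_Suc_antimono_le[of F]) (auto intro: F_Suc[THEN subsetD])

lemma F_sub_R: "F n \<subseteq> R"
  using F_antimono[of 0 n] F_0 by simp

lemma F_uminus: "a \<in> F n \<Longrightarrow> - a \<in> F n"
  using F_diff[OF zero_F] by force

lemma F_add: "a \<in> F n \<Longrightarrow> b \<in> F n \<Longrightarrow> a + b \<in> F n"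
  using F_diff[OF _ F_uminus] by force

lemma F_lmult: "r \<in> R \<Longrightarrow> a \<in> F n \<Longrightarrow> r * a \<in> F n"
  using F_mult[of r 0 a n] F_0 by simp

lemma F_rmult: "r \<in> R \<Longrightarrow> a \<in> F n \<Longrightarrow> a * r \<in> F n"
  using F_mult[of a n r 0] F_0 by simp

lemma F_power: "a \<in> F 1 \<Longrightarrow> a ^ n \<in> F n"
proof (induction n)
  case 0
  show ?case using F_0 one_mem by simp
next
  case (Suc n)
  show ?case using F_mult[OF Suc.prems Suc.IH[OF Suc.prems]] by simp
qed

text \<open>The inverse is the limit of the geometric series.\<close>

lemma one_minus_inverse:
  assumes a: "a \<in> F 1"
  obtains z where "z \<in> R" "z * (1 - a) = 1" "(1 - a) * z = 1"
proof -
  have aR: "a \<in> R" using a F_sub_R by blast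
  define x where "x n = (\<Sum>k<n. a ^ k)" for n
  have xR: "x n \<in> R" for n unfolding x_def by (intro mem_intros aR)
  have gl: "x n * (1 - a) = 1 - a ^ n" for n
    unfolding x_def by (rule geometric_sum_left)
  have gr: "(1 - a) * x n = 1 - a ^ n" for n
    unfolding x_def by (rule geometric_sum_right)
  obtain z where z: "z \<in> R" "\<And>n. z - x n \<in> F n"
    using complete[of x] xR F_power[OF a] by (auto simp: x_def)
  have "z * (1 - a) - 1 \<in> F n" for n
  proof -
    have "z * (1 - a) - 1 = (z - x n) * (1 - a) - a ^ n"
      using gl[of n] by (simp add: algebra_simps)
    thus ?thesis
      by (metis F_diff F_rmult F_power[OF a] z(2) one_mem aR diff_mem)
  qed
  moreover have "(1 - a) * z - 1 \<in> F n" for n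
  proof -
    have "(1 - a) * z - 1 = (1 - a) * (z - x n) - a ^ n"
      using gr[of n] by (simp add: algebra_simps)
    thus ?thesis
      by (metis F_diff F_lmult F_power[OF a] z(2) one_mem aR diff_mem)
  qed
  ultimately show ?thesis
    using that[OF z(1)] separated[of "z * (1 - a) - 1"] separated[of "(1 - a) * z - 1"] by auto
qed

text \<open>Newton's iteration \<open>u \<mapsto> 3u\<^sup>2 - 2u\<^sup>3\<close> squares the error \<open>u\<^sup>2 - u\<close> up to a factor. All iterates are
polynomials in \<open>e\<close>, so the limit commutes with whatever commutes with \<open>e\<close>.\<close>

lemma lift_idempotent:
  assumes e: "e \<in> R" and ee: "e * e - e \<in> F 1"
  obtains h where "h \<in> R" "idem h" "h - e \<in> F 1"
    "\<And>d. d \<in> R \<Longrightarrow> d * e = e * d \<Longrightarrow> d * h = h * d"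
proof -
  \<comment> \<open>Sums in place of numerals: every step is then an identity of noncommutative monomials.\<close>
  define step where "step u = (u * u + u * u + u * u) - (u * u * u + u * u * u)" for u :: 'a
  define x where "x n = (step ^^ n) e" for n
  have xS: "x (Suc n) = step (x n)" for n by (simp add: x_def)
  have step_error: "step u * step u - step u = d * d * (d + d + d + d) - (d * d + d * d + d * d)"
    if "d = u * u - u" for u d
    unfolding step_def that by (simp add: algebra_simps)
  have step_diff: "step u - u = (1 - (u + u)) * (u * u - u)" for u
    unfolding step_def by (simp add: algebra_simps)
  have x: "x n \<in> R \<and> x n * x n - x n \<in> F (Suc n)" for n
  proof (induction n)
    case 0
    show ?case using e ee by (simp add: x_def)
  next
    case (Suc n)
    let ?d = "x n * x n - x n"
    have "?d * ?d \<in> F (Suc n + Suc n)" using Suc F_mult by blast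
    hence "?d * ?d \<in> F (Suc (Suc n))" using F_antimono[of "Suc (Suc n)" "Suc n + Suc n"] by auto
    note dd = this
    have s: "?d + ?d + ?d + ?d \<in> R" using Suc by (intro mem_intros) auto
    have "?d * ?d * (?d + ?d + ?d + ?d) - (?d * ?d + ?d * ?d + ?d * ?d) \<in> F (Suc (Suc n))"
      using F_diff[OF F_rmult[OF s dd] F_add[OF F_add[OF dd dd] dd]] .
    moreover have "x (Suc n) \<in> R" unfolding xS step_def using Suc by (intro mem_intros) auto
    ultimately show ?case by (simp only: xS step_error[OF refl] simp_thms)
  qed
  have inc: "x (Suc n) - x n \<in> F (Suc n)" for n
    unfolding xS step_diff using x[of n] by (intro F_lmult mem_intros) auto
  obtain h where h: "h \<in> R" "\<And>n. h - x n \<in> F n"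
    using complete[of x] x inc F_Suc by blast
  have "h * h - h \<in> F n" for n
  proof -
    have eq: "h * h - h = (h - x n) * h + x n * (h - x n) - (h - x n) + (x n * x n - x n)"
      by (simp add: algebra_simps)
    have "x n * x n - x n \<in> F n" using x[of n] F_Suc by blast
    note xx = this
    have xR: "x n \<in> R" using x[of n] by blast
    show ?thesis unfolding eq
      by (rule F_add[OF F_diff[OF F_add[OF F_rmult[OF h(1) h(2)] F_lmult[OF xR h(2)]] h(2)] xx])
  qed
  hence "idem h" using separated unfolding idem_def by fastforce
  moreover have "h - e \<in> F 1"
  proof -
    have "h - e = (h - x 1) + (x (Suc 0) - x 0)" by (simp add: x_def)
    show ?thesis using F_add[OF h(2)[of 1, unfolded One_nat_def] inc[of 0]] by (simp add: x_def)
  qed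
  moreover have "d * h = h * d" if d: "d \<in> R" "d * e = e * d" for d
  proof -
    have dx: "d * x n = x n * d" for n
    proof (induction n)
      case 0
      show ?case using d by (simp add: x_def)
    next
      case (Suc n)
      have c2: "d * (x n * x n) = (x n * x n) * d" using Suc by (metis mult.assoc)
      hence c3: "d * (x n * x n * x n) = (x n * x n * x n) * d" using Suc by (metis mult.assoc)
      show ?case unfolding xS step_def
        by (simp only: right_diff_distrib left_diff_distrib distrib_left distrib_right c2 c3)
    qed
    have "d * h - h * d \<in> F n" for n
    proof -
      have "d * h - h * d = d * (h - x n) - (h - x n) * d"
        using dx[of n] by (simp add: algebra_simps)
      thus ?thesis using h(2)[of n] d by (simp add: F_diff F_lmult F_rmult)
    qed
    thus ?thesis using separated[of "d * h - h * d"] by simp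
  qed
  ultimately show ?thesis using that h(1) by blast
qed

text \<open>If \<open>y\<^sup>n\<close> is a multiple of \<open>y\<^sup>n\<^sup>+\<^sup>1\<close> modulo the first filtration step, say by \<open>q\<close>, then \<open>y\<^sup>nq\<^sup>n\<close> is idempotent
modulo that step, and \<open>y\<close> is nilpotent on the complement. A lift of this idempotent is the one required.\<close>

lemma semipotent_if_fitting:
  assumes fitting: "\<And>y. y \<in> R \<Longrightarrow> \<exists>n. \<exists>q\<in>R. q * y = y * q \<and> y ^ n - y ^ Suc n * q \<in> F 1"
  shows "semipotent R"
  unfolding semipotent_def
proof
  fix y assume y: "y \<in> R"
  obtain n0 q where q: "q \<in> R" "q * y = y * q" and n0: "y ^ n0 - y ^ Suc n0 * q \<in> F 1"
    using fitting[OF y] by blast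
  \<comment> \<open>Two more factors \<open>y\<close>, so that \<open>e0\<close> below can be written as \<open>y\<close> times something times \<open>y\<close>.\<close>
  define n where "n = Suc (Suc n0)"
  have qy: "q * y ^ k = y ^ k * q" for k
    using q(2) by (induction k) (auto simp: mult.assoc, metis mult.assoc)
  have qky: "q ^ l * y ^ k = y ^ k * q ^ l" for k l
    using qy by (induction l) (auto simp: mult.assoc, metis mult.assoc)
  have st: "y ^ n - y ^ (n + k) * q ^ k \<in> F 1" for k
  proof (induction k)
    case 0
    show ?case using zero_F by simp
  next
    case (Suc k)
    have "y ^ (n + k) * q ^ k - y ^ (n + Suc k) * q ^ Suc k
        = y ^ Suc (Suc k) * (y ^ n0 - y ^ Suc n0 * q) * q ^ k"
      by (simp add: n_def algebra_simps power_add power_commutes)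
        (metis (no_types, lifting) mult.assoc power_commutes power_Suc)
    also have "\<dots> \<in> F 1" using y q n0 by (intro F_rmult F_lmult mem_intros)
    finally show ?case using F_add[OF Suc] by fastforce
  qed
  define e0 where "e0 = y ^ n * q ^ n"
  have e0R: "e0 \<in> R" unfolding e0_def using y q by (intro mem_intros)
  have ye0: "y * e0 = e0 * y" unfolding e0_def
    by (metis mult.assoc power_commutes qky power_one_right)
  have e0y: "e0 * y ^ n = y ^ (n + n) * q ^ n"
    unfolding e0_def by (simp add: power_add mult.assoc qky)
  have "e0 * e0 - e0 = - ((y ^ n - y ^ (n + n) * q ^ n) * q ^ n)"
    using e0y by (simp add: e0_def algebra_simps flip: mult.assoc)
  also have "\<dots> \<in> F 1" using st[of n] q by (intro F_uminus F_rmult mem_intros)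
  finally obtain e where e: "e \<in> R" "idem e" "e - e0 \<in> F 1"
    and comm: "\<And>d. d \<in> R \<Longrightarrow> d * e0 = e0 * d \<Longrightarrow> d * e = e * d"
    using lift_idempotent[OF e0R] by metis
  have ye: "y * e = e * y" using comm[OF y ye0] .
  have e0e: "e0 * e = e * e0" using comm[OF e0R] by simp
  have ee: "e * e = e" using e(2) by (simp add: idem_def)
  \<comment> \<open>On \<open>e\<close>, the element \<open>e0\<close> acts invertibly because it is close to \<open>e\<close>; this brings \<open>e\<close> into \<open>yRy\<close>.\<close>
  define Z where "Z = 1 - e * (e - e0)"
  have "e * (e - e0) \<in> F 1" using e by (intro F_lmult)
  then obtain z where z: "z \<in> R" "z * Z = 1" "Z * z = 1"
    using one_minus_inverse unfolding Z_def by metis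
  have Z2: "Z = 1 - e + e * e0" unfolding Z_def by (simp add: right_diff_distrib ee)
  have "e * e0 * e = e * e0" by (simp add: mult.assoc e0e) (simp add: ee flip: mult.assoc)
  hence Ze: "Z * e = e * e0" unfolding Z2 by (simp add: distrib_right left_diff_distrib ee)
  have "y * (e * e0) = e * e0 * y" by (simp add: mult.assoc flip: ye0) (simp add: ye flip: mult.assoc)
  hence yZ: "y * Z = Z * y" unfolding Z2
    by (simp add: distrib_right left_diff_distrib distrib_left right_diff_distrib ye)
  have yz: "y * z = z * y"
  proof -
    have "z * y = z * y * (Z * z)" using z by simp
    also have "\<dots> = z * (y * Z) * z" by (simp add: mult.assoc)
    also have "\<dots> = (z * Z) * y * z" by (simp add: yZ mult.assoc)
    finally show ?thesis using z by simp
  qed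
  define r where "r = z * e * y ^ n0 * q ^ n"
  have "e = z * Z * e" using z by simp
  also have "\<dots> = z * (e * e0)" using Ze by (simp add: mult.assoc)
  also have "\<dots> = y * r * y"
  proof -
    have "q ^ n * y = y * q ^ n" using qky[of n 1] by simp
    hence "y * r * y = y * (z * e * y ^ n0) * (y * q ^ n)" unfolding r_def by (simp add: mult.assoc)
    also have "\<dots> = (y * z) * e * y ^ n0 * y * q ^ n" by (simp add: mult.assoc)
    also have "\<dots> = z * (y * e) * y ^ n0 * y * q ^ n" using yz by (simp add: mult.assoc)
    also have "\<dots> = z * e * (y * y ^ n0 * y) * q ^ n" using ye by (simp add: mult.assoc)
    also have "y * y ^ n0 * y = y ^ n" by (simp add: n_def mult.assoc power_commutes)
    finally show ?thesis by (simp add: e0_def mult.assoc)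
  qed
  finally have er: "e = y * r * y" .
  have rR: "r \<in> R" unfolding r_def using z e y q by (intro mem_intros)
  \<comment> \<open>On the complement of \<open>e\<close>, a power of \<open>y\<close> lies in the first filtration step.\<close>
  define W where "W = (1 - e) * y"
  have WR: "W \<in> R" unfolding W_def using e y by (intro mem_intros)
  have Wk: "W ^ Suc k = (1 - e) * y ^ Suc k" for k
  proof (induction k)
    case 0
    show ?case by (simp add: W_def)
  next
    case (Suc k)
    have ii: "(1 - e) * (1 - e) = 1 - e" using ee by (simp add: algebra_simps)
    have "W ^ Suc (Suc k) = (1 - e) * y * ((1 - e) * y ^ Suc k)" using Suc by (simp add: W_def)
    also have "\<dots> = (1 - e) * (y * (1 - e)) * y ^ Suc k" by (simp add: mult.assoc)
    also have "y * (1 - e) = (1 - e) * y" using ye by (simp add: algebra_simps)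
    also have "(1 - e) * ((1 - e) * y) * y ^ Suc k = ((1 - e) * (1 - e)) * y ^ Suc (Suc k)"
      by (simp add: mult.assoc)
    finally show ?case using ii by simp
  qed
  have "W ^ n = (y ^ n - y ^ (n + n) * q ^ n) - (e - e0) * y ^ n"
    using Wk[of "Suc n0"] e0y by (simp add: n_def algebra_simps)
  also have "\<dots> \<in> F 1" by (rule F_diff[OF st[of n] F_rmult[OF power_mem[OF y] e(3)]])
  finally obtain z' where z': "z' \<in> R" "z' * (1 - W ^ n) = 1" using one_minus_inverse by metis
  have "1 - y + e * y = 1 - W" by (simp add: W_def left_diff_distrib)
  hence "z' * (\<Sum>k<n. W ^ k) * (1 - y + e * y) = 1"
    using geometric_sum_left[of W n] z' by (simp only: mult.assoc)
  moreover have "z' * (\<Sum>k<n. W ^ k) \<in> R" using z' WR by (intro mem_intros)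
  ultimately show "\<exists>e\<in>R. \<exists>r\<in>R. \<exists>z\<in>R. idem e \<and> e = y * r * y \<and> z * (1 - y + e * y) = 1"
    using e er rR by blast
qed

end


section \<open>Radicals and ideals generated by conjugates\<close>

text \<open>\<open>iRi\<close> is a local ring: a sum is left invertible only if one of its terms is. After multiplication by
\<open>w\<close> the two terms have sum \<open>i\<close>. The idempotent belonging to the first one is \<open>i\<close>, and then that term
is invertible, or \<open>0\<close>, and then the second one is.\<close>

lemma (in subring_1) local_corner:
  assumes sp: "semipotent R" and i: "prim_idem R i"
    and u: "u \<in> R" "u * i = u" "i * u = u" and v: "v \<in> R" "i * v = v" and w: "w \<in> R" "w * (u + v) = i"
  shows "(\<exists>w\<in>R. w * u = i) \<or> (\<exists>w\<in>R. w * v = i)"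
proof -
  have iR: "i \<in> R" and ii: "i * i = i" using i by (auto simp: prim_idem_def idem_def)
  define u' where "u' = i * w * u"
  define v' where "v' = i * w * v"
  have sum: "u' + v' = i" using w ii by (simp add: u'_def v'_def mult.assoc flip: distrib_left)
  have u'R: "u' \<in> R" unfolding u'_def using iR w u by (intro mem_intros)
  have u'i: "u' * i = u'" "i * u' = u'" using u ii by (simp_all add: u'_def mult.assoc) (simp add: ii flip: mult.assoc)
  obtain e r z where e: "e \<in> R" "idem e" "e = u' * r * u'" and r: "r \<in> R"
    and z: "z \<in> R" "z * (1 - u' + e * u') = 1"
    using sp u'R unfolding semipotent_def by blast
  have "e * i = e" using e(3) u'i by (metis mult.assoc)
  moreover have "i * e = e" using e(3) u'i by (metis mult.assoc)
  ultimately consider "e = 0" | "e = i" using i e unfolding prim_idem_def by blast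
  thus ?thesis
  proof cases
    case 1
    have "z * v' = z * (1 - u') * i" using sum u'i by (simp add: mult.assoc left_diff_distrib) (metis add_diff_cancel_left')
    also have "\<dots> = i" using z 1 by simp
    finally have "(z * i * w) * v = i" by (simp add: v'_def mult.assoc)
    moreover have "z * i * w \<in> R" using z iR w by (intro mem_intros)
    ultimately show ?thesis by blast
  next
    case 2
    hence "(u' * r * i * w) * u = i" using e(3) by (simp add: u'_def mult.assoc)
    moreover have "u' * r * i * w \<in> R" using u'R r iR w by (intro mem_intros)
    ultimately show ?thesis by blast
  qed
qed

locale ring_ideal = subring_1 R for R :: "'a::ring_1 set" +
  fixes I :: "'a set"
  assumes I_sub: "I \<subseteq> R"
    and I_zero: "0 \<in> I"
    and I_diff: "a \<in> I \<Longrightarrow> b \<in> I \<Longrightarrow> a - b \<in> I"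
    and I_lmult: "r \<in> R \<Longrightarrow> a \<in> I \<Longrightarrow> r * a \<in> I"
    and I_rmult: "r \<in> R \<Longrightarrow> a \<in> I \<Longrightarrow> a * r \<in> I"
begin

lemma I_uminus: "a \<in> I \<Longrightarrow> - a \<in> I"
  using I_diff[OF I_zero] by force

lemma I_add: "a \<in> I \<Longrightarrow> b \<in> I \<Longrightarrow> a + b \<in> I"
  using I_diff[OF _ I_uminus] by force

text \<open>The Jacobson radical of \<open>R/I\<close>, pulled back to \<open>R\<close>. Working in \<open>R\<close> avoids forming the quotient by the
kernel of the Brauer homomorphism.\<close>

definition jac :: "'a set" where
  "jac = {a \<in> R. \<forall>b\<in>R. \<exists>y\<in>R. y * (1 - b * a) - 1 \<in> I}"

lemma I_sub_jac: "I \<subseteq> jac"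
proof
  fix a assume a: "a \<in> I"
  have "1 * (1 - b * a) - 1 \<in> I" if "b \<in> R" for b
    using I_uminus[OF I_lmult[OF that a]] by simp
  thus "a \<in> jac" unfolding jac_def using a I_sub one_mem by blast
qed

lemma jac_lmult: "r \<in> R \<Longrightarrow> a \<in> jac \<Longrightarrow> r * a \<in> jac"
  unfolding jac_def by (auto intro: mult_mem simp flip: mult.assoc)

text \<open>Jacobson's trick: \<open>1 + a y b\<close> is a left inverse of \<open>1 - ab\<close> if \<open>y\<close> is one of \<open>1 - ba\<close>.\<close>

lemma left_inverse_swap:
  assumes "a \<in> R" "b \<in> R" "y \<in> R" "y * (1 - b * a) - 1 \<in> I"
  shows "\<exists>y\<in>R. y * (1 - a * b) - 1 \<in> I"
proof
  show "1 + a * y * b \<in> R" using assms by (intro mem_intros)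
  have "(1 + a * y * b) * (1 - a * b) - 1 = a * (y * (1 - b * a) - 1) * b"
    by (simp add: algebra_simps)
  also have "\<dots> \<in> I" using assms by (intro I_rmult I_lmult)
  finally show "(1 + a * y * b) * (1 - a * b) - 1 \<in> I" .
qed

lemma jac_rmult:
  assumes r: "r \<in> R" and a: "a \<in> jac"
  shows "a * r \<in> jac"
proof -
  have aR: "a \<in> R" using a by (simp add: jac_def)
  have "\<exists>y\<in>R. y * (1 - b * (a * r)) - 1 \<in> I" if b: "b \<in> R" for b
  proof -
    obtain y where "y \<in> R" "y * (1 - r * b * a) - 1 \<in> I"
      using a mult_mem[OF r b] unfolding jac_def by blast
    hence "\<exists>y\<in>R. y * (1 - (b * a) * r) - 1 \<in> I"
      using left_inverse_swap[of "b * a" r y] r b aR by (simp add: mult_mem mult.assoc)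
    thus ?thesis by (simp add: mult.assoc)
  qed
  thus ?thesis using aR r by (simp add: jac_def mult_mem)
qed

lemma jac_add:
  assumes a: "a \<in> jac" and a': "a' \<in> jac"
  shows "a + a' \<in> jac"
proof -
  have R: "a \<in> R" "a' \<in> R" using a a' by (auto simp: jac_def)
  have "\<exists>y\<in>R. y * (1 - b * (a + a')) - 1 \<in> I" if b: "b \<in> R" for b
  proof -
    obtain y where y: "y \<in> R" "y * (1 - b * a) - 1 \<in> I" using a b unfolding jac_def by blast
    obtain y' where y': "y' \<in> R" "y' * (1 - (y * b) * a') - 1 \<in> I"
      using a' mult_mem[OF y(1) b] unfolding jac_def by blast
    have "y' * y * (1 - b * (a + a')) - 1
        = (y' * (1 - (y * b) * a') - 1) + y' * (y * (1 - b * a) - 1)"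
      by (simp add: algebra_simps)
    also have "\<dots> \<in> I" using y y' by (intro I_add I_lmult)
    finally show ?thesis using mult_mem[OF y'(1) y(1)] by blast
  qed
  thus ?thesis using R by (simp add: jac_def add_mem)
qed

lemma jac_zero: "0 \<in> jac" using I_sub_jac I_zero by blast

lemma jac_uminus: "a \<in> jac \<Longrightarrow> - a \<in> jac"
  using jac_lmult[OF uminus_mem[OF one_mem]] by force

lemma jac_diff: "a \<in> jac \<Longrightarrow> a' \<in> jac \<Longrightarrow> a - a' \<in> jac"
  using jac_add[OF _ jac_uminus] by force

lemma jac_sum: "(\<And>x. x \<in> A \<Longrightarrow> h x \<in> jac) \<Longrightarrow> sum h A \<in> jac"
  by (induction A rule: infinite_finite_induct) (auto intro: jac_zero jac_add)

text \<open>If \<open>e\<close> is in the radical then \<open>1 - e\<close> has a left inverse modulo \<open>I\<close>, and it annihilates \<open>e\<close>.\<close>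

lemma idem_in_jac:
  assumes "e \<in> jac" "idem e"
  shows "e \<in> I"
proof -
  obtain y where y: "y \<in> R" "y * (1 - 1 * e) - 1 \<in> I" using assms one_mem unfolding jac_def by blast
  have e: "e \<in> R" "e * e = e" using assms by (auto simp: jac_def idem_def)
  have "- ((y * (1 - 1 * e) - 1) * e) = e" using e by (simp add: left_diff_distrib right_diff_distrib mult.assoc)
  thus ?thesis using I_uminus[OF I_rmult[OF e(1) y(2)]] by simp
qed

text \<open>The two-sided ideal of \<open>R\<close> generated by \<open>E\<close>, for nonempty \<open>E\<close>.\<close>

inductive_set conj_ideal :: "'a set \<Rightarrow> 'a set" for E where
  gen: "e \<in> E \<Longrightarrow> r \<in> R \<Longrightarrow> r' \<in> R \<Longrightarrow> r * e * r' \<in> conj_ideal E"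
| add: "t \<in> conj_ideal E \<Longrightarrow> t' \<in> conj_ideal E \<Longrightarrow> t + t' \<in> conj_ideal E"

lemma conj_ideal_sub: "E \<subseteq> R \<Longrightarrow> conj_ideal E \<subseteq> R"
proof
  fix t assume "E \<subseteq> R" "t \<in> conj_ideal E"
  from this(2,1) show "t \<in> R" by induction (auto intro!: mem_intros)
qed

lemma conj_ideal_lmult: "t \<in> conj_ideal E \<Longrightarrow> s \<in> R \<Longrightarrow> s * t \<in> conj_ideal E"
proof (induction rule: conj_ideal.induct)
  case (gen e r r')
  thus ?case using conj_ideal.gen[of e E "s * r" r'] by (simp add: mult_mem mult.assoc)
qed (auto simp: distrib_left intro: conj_ideal.add)

lemma conj_ideal_rmult: "t \<in> conj_ideal E \<Longrightarrow> s \<in> R \<Longrightarrow> t * s \<in> conj_ideal E"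
proof (induction rule: conj_ideal.induct)
  case (gen e r r')
  thus ?case using conj_ideal.gen[of e E r "r' * s"] by (simp add: mult_mem mult.assoc)
qed (auto simp: distrib_right intro: conj_ideal.add)

lemma conj_ideal_base: "E \<subseteq> R \<Longrightarrow> e \<in> E \<Longrightarrow> e \<in> conj_ideal E"
  using conj_ideal.gen[of e E 1 1] one_mem by simp

text \<open>Rosenberg's lemma: \<open>i\<close> is, modulo \<open>I\<close>, a sum of products \<open>i r e r' i\<close> with \<open>e \<in> E\<close>. Since \<open>iRi\<close> is
local and \<open>I\<close> does not contain \<open>i\<close>, one of these products is left invertible in \<open>iRi\<close>.\<close>

lemma primitive_absorbed_by_generator:
  assumes sp: "semipotent R" and i: "prim_idem R i" "i \<notin> I"
    and E: "E \<subseteq> R" and t: "t \<in> conj_ideal E" "i - t \<in> I"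
  shows "\<exists>e\<in>E. \<exists>w\<in>R. \<exists>r\<in>R. \<exists>r'\<in>R. w * (i * r * e * r' * i) = i"
proof (rule ccontr)
  assume contra: "\<not> ?thesis"
  have iR: "i \<in> R" and ii: "i * i = i" using i by (auto simp: prim_idem_def idem_def)
  have no: "\<not> (\<exists>w\<in>R. w * (i * t * i) = i)" if "t \<in> conj_ideal E" for t
    using that
  proof induction
    case (gen e r r')
    thus ?case using contra by (auto simp: mult.assoc)
  next
    case (add t t')
    have R: "t \<in> R" "t' \<in> R" using add conj_ideal_sub[OF E] by auto
    show ?case
    proof
      assume "\<exists>w\<in>R. w * (i * (t + t') * i) = i"
      then obtain w where w: "w \<in> R" "w * (i * t * i + i * t' * i) = i"
        by (auto simp: distrib_left distrib_right)
      have c: "i * x * i * i = i * x * i" "i * (i * x * i) = i * x * i" for x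
        by (simp_all add: mult.assoc ii) (simp add: ii flip: mult.assoc)
      show False
        using local_corner[OF sp i(1) _ c(1) c(2) _ c(2) w] R iR add.IH by (auto intro: mem_intros)
    qed
  qed
  have tR: "t \<in> R" using t conj_ideal_sub[OF E] by auto
  have c: "i * x * i * i = i * x * i" "i * (i * x * i) = i * x * i" for x
    by (simp_all add: mult.assoc ii) (simp add: ii flip: mult.assoc)
  have "i * t * i + i * (i - t) * i = i" by (simp add: left_diff_distrib right_diff_distrib ii)
  hence "i * (i * t * i + i * (i - t) * i) = i" using ii by simp
  from local_corner[OF sp i(1) _ c(1) c(2) _ c(2) iR this]
  have "\<exists>w\<in>R. w * (i * (i - t) * i) = i" using no[OF t(1)] tR iR by (auto intro: mem_intros)
  then obtain w where "w \<in> R" "w * (i * (i - t) * i) = i" by blast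
  hence "i \<in> I" using I_lmult[OF \<open>w \<in> R\<close> I_rmult[OF iR I_lmult[OF iR t(2)]]] by simp
  thus False using i by blast
qed

end

text \<open>In the application \<open>R\<close> is the algebra of \<open>P\<close>-fixed points, \<open>I\<close> the kernel of the Brauer homomorphism,
\<open>\<sigma>\<close> the conjugation action of \<open>N = N\<^sub>G(P)\<close>, and \<open>L\<close> the center of \<open>\<O>N\<close>. The bound \<open>finite_length\<close>
stands for the rank of idempotents; it guarantees maximal idempotents in ideals.\<close>

locale semipotent_ring_action = ring_ideal R I for R :: "'a::ring_1 set" and I +
  fixes \<sigma> :: "'x \<Rightarrow> 'a \<Rightarrow> 'a" and N :: "'x set" and L :: "'a set"
  assumes semipotent_R: "semipotent R"
    and \<sigma>_mem: "x \<in> N \<Longrightarrow> a \<in> R \<Longrightarrow> \<sigma> x a \<in> R"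
    and \<sigma>_I: "x \<in> N \<Longrightarrow> a \<in> I \<Longrightarrow> \<sigma> x a \<in> I"
    and \<sigma>_add: "x \<in> N \<Longrightarrow> a \<in> R \<Longrightarrow> b \<in> R \<Longrightarrow> \<sigma> x (a + b) = \<sigma> x a + \<sigma> x b"
    and \<sigma>_mult: "x \<in> N \<Longrightarrow> a \<in> R \<Longrightarrow> b \<in> R \<Longrightarrow> \<sigma> x (a * b) = \<sigma> x a * \<sigma> x b"
    and \<sigma>_one: "x \<in> N \<Longrightarrow> \<sigma> x 1 = 1"
    and \<sigma>_unit: "\<exists>x\<in>N. \<forall>a\<in>R. \<sigma> x a = a"
    and \<sigma>_comp: "x \<in> N \<Longrightarrow> y \<in> N \<Longrightarrow> \<exists>z\<in>N. \<forall>a\<in>R. \<sigma> x (\<sigma> y a) = \<sigma> z a"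
    and \<sigma>_inv: "x \<in> N \<Longrightarrow> \<exists>y\<in>N. \<forall>a\<in>R. \<sigma> x (\<sigma> y a) = a"
    and finite_length: "\<exists>\<mu> M. \<forall>e\<in>R. \<forall>h\<in>R. idem e \<and> idem h \<and> e * h = 0 \<and> h * e = 0 \<and> h \<noteq> 0 \<longrightarrow>
          \<mu> e < \<mu> (e + h) \<and> \<mu> (e + h) \<le> (M::nat)"
    and subring_L: "subring_1 L" and L_sub: "L \<subseteq> R"
    and L_comm: "a \<in> L \<Longrightarrow> b \<in> L \<Longrightarrow> a * b = b * a"
    and semipotent_L: "semipotent L"
begin

lemma \<sigma>_uminus: "x \<in> N \<Longrightarrow> a \<in> R \<Longrightarrow> \<sigma> x (- a) = - \<sigma> x a"
  using \<sigma>_add[of x a "- a"] \<sigma>_add[of x 0 0] zero_mem uminus_mem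
  by (simp add: eq_neg_iff_add_eq_0 add.commute)

lemma \<sigma>_diff: "x \<in> N \<Longrightarrow> a \<in> R \<Longrightarrow> b \<in> R \<Longrightarrow> \<sigma> x (a - b) = \<sigma> x a - \<sigma> x b"
  using \<sigma>_add[of x a "- b"] \<sigma>_uminus[of x b] uminus_mem by simp

lemma \<sigma>_jac:
  assumes x: "x \<in> N" and a: "a \<in> jac"
  shows "\<sigma> x a \<in> jac"
proof -
  have aR: "a \<in> R" using a by (simp add: jac_def)
  have "\<exists>y\<in>R. y * (1 - b * \<sigma> x a) - 1 \<in> I" if b: "b \<in> R" for b
  proof -
    obtain x' where x': "x' \<in> N" "\<And>a. a \<in> R \<Longrightarrow> \<sigma> x (\<sigma> x' a) = a" using \<sigma>_inv[OF x] by blast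
    define b' where "b' = \<sigma> x' b"
    have b': "b' \<in> R" "\<sigma> x b' = b" using x' b \<sigma>_mem by (auto simp: b'_def)
    obtain y where y: "y \<in> R" "y * (1 - b' * a) - 1 \<in> I" using a b' unfolding jac_def by blast
    have "\<sigma> x (y * (1 - b' * a) - 1) = \<sigma> x y * (1 - b * \<sigma> x a) - 1"
      using x y b' aR by (simp add: \<sigma>_diff \<sigma>_mult \<sigma>_one mem_intros)
    thus ?thesis using \<sigma>_I[OF x y(2)] \<sigma>_mem[OF x y(1)] by auto
  qed
  thus ?thesis using \<sigma>_mem[OF x aR] by (simp add: jac_def)
qed

lemma \<sigma>_conj_ideal:
  assumes x: "x \<in> N" and e: "e \<in> R" and t: "t \<in> conj_ideal ((\<lambda>y. \<sigma> y e) ` N)"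
  shows "\<sigma> x t \<in> conj_ideal ((\<lambda>y. \<sigma> y e) ` N)"
  using t
proof induction
  case (gen e' r r')
  then obtain y where y: "y \<in> N" "e' = \<sigma> y e" by blast
  obtain z where z: "z \<in> N" "\<sigma> x (\<sigma> y e) = \<sigma> z e" using \<sigma>_comp[OF x y(1)] e by blast
  have "\<sigma> x (r * e' * r') = \<sigma> x r * \<sigma> z e * \<sigma> x r'"
    using x y z gen e by (simp add: \<sigma>_mult mult_mem \<sigma>_mem)
  thus ?case using conj_ideal.gen[of "\<sigma> z e" _ "\<sigma> x r" "\<sigma> x r'"] z x gen \<sigma>_mem by auto
next
  case (add t t')
  have "(\<lambda>y. \<sigma> y e) ` N \<subseteq> R" using e \<sigma>_mem by auto
  from conj_ideal_sub[OF this] have "t \<in> R" "t' \<in> R" using add by auto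
  thus ?case using add x by (simp add: \<sigma>_add conj_ideal.add)
qed

text \<open>An idempotent \<open>\<epsilon>\<close> of greatest rank in the ideal \<open>T\<close> generated by \<open>E\<close> is an identity of \<open>T\<close> modulo
the radical: a nonzero idempotent in \<open>(1 - \<epsilon>)T(1 - \<epsilon>)\<close> could be added to \<open>\<epsilon>\<close>, so there is none, and
by semipotency \<open>1 - y\<close> is left invertible for every \<open>y\<close> in this corner.\<close>

lemma maximal_idempotent:
  assumes E: "E \<subseteq> R"
  obtains \<epsilon> where "\<epsilon> \<in> conj_ideal E \<or> \<epsilon> = 0" "\<epsilon> \<in> R" "idem \<epsilon>"
    "\<And>t. t \<in> conj_ideal E \<Longrightarrow> t * (1 - \<epsilon>) \<in> jac"
    "\<And>t. t \<in> conj_ideal E \<Longrightarrow> (1 - \<epsilon>) * t \<in> jac"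
proof -
  obtain \<mu> :: "'a \<Rightarrow> nat" and M where \<mu>: "\<And>e h. e \<in> R \<Longrightarrow> h \<in> R \<Longrightarrow> idem e \<Longrightarrow> idem h \<Longrightarrow> e * h = 0 \<Longrightarrow> h * e = 0 \<Longrightarrow>
    h \<noteq> 0 \<Longrightarrow> \<mu> e < \<mu> (e + h) \<and> \<mu> (e + h) \<le> M"
    using finite_length by blast
  define Q where "Q e \<longleftrightarrow> (e \<in> conj_ideal E \<or> e = 0) \<and> idem e" for e
  \<comment> \<open>The bound \<open>M\<close> is only given for proper sums of orthogonal idempotents, hence the truncation.\<close>
  define \<mu>' where "\<mu>' e = min (\<mu> e) M" for e
  have TR: "conj_ideal E \<subseteq> R" using conj_ideal_sub[OF E] .
  have "Q 0" by (simp add: Q_def idem_def)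
  moreover have "\<forall>e. Q e \<longrightarrow> \<mu>' e < Suc M" by (simp add: \<mu>'_def less_Suc_eq_le)
  ultimately obtain \<epsilon> where \<epsilon>: "Q \<epsilon>" "\<And>e. Q e \<Longrightarrow> \<mu>' e \<le> \<mu>' \<epsilon>"
    using ex_has_greatest_nat[of Q 0 \<mu>' "Suc M"] by blast
  have \<epsilon>R: "\<epsilon> \<in> R" and \<epsilon>\<epsilon>: "\<epsilon> * \<epsilon> = \<epsilon>" using \<epsilon>(1) TR zero_mem by (auto simp: Q_def idem_def)
  define u where "u = 1 - \<epsilon>"
  have uR: "u \<in> R" unfolding u_def using \<epsilon>R by (intro mem_intros)
  have uu: "u * u = u" and \<epsilon>u: "\<epsilon> * u = 0" and u\<epsilon>: "u * \<epsilon> = 0"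
    using \<epsilon>\<epsilon> by (simp_all add: u_def algebra_simps)
  have inv: "\<exists>z\<in>R. z * (1 - u * t * u) = 1" if t: "t \<in> conj_ideal E" for t
  proof -
    define y where "y = u * t * u"
    have yR: "y \<in> R" unfolding y_def using uR t TR by (intro mem_intros) auto
    have uy: "u * y = y" "y * u = y" unfolding y_def by (simp_all add: mult.assoc uu) (simp add: uu flip: mult.assoc)
    obtain h r z where h: "h \<in> R" "idem h" "h = y * r * y" and r: "r \<in> R"
      and z: "z \<in> R" "z * (1 - y + h * y) = 1"
      using semipotent_R yR unfolding semipotent_def by blast
    have uh: "u * h = h" "h * u = h" using h(3) uy by (metis mult.assoc)+
    have \<epsilon>h: "\<epsilon> * h = 0" "h * \<epsilon> = 0" using uh \<epsilon>u u\<epsilon> by (metis mult.assoc mult_zero_left mult_zero_right)+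
    have hT: "h \<in> conj_ideal E"
      unfolding h(3) y_def using t uR r TR by (intro conj_ideal_rmult conj_ideal_lmult mem_intros) auto
    have "h = 0"
    proof (rule ccontr)
      assume h0: "h \<noteq> 0"
      have "\<mu> \<epsilon> < \<mu> (\<epsilon> + h) \<and> \<mu> (\<epsilon> + h) \<le> M"
        using \<mu>[OF \<epsilon>R h(1) _ h(2) \<epsilon>h h0] \<epsilon>\<epsilon> by (simp add: idem_def)
      moreover have "Q (\<epsilon> + h)"
        using \<epsilon>(1) hT h(2) \<epsilon>h \<epsilon>\<epsilon> unfolding Q_def idem_def
        by (auto intro: conj_ideal.add simp: distrib_left distrib_right)
      ultimately show False using \<epsilon>(2)[of "\<epsilon> + h"] by (simp add: \<mu>'_def)
    qed
    thus ?thesis using z by (auto simp: y_def)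
  qed
  have l: "t * u \<in> jac" if t: "t \<in> conj_ideal E" for t
  proof -
    have tR: "t \<in> R" using t TR by auto
    have "\<exists>z\<in>R. z * (1 - r * (t * u)) - 1 \<in> I" if r: "r \<in> R" for r
    proof -
      obtain z where z: "z \<in> R" "z * (1 - u * (r * t) * u) = 1"
        using inv[OF conj_ideal_lmult[OF t r]] by blast
      have "u * (r * t) * u = u * (r * t * u)" by (simp add: mult.assoc)
      hence "z * (1 - u * (r * t * u)) - 1 \<in> I" using z I_zero by simp
      hence "\<exists>z\<in>R. z * (1 - (r * t * u) * u) - 1 \<in> I"
        using left_inverse_swap[of "r * t * u" u z] z r tR uR by (simp add: mult_mem)
      thus ?thesis by (simp add: mult.assoc uu)
    qed
    thus ?thesis using tR uR by (simp add: jac_def mult_mem)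
  qed
  have r: "u * t \<in> jac" if t: "t \<in> conj_ideal E" for t
  proof -
    have tR: "t \<in> R" using t TR by auto
    have "\<exists>z\<in>R. z * (1 - r * (u * t)) - 1 \<in> I" if r: "r \<in> R" for r
    proof -
      obtain z where z: "z \<in> R" "z * (1 - u * (t * r) * u) = 1"
        using inv[OF conj_ideal_rmult[OF t r]] by blast
      have "u * (t * r) * u = u * t * (r * u)" by (simp add: mult.assoc)
      hence "z * (1 - (u * t) * (r * u)) - 1 \<in> I" using z I_zero by simp
      hence "\<exists>z\<in>R. z * (1 - (r * u) * (u * t)) - 1 \<in> I"
        using left_inverse_swap[of "r * u" "u * t" z] z r tR uR by (simp add: mult_mem)
      moreover have "(r * u) * (u * t) = r * (u * t)" by (simp add: mult.assoc) (simp add: uu flip: mult.assoc)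
      ultimately show ?thesis by simp
    qed
    thus ?thesis using tR uR by (simp add: jac_def mult_mem)
  qed
  show ?thesis
    using that[of \<epsilon>] \<epsilon>(1) \<epsilon>R l r unfolding Q_def u_def by blast
qed

text \<open>The trace hypothesis makes the passage from the noncommutative ring \<open>R\<close> to the commutative local ring
\<open>Lc\<close> possible. With \<open>\<epsilon>\<close> the identity, modulo the radical, of the ideal generated by the conjugates
of \<open>e\<close>, the trace \<open>s\<close> of \<open>\<epsilon>a\<close> is close to \<open>\<epsilon>c\<close> and to an element \<open>z\<close> of \<open>L\<close>, so that either \<open>zc\<close> or
\<open>c - zc\<close> is invertible in \<open>Lc\<close>.\<close>

theorem primitive_divides_conjugate:
  assumes c: "prim_idem L c"
    and N': "N' \<subseteq> N" and a: "a \<in> R" "c = (\<Sum>x\<in>N'. \<sigma> x a)"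
    and tr: "\<And>t. t \<in> R \<Longrightarrow> \<exists>z\<in>L. z - (\<Sum>x\<in>N'. \<sigma> x t) \<in> I"
    and e: "e \<in> R" "idem e" "e \<notin> I" "e * c - e \<in> I"
    and i: "prim_idem R i" "i \<notin> I" "i * c - i \<in> I"
  shows "\<exists>x\<in>N. \<exists>w\<in>R. \<exists>r\<in>R. \<exists>r'\<in>R. w * (i * r * \<sigma> x e * r' * i) = i"
proof -
  interpret L: subring_1 L by (rule subring_L)
  have iR: "i \<in> R" using i by (auto simp: prim_idem_def)
  have cL: "c \<in> L" and cc: "c * c = c" using c by (auto simp: prim_idem_def idem_def)
  have cR: "c \<in> R" using cL L_sub by blast
  define E where "E = (\<lambda>y. \<sigma> y e) ` N"
  have E: "E \<subseteq> R" unfolding E_def using e \<sigma>_mem by auto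
  have eE: "e \<in> E" unfolding E_def using \<sigma>_unit e(1) by force
  have eT: "e \<in> conj_ideal E" using conj_ideal_base[OF E eE] .
  have TR: "conj_ideal E \<subseteq> R" using conj_ideal_sub[OF E] .
  obtain \<epsilon> where \<epsilon>: "\<epsilon> \<in> conj_ideal E \<or> \<epsilon> = 0" "\<epsilon> \<in> R" "idem \<epsilon>"
    and \<epsilon>r: "\<And>t. t \<in> conj_ideal E \<Longrightarrow> t * (1 - \<epsilon>) \<in> jac"
    and \<epsilon>l: "\<And>t. t \<in> conj_ideal E \<Longrightarrow> (1 - \<epsilon>) * t \<in> jac"
    using maximal_idempotent[OF E] by blast
  have zT: "0 \<in> conj_ideal E" using conj_ideal_lmult[OF eT zero_mem] by simp
  have \<epsilon>T: "\<epsilon> \<in> conj_ideal E" using \<epsilon>(1) zT by auto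
  \<comment> \<open>\<open>\<epsilon>\<close> and \<open>\<sigma> x \<epsilon>\<close> are both identities of the same ideal modulo the radical.\<close>
  have \<epsilon>\<sigma>: "\<sigma> x \<epsilon> - \<epsilon> \<in> jac" if x: "x \<in> N" for x
  proof -
    obtain x' where x': "x' \<in> N" "\<And>a. a \<in> R \<Longrightarrow> \<sigma> x (\<sigma> x' a) = a" using \<sigma>_inv[OF x] by blast
    have "\<sigma> x' \<epsilon> \<in> conj_ideal E" using \<sigma>_conj_ideal[OF x'(1) e(1)] \<epsilon>T unfolding E_def by blast
    hence "\<sigma> x (\<sigma> x' \<epsilon> * (1 - \<epsilon>)) \<in> jac" using \<sigma>_jac[OF x] \<epsilon>r by blast
    also have "\<sigma> x (\<sigma> x' \<epsilon> * (1 - \<epsilon>)) = \<epsilon> * (1 - \<sigma> x \<epsilon>)"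
      using x x' \<epsilon>(2) by (simp add: \<sigma>_mult \<sigma>_diff \<sigma>_one mem_intros \<sigma>_mem)
    finally have 1: "\<epsilon> - \<epsilon> * \<sigma> x \<epsilon> \<in> jac" by (simp add: right_diff_distrib)
    have "\<sigma> x \<epsilon> \<in> conj_ideal E" using \<sigma>_conj_ideal[OF x e(1)] \<epsilon>T unfolding E_def by blast
    from \<epsilon>l[OF this] have "\<sigma> x \<epsilon> - \<epsilon> * \<sigma> x \<epsilon> \<in> jac" by (simp add: left_diff_distrib)
    from jac_diff[OF this 1] show ?thesis by simp
  qed
  define s where "s = (\<Sum>x\<in>N'. \<sigma> x (\<epsilon> * a))"
  have "s - \<epsilon> * c = (\<Sum>x\<in>N'. (\<sigma> x \<epsilon> - \<epsilon>) * \<sigma> x a)"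
    unfolding s_def a(2) sum_distrib_left sum_subtractf[symmetric]
    using N' \<epsilon>(2) a(1) by (intro sum.cong) (auto simp: \<sigma>_mult left_diff_distrib)
  also have "\<dots> \<in> jac" using N' a(1) \<sigma>_mem \<epsilon>\<sigma> by (intro jac_sum jac_rmult) auto
  finally have s: "s - \<epsilon> * c \<in> jac" .
  have sT: "s \<in> conj_ideal E"
  proof -
    have "\<sigma> x (\<epsilon> * a) \<in> conj_ideal E" if "x \<in> N'" for x
      using \<sigma>_conj_ideal[of x e] that N' e(1) conj_ideal_rmult[OF \<epsilon>T a(1)] unfolding E_def by blast
    thus ?thesis unfolding s_def
      by (induction N' rule: infinite_finite_induct) (auto intro: conj_ideal.add zT)
  qed
  obtain z where z: "z \<in> L" "z - s \<in> I" using tr[of "\<epsilon> * a"] \<epsilon>(2) a(1) mult_mem unfolding s_def by blast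
  have zR: "z \<in> R" using z L_sub by blast
  have cz: "c * z = z * c" using L_comm[OF cL z(1)] .
  have "(\<exists>w\<in>L. w * (z * c) = c) \<or> (\<exists>w\<in>L. w * (c - z * c) = c)"
    by (rule L.local_corner[OF semipotent_L c, where w = c])
      (use z cL cc cz in \<open>auto intro: L.mem_intros simp: mult.assoc right_diff_distrib\<close>,
       (metis mult.assoc)+)
  thus ?thesis
  proof
    assume "\<exists>w\<in>L. w * (z * c) = c"
    then obtain w where w: "w \<in> L" "w * (z * c) = c" by blast
    have wR: "w \<in> R" using w L_sub by blast
    \<comment> \<open>Here \<open>c\<close>, and therefore \<open>i\<close>, lies in the ideal generated by the conjugates, modulo \<open>I\<close>.\<close>
    define t where "t = i * w * s * c"
    have "t \<in> conj_ideal E" unfolding t_def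
      using sT iR wR cR by (intro conj_ideal_rmult conj_ideal_lmult mem_intros)
        (simp_all add: mult.assoc conj_ideal_lmult conj_ideal_rmult mult_mem)
    moreover have "i - t = (i * w) * (z - s) * c - (i * c - i)"
      using w by (simp add: t_def algebra_simps)
    moreover have "\<dots> \<in> I" by (rule I_diff[OF I_rmult[OF cR I_lmult[OF mult_mem[OF iR wR] z(2)]] i(3)])
    ultimately have t: "t \<in> conj_ideal E" "i - t \<in> I" by (simp_all only:)
    have "\<exists>e\<in>E. \<exists>w\<in>R. \<exists>r\<in>R. \<exists>r'\<in>R. w * (i * r * e * r' * i) = i"
      using primitive_absorbed_by_generator[OF semipotent_R i(1,2) E t] .
    thus ?thesis unfolding E_def by blast
  next
    assume "\<exists>w\<in>L. w * (c - z * c) = c"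
    then obtain w where w: "w \<in> L" "w * (c - z * c) = c" by blast
    have wR: "w \<in> R" using w L_sub by blast
    have \<epsilon>\<epsilon>: "\<epsilon> * \<epsilon> = \<epsilon>" using \<epsilon>(3) by (simp add: idem_def)
    have cw: "c = (c - z * c) * w" using w L_comm[of w "c - z * c"] z cL L.mem_intros by metis
    have zs: "z - \<epsilon> * c \<in> jac" using jac_add[OF s subsetD[OF I_sub_jac z(2)]] by simp
    have \<epsilon>c: "\<epsilon> * c = \<epsilon> * (c - z * c) * w" using cw by (metis mult.assoc)
    \<comment> \<open>Here \<open>\<epsilon>c\<close> is in the radical, and so is \<open>e\<close>, which agrees with \<open>e\<epsilon>c\<close> modulo the radical.\<close>
    have "\<epsilon> * (c - z * c) = - (\<epsilon> * (z - \<epsilon> * c) * c)"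
      using \<epsilon>\<epsilon> cc by (simp add: algebra_simps) (metis mult.assoc)
    also have "\<dots> \<in> jac" using zs \<epsilon>(2) cR by (intro jac_uminus jac_rmult jac_lmult)
    finally have "\<epsilon> * c \<in> jac" unfolding \<epsilon>c by (rule jac_rmult[OF wR])
    hence "e * (\<epsilon> * c) \<in> jac" using e jac_lmult by blast
    moreover have "e * (1 - \<epsilon>) * c \<in> jac" using jac_rmult[OF cR \<epsilon>r[OF eT]] .
    ultimately have "e * (\<epsilon> * c) + e * (1 - \<epsilon>) * c \<in> jac" by (rule jac_add)
    hence "e * c \<in> jac" by (simp add: algebra_simps)
    hence "e * c - (e * c - e) \<in> jac" by (rule jac_diff[OF _ subsetD[OF I_sub_jac e(4)]])
    hence "e \<in> jac" by simp
    hence "e \<in> I" using idem_in_jac e(2) by blast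
    thus ?thesis using e(3) by blast
  qed
qed
end


section \<open>Complete discrete valuation rings\<close>

text \<open>What is used of \<open>\<O>\<close>: it is a subring of the field, complete and separated with respect to the powers of
\<open>\<pi>\<close>, and \<open>res\<close> is its reduction modulo \<open>\<pi>\<close>.\<close>

locale residue_ring = subring_1 \<O> for \<O> :: "'k::field_char_0 set" +
  fixes \<pi> :: 'k and res :: "'k \<Rightarrow> 'r::field" and p :: nat
  assumes \<pi>_mem: "\<pi> \<in> \<O>"
    and separated: "(\<And>n. \<exists>b\<in>\<O>. z = \<pi> ^ n * b) \<Longrightarrow> z = 0"
    and complete: "(\<And>n. x n \<in> \<O>) \<Longrightarrow> (\<And>n. \<exists>b\<in>\<O>. x (Suc n) - x n = \<pi> ^ n * b) \<Longrightarrow>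
        \<exists>l\<in>\<O>. \<forall>n. \<exists>b\<in>\<O>. l - x n = \<pi> ^ n * b"
    and res_add: "a \<in> \<O> \<Longrightarrow> b \<in> \<O> \<Longrightarrow> res (a + b) = res a + res b"
    and res_mult: "a \<in> \<O> \<Longrightarrow> b \<in> \<O> \<Longrightarrow> res (a * b) = res a * res b"
    and res_one: "res 1 = 1"
    and res_surj: "res ` \<O> = UNIV"
    and res_ker: "a \<in> \<O> \<Longrightarrow> res a = 0 \<longleftrightarrow> (\<exists>b\<in>\<O>. a = \<pi> * b)"
    and char_p: "CHAR('r) = p" and prime_p: "Factorial_Ring.prime p"

lemma subring_record_simps [simp]:
  "carrier (subring_record S) = S" "monoid.mult (subring_record S) = (*)"
  "one (subring_record S) = 1" "zero (subring_record S) = 0" "add (subring_record S) = (+)"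
  by (simp_all add: subring_record_def ring_of_type_algebra_def fun_eq_iff)

text \<open>The kernel of \<open>res\<close> is a maximal ideal, hence the maximal ideal, and \<open>\<pi>\<close> is a generator of it. That the
powers of \<open>\<pi>\<close> have intersection \<open>0\<close> is Krull's argument in a principal ideal domain: a generator
\<open>d\<close> of the intersection satisfies \<open>d = \<pi> u d\<close>.\<close>

lemma residue_ring_if_complete_dvr:
  fixes \<O> :: "'k::field_char_0 set" and res :: "'k \<Rightarrow> 'r::field"
  assumes dvr: "complete_dvr (subring_record \<O>)" and res: "is_residue_map \<O> res"
    and char: "CHAR('r) = p" and p: "Factorial_Ring.prime p"
  shows "\<exists>\<pi>. residue_ring \<O> \<pi> res p"
proof -
  let ?R = "subring_record \<O>" and ?k = "ring_of_type_algebra :: 'r ring"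
  interpret R: principal_domain ?R using dvr by (simp add: complete_dvr_def is_dvr_def)
  have ex1: "\<exists>!M. maximalideal M ?R" using dvr by (simp add: complete_dvr_def is_dvr_def)
  have hom: "res \<in> ring_hom ?R ?k" and surj: "res ` \<O> = UNIV"
    using res by (auto simp: is_residue_map_def)
  have k: "ring ?k" by (rule ring_from_type_algebra)
  interpret h: ring_hom_ring ?R ?k res
    by (rule ring_hom_ringI2[OF R.ring_axioms k hom])
  have radd: "res (a + b) = res a + res b" and rmult: "res (a * b) = res a * res b"
    if "a \<in> \<O>" "b \<in> \<O>" for a b
    using h.hom_add[of a b] h.hom_mult[of a b] that by (simp_all add: ring_of_type_algebra_def)
  have rone: "res 1 = 1" using h.hom_one by (simp add: ring_of_type_algebra_def)
  have minus: "- b \<in> \<O> \<and> a_inv ?R b = - b" if "b \<in> \<O>" for b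
    using R.a_inv_closed[of b] R.r_neg[of b] that by (simp add: add_eq_0_iff)
  have diff: "a_minus ?R a b = a - b" if "b \<in> \<O>" for a b
    using minus[OF that] by (simp add: a_minus_def)
  have sub: "subring_1 \<O>"
  proof
    show "1 \<in> \<O>" using R.one_closed by simp
    show "a - b \<in> \<O>" "a * b \<in> \<O>" if "a \<in> \<O>" "b \<in> \<O>" for a b
      using R.minus_closed[of a b] R.m_closed[of a b] that diff by simp_all
  qed
  interpret O: subring_1 \<O> by (rule sub)
  define M where "M = {a\<in>\<O>. res a = 0}"
  have M: "ideal M ?R"
  proof -
    have "\<zero>\<^bsub>?k\<^esub> = 0" by (simp add: ring_of_type_algebra_def)
    hence "M = a_kernel ?R ?k res" unfolding M_def a_kernel_def' by simp
    thus ?thesis using h.kernel_is_ideal by (simp only:)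
  qed
  have max: "maximalideal M ?R"
  proof (rule maximalidealI[OF M])
    have "1 \<notin> M" using rone by (simp add: M_def)
    thus "carrier ?R \<noteq> M" using O.one_mem by auto
    fix J assume J: "ideal J ?R" "M \<subseteq> J" "J \<subseteq> carrier ?R"
    interpret J: ideal J ?R by (rule J)
    show "J = M \<or> J = carrier ?R"
    proof (cases "J = M")
      case False
      then obtain a where a: "a \<in> J" "a \<notin> M" using J by blast
      hence aO: "a \<in> \<O>" and ra: "res a \<noteq> 0" using J by (auto simp: M_def)
      obtain b where b: "b \<in> \<O>" "res b = inverse (res a)" using surj by (metis UNIV_I imageE)
      have "res (1 - a * b) + res (a * b) = 1" 
        using radd[of "1 - a * b" "a * b"] rone aO b by (simp add: O.mem_intros)
      hence "res (1 - a * b) = 0" using rmult[OF aO b(1)] b ra by simp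
      hence "1 - a * b \<in> J" using J aO b by (auto simp: M_def O.mem_intros)
      moreover have "a * b \<in> J" using J.I_r_closed[OF a(1)] b by simp
      ultimately have "1 \<in> J" using J.a_closed by force
      hence "J = carrier ?R" using J.one_imp_carrier by simp
      thus ?thesis by simp
    qed simp
  qed
  hence the: "the_maximal_ideal ?R = M" unfolding the_maximal_ideal_def by (rule the1_equality[OF ex1])
  obtain \<pi> where \<pi>: "\<pi> \<in> \<O>" "M = PIdl\<^bsub>?R\<^esub> \<pi>" using R.exists_gen[OF M] by auto
  have M\<pi>: "a \<in> M \<longleftrightarrow> (\<exists>b\<in>\<O>. a = \<pi> * b)" for a
    unfolding \<pi>(2) cgenideal_def by (auto simp: mult.commute)
  have pow: "a \<in> ideal_power ?R M n \<longleftrightarrow> (\<exists>b\<in>\<O>. a = \<pi> ^ n * b)" for n a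
  proof (induction n arbitrary: a)
    case 0
    show ?case by simp
  next
    case (Suc n)
    show ?case
    proof
      assume "a \<in> ideal_power ?R M (Suc n)"
      hence "a \<in> ideal_prod ?R M (ideal_power ?R M n)" by simp
      thus "\<exists>b\<in>\<O>. a = \<pi> ^ Suc n * b"
      proof induction
        case (prod i j)
        obtain b b' where "b \<in> \<O>" "i = \<pi> * b" "b' \<in> \<O>" "j = \<pi> ^ n * b'"
          using prod M\<pi> Suc by auto
        thus ?case by (intro bexI[of _ "b * b'"]) (auto intro: O.mem_intros)
      next
        case (sum s1 s2)
        then obtain b b' where "b \<in> \<O>" "s1 = \<pi> ^ Suc n * b" "b' \<in> \<O>" "s2 = \<pi> ^ Suc n * b'" by blast
        thus ?case by (intro bexI[of _ "b + b'"]) (auto intro: O.mem_intros simp: distrib_left)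
      qed
    next
      assume "\<exists>b\<in>\<O>. a = \<pi> ^ Suc n * b"
      then obtain b where b: "b \<in> \<O>" "a = \<pi> ^ Suc n * b" by blast
      have "\<pi> \<in> M" using M\<pi> O.one_mem by (metis mult.right_neutral)
      moreover have "\<pi> ^ n * b \<in> ideal_power ?R M n" using Suc b by blast
      ultimately have "\<pi> \<otimes>\<^bsub>?R\<^esub> (\<pi> ^ n * b) \<in> ideal_prod ?R M (ideal_power ?R M n)"
        by (rule ideal_prod.prod)
      thus "a \<in> ideal_power ?R M (Suc n)" using b by (simp add: mult.assoc)
    qed
  qed
  have "residue_ring \<O> \<pi> res p"
  proof (unfold_locales; (rule \<pi>(1) radd rmult rone surj char p; assumption?)?)
    show "\<exists>l\<in>\<O>. \<forall>n. \<exists>b\<in>\<O>. l - x n = \<pi> ^ n * b"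
      if x: "\<And>n. x n \<in> \<O>" "\<And>n. \<exists>b\<in>\<O>. x (Suc n) - x n = \<pi> ^ n * b" for x :: "nat \<Rightarrow> 'k"
      using dvr x unfolding complete_dvr_def adically_complete_def the
      by (auto simp: pow diff)
    show "res a = 0 \<longleftrightarrow> (\<exists>b\<in>\<O>. a = \<pi> * b)" if "a \<in> \<O>" for a
      using M\<pi>[of a] that by (auto simp: M_def)
    show "z = 0" if z: "\<And>n. \<exists>b\<in>\<O>. z = \<pi> ^ n * b" for z
    proof (cases "\<pi> = 0")
      case True
      thus ?thesis using z[of 1] by simp
    next
      case False
      define D where "D = {z. \<forall>n. \<exists>b\<in>\<O>. z = \<pi> ^ n * b}"
      have D: "\<exists>b\<in>\<O>. a = \<pi> ^ n * b" if "a \<in> D" for a n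
        using that unfolding D_def by blast
      have DO: "D \<subseteq> \<O>"
      proof
        fix a assume "a \<in> D"
        thus "a \<in> \<O>" using D[of a 0] by simp
      qed
      have D_uminus: "- a \<in> D" if aD: "a \<in> D" for a
        unfolding D_def
      proof safe
        fix n
        obtain b where "b \<in> \<O>" "a = \<pi> ^ n * b" using D[OF aD, of n] by blast
        thus "\<exists>b\<in>\<O>. - a = \<pi> ^ n * b" using O.uminus_mem by (intro bexI[of _ "- b"]) auto
      qed
      have D_add: "a + a' \<in> D" if aD: "a \<in> D" "a' \<in> D" for a a'
        unfolding D_def
      proof safe
        fix n
        obtain b b' where "b \<in> \<O>" "a = \<pi> ^ n * b" "b' \<in> \<O>" "a' = \<pi> ^ n * b'"
          using D[OF aD(1), of n] D[OF aD(2), of n] by blast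
        thus "\<exists>b\<in>\<O>. a + a' = \<pi> ^ n * b"
          using O.add_mem by (intro bexI[of _ "b + b'"]) (auto simp: distrib_left)
      qed
      have "ideal D ?R"
      proof (rule idealI[OF R.ring_axioms])
        show "subgroup D (add_monoid ?R)"
        proof (rule R.add.subgroupI)
          show "D \<subseteq> carrier ?R" using DO by simp
          have "0 \<in> D" unfolding D_def using O.zero_mem by (auto intro!: bexI[of _ 0])
          thus "D \<noteq> {}" by blast
          fix a assume a: "a \<in> D"
          show "\<ominus>\<^bsub>?R\<^esub> a \<in> D" using a DO minus[of a] by (simp add: subset_iff D_uminus)
          fix b assume b: "b \<in> D"
          show "a \<oplus>\<^bsub>?R\<^esub> b \<in> D" using a b by (simp add: D_add)
        qed
        fix a x assume a: "a \<in> D" and x: "x \<in> carrier ?R"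
        have "x * a \<in> D" unfolding D_def
        proof safe
          fix n
          obtain b where "b \<in> \<O>" "a = \<pi> ^ n * b" using D[OF a, of n] by blast
          thus "\<exists>b\<in>\<O>. x * a = \<pi> ^ n * b" using x
            by (intro bexI[of _ "x * b"]) (auto intro: O.mem_intros)
        qed
        thus "x \<otimes>\<^bsub>?R\<^esub> a \<in> D" "a \<otimes>\<^bsub>?R\<^esub> x \<in> D" by (simp_all add: mult.commute)
      qed
      then obtain d where d: "d \<in> \<O>" "D = PIdl\<^bsub>?R\<^esub> d" using R.exists_gen by auto
      have dD: "d \<in> D" using d R.cgenideal_self[of d] by simp
      obtain d' where d': "d' \<in> \<O>" "d = \<pi> * d'" using D[OF dD, of 1] by auto
      have "d' \<in> D" unfolding D_def
      proof safe
        fix n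
        obtain b where "b \<in> \<O>" "d = \<pi> ^ Suc n * b" using D[OF dD, of "Suc n"] by blast
        thus "\<exists>b\<in>\<O>. d' = \<pi> ^ n * b" using d' False by (auto intro!: bexI[of _ b])
      qed
      then obtain u where u: "u \<in> \<O>" "d' = u * d" unfolding d(2) cgenideal_def by auto
      have "d = 0"
      proof (rule ccontr)
        assume "d \<noteq> 0"
        hence "\<pi> * u = 1" using d' u by (metis mult.assoc mult_cancel_right1 mult.commute)
        hence "1 \<in> M" using M\<pi> u by metis
        thus False using rone by (simp add: M_def)
      qed
      moreover have "z \<in> D" using z by (simp add: D_def)
      ultimately show ?thesis unfolding d(2) cgenideal_def by simp
    qed
  qed
  thus ?thesis by blast
qed

context residue_ring
begin

lemma res_zero: "res 0 = 0"
  using res_add[OF zero_mem zero_mem] by (metis add.right_neutral add_left_cancel)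

lemma res_uminus: "a \<in> \<O> \<Longrightarrow> res (- a) = - res a"
  using res_add[of a "- a"] uminus_mem res_zero by (simp add: eq_neg_iff_add_eq_0 add.commute)

lemma res_diff: "a \<in> \<O> \<Longrightarrow> b \<in> \<O> \<Longrightarrow> res (a - b) = res a - res b"
  using res_add[of a "- b"] uminus_mem res_uminus by simp

lemma res_sum: "(\<And>x. x \<in> A \<Longrightarrow> h x \<in> \<O>) \<Longrightarrow> res (sum h A) = (\<Sum>x\<in>A. res (h x))"
  by (induction A rule: infinite_finite_induct) (auto simp: res_zero res_add sum_mem)

lemma of_nat_mem: "of_nat n \<in> \<O>"
  by (induction n) (auto intro: mem_intros)

lemma res_of_nat: "res (of_nat n) = of_nat n"
  by (induction n) (auto simp: res_zero res_add of_nat_mem mem_intros res_one)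

definition filt :: "nat \<Rightarrow> 'k set" where
  "filt n = {\<pi> ^ n * b | b. b \<in> \<O>}"

lemma filt_0: "filt 0 = \<O>" by (auto simp: filt_def)

lemma filt_1: "a \<in> filt 1 \<longleftrightarrow> a \<in> \<O> \<and> res a = 0"
  using res_ker by (auto simp: filt_def mem_intros \<pi>_mem)

lemmas filt_Suc_0 = filt_1[unfolded One_nat_def]

lemma filtI: "b \<in> \<O> \<Longrightarrow> \<pi> ^ n * b \<in> filt n"
  by (auto simp: filt_def)

lemma filtE:
  assumes "a \<in> filt n"
  obtains b where "b \<in> \<O>" "a = \<pi> ^ n * b"
  using assms by (auto simp: filt_def)

lemma filt_diff: "a \<in> filt n \<Longrightarrow> b \<in> filt n \<Longrightarrow> a - b \<in> filt n"
  by (elim filtE) (simp add: filtI diff_mem flip: right_diff_distrib)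

lemma filt_mult: assumes "a \<in> filt m" "b \<in> filt n" shows "a * b \<in> filt (m + n)"
proof -
  obtain a' b' where *: "a' \<in> \<O>" "a = \<pi> ^ m * a'" "b' \<in> \<O>" "b = \<pi> ^ n * b'"
    using assms by (metis filtE)
  hence "a * b = \<pi> ^ (m + n) * (a' * b')" by (simp add: power_add)
  thus ?thesis using filtI[OF mult_mem[OF *(1,3)], of "m + n"] by simp
qed

lemma filt_zero: "0 \<in> filt n"
  using filtI[OF zero_mem, of n] by simp

lemma filt_Suc: "filt (Suc n) \<subseteq> filt n"
proof
  fix a assume "a \<in> filt (Suc n)"
  then obtain b where "b \<in> \<O>" "a = \<pi> ^ n * (\<pi> * b)" by (auto elim!: filtE)
  thus "a \<in> filt n" using filtI mult_mem \<pi>_mem by blast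
qed

lemma filt_complete: "(\<And>n. x n \<in> \<O>) \<Longrightarrow> (\<And>n. x (Suc n) - x n \<in> filt n) \<Longrightarrow> \<exists>l\<in>\<O>. \<forall>n. l - x n \<in> filt n"
  using complete[of x] unfolding filt_def by blast

lemma filt_separated: "(\<And>n. z \<in> filt n) \<Longrightarrow> z = 0"
  using separated[of z] unfolding filt_def by blast

sublocale O_filt: complete_filtered_ring \<O> filt
  by unfold_locales (auto intro: filt_diff filt_mult filt_zero filt_complete filt_separated filt_Suc[THEN subsetD] simp: filt_0)

text \<open>If \<open>b\<close> lifts the inverse of \<open>res a\<close>, then \<open>ab\<close> is congruent to \<open>1\<close> and so invertible.\<close>

lemma unit_if_res_nonzero:
  assumes a: "a \<in> \<O>" "res a \<noteq> 0"
  shows "inverse a \<in> \<O>"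
proof -
  obtain b where b: "b \<in> \<O>" "res b = inverse (res a)" using res_surj by (metis UNIV_I imageE)
  have "res (1 - a * b) = 0" using a b by (simp add: res_diff res_mult mem_intros res_one)
  hence "1 - a * b \<in> filt 1" using a b by (simp add: filt_Suc_0 mem_intros)
  then obtain z where z: "z \<in> \<O>" "z * (1 - (1 - a * b)) = 1" using O_filt.one_minus_inverse by metis
  hence "a * (b * z) = 1" by (simp add: ac_simps)
  hence "inverse a = b * z" by (rule inverse_unique)
  thus ?thesis using b z by (simp add: mult_mem)
qed

lemma inverse_of_nat_mem:
  assumes "\<not> p dvd n"
  shows "inverse (of_nat n) \<in> \<O>"
  using assms char_p by (intro unit_if_res_nonzero of_nat_mem) (simp add: res_of_nat of_nat_eq_0_iff_char_dvd)

lemma p_times_mem: "a \<in> \<O> \<Longrightarrow> of_nat p * a \<in> filt 1"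
  using char_p of_nat_CHAR[where 'a = 'r] by (simp add: filt_Suc_0 mult_mem of_nat_mem res_mult res_of_nat)

end


section \<open>Group algebras as subrings of endomorphism rings\<close>

text \<open>The group algebra depends on the group, so it is not a type. The additive endomorphisms of a type form a
ring in the sense of type classes, and the group algebra is mapped into such a ring by left
multiplication; the ring theory above then applies to the images of its subalgebras.\<close>

typedef (overloaded) 'v add_endo = "{h :: 'v::{ab_group_add,zero_neq_one} \<Rightarrow> 'v. \<forall>x y. h (x + y) = h x + h y}"
  morphisms app Add_Endo
  by (rule exI[of _ id]) simp

setup_lifting type_definition_add_endo

instantiation add_endo :: ("{ab_group_add,zero_neq_one}") ring_1
begin

lift_definition zero_add_endo :: "'a add_endo" is "\<lambda>_. 0" by simp
lift_definition one_add_endo :: "'a add_endo" is "\<lambda>v. v" by simp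
lift_definition plus_add_endo :: "'a add_endo \<Rightarrow> 'a add_endo \<Rightarrow> 'a add_endo" is "\<lambda>h k v. h v + k v"
  by (simp add: algebra_simps)
lift_definition uminus_add_endo :: "'a add_endo \<Rightarrow> 'a add_endo" is "\<lambda>h v. - h v"
  by (simp add: algebra_simps)
lift_definition minus_add_endo :: "'a add_endo \<Rightarrow> 'a add_endo \<Rightarrow> 'a add_endo" is "\<lambda>h k v. h v - k v"
  by (simp add: algebra_simps)
lift_definition times_add_endo :: "'a add_endo \<Rightarrow> 'a add_endo \<Rightarrow> 'a add_endo" is "\<lambda>h k v. h (k v)"
  by simp

instance
proof
  show "(0 :: 'a add_endo) \<noteq> 1"
    by transfer (metis zero_neq_one)
qed (transfer; force simp: algebra_simps)+

end

lemma sum_fun_apply: "(\<Sum>x\<in>A. h x) y = (\<Sum>x\<in>A. h x y)"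
  by (induction A rule: infinite_finite_induct) auto

locale finite_group = group G for G (structure) +
  assumes fin: "finite (carrier G)"
begin

lemma conj_inv_cancel:
  assumes "u \<in> carrier G" "x \<in> carrier G"
  shows "inv u \<otimes> (u \<otimes> x \<otimes> inv u) \<otimes> u = x" "u \<otimes> (inv u \<otimes> x \<otimes> u) \<otimes> inv u = x"
  using assms by (simp_all add: m_assoc) (simp_all add: m_assoc[symmetric])

lemma sum_shift: "x \<in> carrier G \<Longrightarrow> (\<Sum>y\<in>carrier G. h (x \<otimes> y)) = sum h (carrier G)"
  by (rule sum.reindex_bij_witness[of _ "\<lambda>y. inv x \<otimes> y" "\<lambda>y. x \<otimes> y"])
    (auto simp: m_assoc[symmetric])

lemma conv_supp: "x \<notin> carrier G \<Longrightarrow> conv G a b x = 0"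
  by (simp add: conv_def)

lemma conv_cong:
  assumes "\<And>x. x \<in> carrier G \<Longrightarrow> a x = a' x" "\<And>x. x \<in> carrier G \<Longrightarrow> b x = b' x"
  shows "conv G a b = conv G a' b'"
  using assms by (auto simp: conv_def fun_eq_iff intro!: sum.cong)

lemma conv_assoc: "conv G (conv G a b) v = conv G a (conv G b v)"
proof
  fix x
  show "conv G (conv G a b) v x = conv G a (conv G b v) x"
  proof (cases "x \<in> carrier G")
    case True
    have "conv G (conv G a b) v x = (\<Sum>y\<in>carrier G. \<Sum>z\<in>carrier G. a z * b (inv z \<otimes> y) * v (inv y \<otimes> x))"
      using True by (simp add: conv_def sum_distrib_right)
    also have "\<dots> = (\<Sum>z\<in>carrier G. \<Sum>y\<in>carrier G. a z * b (inv z \<otimes> y) * v (inv y \<otimes> x))"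
      by (rule sum.swap)
    also have "\<dots> = (\<Sum>z\<in>carrier G. \<Sum>y\<in>carrier G. a z * b y * v (inv y \<otimes> (inv z \<otimes> x)))"
    proof (rule sum.cong[OF refl])
      fix z assume z: "z \<in> carrier G"
      show "(\<Sum>y\<in>carrier G. a z * b (inv z \<otimes> y) * v (inv y \<otimes> x))
          = (\<Sum>y\<in>carrier G. a z * b y * v (inv y \<otimes> (inv z \<otimes> x)))"
        using z True by (subst sum_shift[OF z, symmetric])
          (auto simp: inv_mult_group m_assoc[symmetric] intro!: sum.cong)
    qed
    also have "\<dots> = conv G a (conv G b v) x"
      using True by (auto simp: conv_def sum_distrib_left mult.assoc intro!: sum.cong)
    finally show ?thesis .
  qed (simp add: conv_def)
qed

lemma conv_grp_elt_left: "u \<in> carrier G \<Longrightarrow> x \<in> carrier G \<Longrightarrow> conv G (grp_elt u) a x = a (inv u \<otimes> x)"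
  by (simp add: conv_def grp_elt_def fin if_distrib[of "\<lambda>t. t * _"] sum.delta cong: if_cong)

lemma conv_grp_elt_right:
  assumes "u \<in> carrier G" "x \<in> carrier G"
  shows "conv G a (grp_elt u) x = a (x \<otimes> inv u)"
proof -
  have "inv y \<otimes> x = u \<longleftrightarrow> y = x \<otimes> inv u" if "y \<in> carrier G" for y
    using assms that by (metis inv_closed inv_inv inv_mult_group inv_solve_left inv_solve_right m_closed)
  hence "conv G a (grp_elt u) x = (\<Sum>y\<in>carrier G. if y = x \<otimes> inv u then a y else 0)"
    using assms by (auto simp: conv_def grp_elt_def intro!: sum.cong)
  thus ?thesis using assms by (simp add: fin)
qed

lemma conv_add_left: "conv G (a + b) v = conv G a v + conv G b v"
  by (auto simp: conv_def fun_eq_iff distrib_right sum.distrib)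
lemma conv_add_right: "conv G v (a + b) = conv G v a + conv G v b"
  by (auto simp: conv_def fun_eq_iff distrib_left sum.distrib)
lemma conv_diff_left: "conv G (a - b) v = conv G a v - conv G b v"
  by (auto simp: conv_def fun_eq_iff left_diff_distrib sum_subtractf)
lemma conv_diff_right: "conv G v (a - b) = conv G v a - conv G v b"
  by (auto simp: conv_def fun_eq_iff right_diff_distrib sum_subtractf)
lemma conv_scale_left: "conv G (fscale c a) v = fscale c (conv G a v)"
  by (auto simp: conv_def fun_eq_iff fscale_def sum_distrib_left mult.assoc)
lemma conv_scale_right: "conv G v (fscale c a) = fscale c (conv G v a)"
  by (auto simp: conv_def fun_eq_iff fscale_def sum_distrib_left mult.left_commute)

lemma conj_act_apply:
  "u \<in> carrier G \<Longrightarrow> x \<in> carrier G \<Longrightarrow> conj_act G u a x = a (inv u \<otimes> x \<otimes> u)"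
  by (simp add: conj_act_def conv_grp_elt_right conv_grp_elt_left m_assoc)

lemma conj_act_supp: "x \<notin> carrier G \<Longrightarrow> conj_act G u a x = 0"
  by (simp add: conj_act_def conv_supp)

definition supp :: "('a \<Rightarrow> 'c::zero) set" where
  "supp = {a. \<forall>x. x \<notin> carrier G \<longrightarrow> a x = 0}"

lemma conv_in_supp [simp]: "conv G a b \<in> supp"
  by (simp add: supp_def conv_supp)

lemma grp_elt_in_supp: "u \<in> carrier G \<Longrightarrow> grp_elt u \<in> supp"
  by (auto simp: supp_def grp_elt_def)

lemma conv_one_right: "a \<in> supp \<Longrightarrow> conv G a (grp_elt \<one>) = a"
proof
  fix x
  assume "a \<in> supp"
  thus "conv G a (grp_elt \<one>) x = a x"
    by (cases "x \<in> carrier G") (auto simp: supp_def conv_grp_elt_right conv_supp)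
qed

lemma conv_one_left: "a \<in> supp \<Longrightarrow> conv G (grp_elt \<one>) a = a"
proof
  fix x
  assume "a \<in> supp"
  thus "conv G (grp_elt \<one>) a x = a x"
    by (cases "x \<in> carrier G") (auto simp: supp_def conv_grp_elt_left conv_supp)
qed

lemma grp_elt_mult:
  assumes "x \<in> carrier G" "y \<in> carrier G"
  shows "conv G (grp_elt x) (grp_elt y) = (grp_elt (x \<otimes> y) :: 'a \<Rightarrow> 'c::comm_ring_1)"
proof
  fix z
  have "inv x \<otimes> z = y \<longleftrightarrow> z = x \<otimes> y" if "z \<in> carrier G"
    using that assms by (metis inv_closed inv_inv inv_solve_left)
  hence "conv G (grp_elt x) (grp_elt y) z = (grp_elt (x \<otimes> y) z :: 'c)" if "z \<in> carrier G"
    unfolding conv_grp_elt_left[OF assms(1) that] using that by (simp add: grp_elt_def)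
  moreover have "grp_elt (x \<otimes> y) z = (0 :: 'c)" if "z \<notin> carrier G"
    using that assms by (auto simp: grp_elt_def)
  ultimately show "conv G (grp_elt x) (grp_elt y) z = (grp_elt (x \<otimes> y) z :: 'c)"
    using conv_supp[of z] by metis
qed

lemma supp_expansion:
  fixes a :: "'a \<Rightarrow> 'c::field"
  assumes "a \<in> supp"
  shows "a = (\<Sum>x\<in>carrier G. fscale (a x) (grp_elt x))"
proof
  fix y
  show "a y = (\<Sum>x\<in>carrier G. fscale (a x) (grp_elt x)) y"
    using assms by (auto simp: sum_fun_apply fscale_def grp_elt_def supp_def fin if_distrib cong: if_cong)
qed

lemma supp_span: "supp = fvec.span (grp_elt ` carrier G :: ('a \<Rightarrow> 'c::field) set)"
proof
  show "supp \<subseteq> fvec.span (grp_elt ` carrier G :: ('a \<Rightarrow> 'c) set)"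
  proof
    fix a :: "'a \<Rightarrow> 'c" assume a: "a \<in> supp"
    have "(\<Sum>x\<in>carrier G. fscale (a x) (grp_elt x)) \<in> fvec.span (grp_elt ` carrier G)"
      by (intro fvec.span_sum fvec.span_scale fvec.span_base imageI)
    thus "a \<in> fvec.span (grp_elt ` carrier G)" unfolding supp_expansion[OF a, symmetric] .
  qed
  have "fvec.subspace (supp :: ('a \<Rightarrow> 'c) set)"
    by (rule fvec.subspaceI) (auto simp: supp_def fscale_def)
  thus "fvec.span (grp_elt ` carrier G :: ('a \<Rightarrow> 'c) set) \<subseteq> supp"
    by (intro fvec.span_minimal) (auto intro: grp_elt_in_supp)
qed

text \<open>The augmentation homomorphism.\<close>

definition aug :: "('a \<Rightarrow> 'c::comm_ring_1) \<Rightarrow> 'c" where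
  "aug a = sum a (carrier G)"

lemma aug_conv: "aug (conv G a b) = aug a * aug b"
proof -
  have "aug (conv G a b) = (\<Sum>x\<in>carrier G. \<Sum>y\<in>carrier G. a y * b (inv y \<otimes> x))"
    by (simp add: aug_def conv_def)
  also have "\<dots> = (\<Sum>y\<in>carrier G. \<Sum>x\<in>carrier G. a y * b (inv y \<otimes> x))" by (rule sum.swap)
  also have "\<dots> = (\<Sum>y\<in>carrier G. \<Sum>x\<in>carrier G. a y * b x)"
    by (intro sum.cong refl sum_shift[where h = "\<lambda>x. _ * b x"]) simp
  also have "\<dots> = aug a * aug b" by (simp add: aug_def sum_product)
  finally show ?thesis .
qed

text \<open>Left multiplication by \<open>a\<close> alone would not map the unit element to the identity, because convolution
discards what lies outside of the group. There the scalar \<open>aug a\<close> acts instead, which keeps the map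
multiplicative.\<close>

definition lmul :: "('a \<Rightarrow> 'c::comm_ring_1) \<Rightarrow> ('a \<Rightarrow> 'c) add_endo" where
  "lmul a = Add_Endo (\<lambda>v x. if x \<in> carrier G then conv G a v x else aug a * v x)"

lemma app_lmul: "app (lmul a) v x = (if x \<in> carrier G then conv G a v x else aug a * v x)"
  unfolding lmul_def
  by (subst Add_Endo_inverse) (auto simp: fun_eq_iff conv_add_right distrib_left)

lemma add_endo_eqI: "(\<And>v x. app h v x = app k v x) \<Longrightarrow> h = k" for h k :: "('a \<Rightarrow> 'c::comm_ring_1) add_endo"
  by (metis app_inject ext)

lemma lmul_conv: "lmul (conv G a b) = lmul a * lmul b"
proof (rule add_endo_eqI)
  fix v x
  have "conv G a (conv G b v) = conv G a (app (lmul b) v)"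
    by (rule conv_cong) (auto simp: app_lmul)
  thus "app (lmul (conv G a b)) v x = app (lmul a * lmul b) v x"
    by (auto simp: app_lmul times_add_endo.rep_eq conv_assoc aug_conv mult.assoc)
qed

lemma aug_grp_elt: "u \<in> carrier G \<Longrightarrow> aug (grp_elt u) = 1"
  by (simp add: aug_def grp_elt_def fin)

lemma lmul_one: "lmul (grp_elt \<one>) = 1"
  by (rule add_endo_eqI) (simp add: app_lmul one_add_endo.rep_eq conv_grp_elt_left aug_grp_elt)

lemma lmul_add: "lmul (a + b) = lmul a + lmul b"
  by (rule add_endo_eqI)
    (simp add: app_lmul plus_add_endo.rep_eq conv_add_left aug_def sum.distrib distrib_right)

lemma lmul_diff: "lmul (a - b) = lmul a - lmul b"
  by (rule add_endo_eqI)
    (simp add: app_lmul minus_add_endo.rep_eq conv_diff_left aug_def sum_subtractf left_diff_distrib)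

lemma lmul_zero: "lmul 0 = 0"
  using lmul_diff[of 0 0] by simp

text \<open>A left inverse of \<open>lmul\<close>: the coefficients are recovered from the value at the unit element.\<close>

definition coef :: "('a \<Rightarrow> 'c::comm_ring_1) add_endo \<Rightarrow> 'a \<Rightarrow> 'c" where
  "coef h = app h (grp_elt \<one>)"

lemma coef_lmul:
  fixes a :: "'a \<Rightarrow> 'c::comm_ring_1"
  assumes "a \<in> supp"
  shows "coef (lmul a) = a"
proof
  fix x
  have "conv G a (grp_elt \<one>) x = a x" using conv_one_right[OF assms] by simp
  moreover have "x \<notin> carrier G \<Longrightarrow> a x = 0" "x \<notin> carrier G \<Longrightarrow> grp_elt \<one> x = (0 :: 'c)"
    using assms by (auto simp: supp_def grp_elt_def)
  ultimately show "coef (lmul a) x = a x" by (simp add: coef_def app_lmul)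
qed

lemma coef_diff: "coef (h - k) = coef h - coef k"
  by (simp add: coef_def minus_add_endo.rep_eq fun_eq_iff)

lemma coef_add: "coef (h + k) = coef h + coef k"
  by (simp add: coef_def plus_add_endo.rep_eq fun_eq_iff)

lemma lmul_inj: "a \<in> supp \<Longrightarrow> b \<in> supp \<Longrightarrow> lmul a = lmul b \<Longrightarrow> a = b"
  by (metis coef_lmul)

lemma lmul_sum: "lmul (\<Sum>x\<in>A. h x) = (\<Sum>x\<in>A. lmul (h x))"
proof (induction A rule: infinite_finite_induct)
  case (insert x F)
  show ?case unfolding sum.insert[OF insert(1,2)] lmul_add insert(3) by (rule refl)
qed (simp_all only: sum.infinite sum.empty lmul_zero not_False_eq_True)

end

text \<open>Otherwise the vectors \<open>w n\<close>, taken from the last to the first among \<open>card S + 1\<close> of them, would be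
linearly independent.\<close>

lemma exists_dependent_tail:
  fixes w :: "nat \<Rightarrow> 'b \<Rightarrow> 'k::field"
  assumes S: "finite S" "\<And>n. w n \<in> fvec.span S"
  shows "\<exists>n. w n \<in> fvec.span (w ` {n<..})"
proof (rule ccontr)
  assume no: "\<not> ?thesis"
  define D where "D = Suc (card S)"
  have "\<not> fvec.dependent (w ` {D - m..<D}) \<and> card (w ` {D - m..<D}) = m" if "m \<le> D" for m
    using that
  proof (induction m)
    case 0
    show ?case by (simp add: fvec.independent_empty)
  next
    case (Suc m)
    define k where "k = D - Suc m"
    have k: "{k..<D} = insert k {D - m..<D}" using Suc.prems by (auto simp: k_def)
    have "w k \<notin> fvec.span (w ` {k<..})" using no by blast
    moreover have "fvec.span (w ` {D - m..<D}) \<subseteq> fvec.span (w ` {k<..})"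
      using Suc.prems by (intro fvec.span_mono image_mono) (auto simp: k_def)
    ultimately have nk: "w k \<notin> fvec.span (w ` {D - m..<D})" by blast
    hence "w k \<notin> w ` {D - m..<D}" using fvec.span_base by blast
    thus ?case using Suc nk unfolding k_def[symmetric] k
      by (simp add: fvec.independent_insertI)
  qed
  from this[of D] have "\<not> fvec.dependent (w ` {0..<D})" "card (w ` {0..<D}) = D" by simp_all
  moreover have "w ` {0..<D} \<subseteq> fvec.span S" using S by blast
  ultimately show False using fvec.independent_span_bound[OF S(1), of "w ` {0..<D}"]
    by (simp add: D_def)
qed

locale group_algebra = finite_group G + residue_ring \<O> \<pi> res p
  for G :: "('g, 'm) monoid_scheme" (structure) and \<O> :: "'k::field_char_0 set"
    and \<pi> and res :: "'k \<Rightarrow> 'r::field" and p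
begin

text \<open>The elements of \<open>\<O>H\<close> that are fixed under conjugation by \<open>Q\<close>, inside of \<open>\<O>G\<close>. Invariance is
expressed by coefficients; so it visibly passes to limits. For \<open>H = Q\<close> this is the center of \<open>\<O>H\<close>.\<close>

definition fixalg :: "'g set \<Rightarrow> 'g set \<Rightarrow> ('g \<Rightarrow> 'k) set" where
  "fixalg H Q = {a. (\<forall>x. a x \<in> \<O>) \<and> (\<forall>x. x \<notin> H \<longrightarrow> a x = 0) \<and>
     (\<forall>u\<in>Q. \<forall>x\<in>carrier G. a (u \<otimes> x \<otimes> inv u) = a x)}"

lemma fixalg_supp: "H \<subseteq> carrier G \<Longrightarrow> fixalg H Q \<subseteq> supp"
  by (auto simp: fixalg_def supp_def)

lemma fixalg_inv: "a \<in> fixalg H Q \<Longrightarrow> u \<in> Q \<Longrightarrow> x \<in> carrier G \<Longrightarrow> a (u \<otimes> x \<otimes> inv u) = a x"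
  by (simp add: fixalg_def)

lemma fixalg_diff: "a \<in> fixalg H Q \<Longrightarrow> b \<in> fixalg H Q \<Longrightarrow> a - b \<in> fixalg H Q"
  by (auto simp: fixalg_def diff_mem)

lemma conv_closed: "\<forall>x. a x \<in> \<O> \<Longrightarrow> \<forall>x. b x \<in> \<O> \<Longrightarrow> conv G a b x \<in> \<O>"
  by (auto simp: conv_def zero_mem intro!: sum_mem mult_mem)

lemma conv_supp_subgroup:
  assumes H: "subgroup H G" and a: "\<forall>x. x \<notin> H \<longrightarrow> a x = 0" and b: "\<forall>x. x \<notin> H \<longrightarrow> b x = 0"
    and x: "x \<notin> H"
  shows "conv G a b x = 0"
proof (cases "x \<in> carrier G")
  case True
  have "a y * b (inv y \<otimes> x) = 0" if y: "y \<in> carrier G" for y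
  proof (rule ccontr)
    assume "a y * b (inv y \<otimes> x) \<noteq> 0"
    hence "y \<in> H" "inv y \<otimes> x \<in> H" using a b by force+
    hence "y \<otimes> (inv y \<otimes> x) \<in> H" using H by (simp add: subgroup.m_closed)
    thus False using x True y by (simp add: m_assoc[symmetric])
  qed
  thus ?thesis by (simp add: conv_def)
qed (simp add: conv_supp)

lemma fixalg_conv:
  assumes H: "subgroup H G" and Q: "Q \<subseteq> carrier G" and a: "a \<in> fixalg H Q" and b: "b \<in> fixalg H Q"
  shows "conv G a b \<in> fixalg H Q"
proof -
  have "conv G a b (u \<otimes> x \<otimes> inv u) = conv G a b x" if u: "u \<in> Q" and x: "x \<in> carrier G" for u x
  proof -
    have uG: "u \<in> carrier G" using u Q by blast
    have "conv G a b (u \<otimes> x \<otimes> inv u) = (\<Sum>y\<in>carrier G. a y * b (inv y \<otimes> (u \<otimes> x \<otimes> inv u)))"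
      using uG x by (simp add: conv_def)
    also have "\<dots> = (\<Sum>y\<in>carrier G. a y * b (inv y \<otimes> x))"
    proof (rule sum.reindex_bij_witness[of _ "\<lambda>y. u \<otimes> y \<otimes> inv u" "\<lambda>y. inv u \<otimes> y \<otimes> u"])
      fix y assume y: "y \<in> carrier G"
      show "u \<otimes> (inv u \<otimes> y \<otimes> u) \<otimes> inv u = y" "inv u \<otimes> (u \<otimes> y \<otimes> inv u) \<otimes> u = y"
        by (rule conj_inv_cancel[OF uG y])+
      show "inv u \<otimes> y \<otimes> u \<in> carrier G" "u \<otimes> y \<otimes> inv u \<in> carrier G" using uG y by simp_all
      note e1 = conj_inv_cancel(2)[OF uG y]
      have e2: "inv y \<otimes> (u \<otimes> x \<otimes> inv u) = u \<otimes> (inv (inv u \<otimes> y \<otimes> u) \<otimes> x) \<otimes> inv u"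
        using uG x y by (simp add: m_assoc inv_mult_group) (simp add: m_assoc[symmetric])
      have a1: "a (inv u \<otimes> y \<otimes> u) = a y"
        using fixalg_inv[OF a u, of "inv u \<otimes> y \<otimes> u"] uG y unfolding e1 by simp
      have b1: "b (inv y \<otimes> (u \<otimes> x \<otimes> inv u)) = b (inv (inv u \<otimes> y \<otimes> u) \<otimes> x)"
        unfolding e2 using uG x y by (intro fixalg_inv[OF b u]) simp
      show "a (inv u \<otimes> y \<otimes> u) * b (inv (inv u \<otimes> y \<otimes> u) \<otimes> x) = a y * b (inv y \<otimes> (u \<otimes> x \<otimes> inv u))"
        using a1 b1 by simp
    qed
    also have "\<dots> = conv G a b x" using x by (simp add: conv_def)
    finally show ?thesis .
  qed
  moreover have "conv G a b x \<in> \<O>" for x using a b conv_closed by (auto simp: fixalg_def)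
  moreover have "conv G a b x = 0" if "x \<notin> H" for x
    using conv_supp_subgroup[OF H _ _ that] a b by (auto simp: fixalg_def)
  ultimately show ?thesis by (simp add: fixalg_def)
qed

lemma grp_elt_one_fixalg: "subgroup H G \<Longrightarrow> Q \<subseteq> carrier G \<Longrightarrow> grp_elt \<one> \<in> fixalg H Q"
proof -
  assume H: "subgroup H G" and Q: "Q \<subseteq> carrier G"
  have "u \<otimes> x \<otimes> inv u = \<one> \<longleftrightarrow> x = \<one>" if "u \<in> Q" "x \<in> carrier G" for u x
  proof -
    have uG: "u \<in> carrier G" using Q that by blast
    show ?thesis using conj_inv_cancel(1)[OF uG that(2)] uG by auto
  qed
  thus ?thesis using subgroup.one_closed[OF H] by (auto simp: fixalg_def grp_elt_def zero_mem one_mem)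
qed

lemma scale_fixalg: "c \<in> \<O> \<Longrightarrow> a \<in> fixalg H Q \<Longrightarrow> fscale c a \<in> fixalg H Q"
  by (auto simp: fixalg_def fscale_def mult_mem)

lemma subring_fixalg:
  assumes H: "subgroup H G" and Q: "Q \<subseteq> carrier G"
  shows "subring_1 (lmul ` fixalg H Q)"
proof
  show "1 \<in> lmul ` fixalg H Q" using grp_elt_one_fixalg[OF H Q] lmul_one by (metis image_eqI)
  fix a b assume "a \<in> lmul ` fixalg H Q" "b \<in> lmul ` fixalg H Q"
  thus "a - b \<in> lmul ` fixalg H Q" "a * b \<in> lmul ` fixalg H Q"
    using fixalg_diff fixalg_conv[OF H Q] by (auto simp flip: lmul_diff lmul_conv)
qed

lemma complete_filtered_fixalg:
  assumes H: "subgroup H G" and Q: "Q \<subseteq> carrier G"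
  shows "complete_filtered_ring (lmul ` fixalg H Q) (\<lambda>n. lmul ` {a \<in> fixalg H Q. \<forall>x. a x \<in> filt n})"
proof -
  have Hs: "fixalg H Q \<subseteq> supp" using fixalg_supp[OF subgroup.subset[OF H]] .
  have sep: "a = 0" if aR: "a \<in> fixalg H Q" and aF: "\<And>n. lmul a \<in> lmul ` {a \<in> fixalg H Q. \<forall>x. a x \<in> filt n}" for a
  proof -
    have "a x \<in> filt n" for n x
    proof -
      obtain b where "b \<in> fixalg H Q" "\<forall>x. b x \<in> filt n" "lmul a = lmul b" using aF[of n] by blast
      thus ?thesis using lmul_inj[of a b] aR Hs by auto
    qed
    thus ?thesis using filt_separated by (auto simp: fun_eq_iff)
  qed
  interpret S: subring_1 "lmul ` fixalg H Q" by (rule subring_fixalg[OF H Q])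
  show ?thesis
  proof
    show "lmul ` {a \<in> fixalg H Q. \<forall>x. a x \<in> filt 0} = lmul ` fixalg H Q"
      by (auto simp: filt_0 fixalg_def)
    show "0 \<in> lmul ` {a \<in> fixalg H Q. \<forall>x. a x \<in> filt n}" for n
      by (rule image_eqI[of _ _ 0]) (auto simp: lmul_zero fixalg_def filt_zero zero_mem)
    show "lmul ` {a \<in> fixalg H Q. \<forall>x. a x \<in> filt (Suc n)} \<subseteq> lmul ` {a \<in> fixalg H Q. \<forall>x. a x \<in> filt n}" for n
      using filt_Suc by fast
    show "a - b \<in> lmul ` {a \<in> fixalg H Q. \<forall>x. a x \<in> filt n}"
      if "a \<in> lmul ` {a \<in> fixalg H Q. \<forall>x. a x \<in> filt n}" "b \<in> lmul ` {a \<in> fixalg H Q. \<forall>x. a x \<in> filt n}" for a b n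
      using that fixalg_diff filt_diff by (auto simp flip: lmul_diff intro!: imageI)
    show "a * b \<in> lmul ` {a \<in> fixalg H Q. \<forall>x. a x \<in> filt (m + n)}"
      if ab: "a \<in> lmul ` {a \<in> fixalg H Q. \<forall>x. a x \<in> filt m}" "b \<in> lmul ` {a \<in> fixalg H Q. \<forall>x. a x \<in> filt n}" for a b m n
    proof -
      obtain a' b' where a': "a' \<in> fixalg H Q" "\<forall>x. a' x \<in> filt m" "a = lmul a'"
        and b': "b' \<in> fixalg H Q" "\<forall>x. b' x \<in> filt n" "b = lmul b'" using ab by auto
      have "conv G a' b' x \<in> filt (m + n)" for x
      proof (cases "x \<in> carrier G")
        case True
        have "(\<Sum>y\<in>A. a' y * b' (inv y \<otimes> x)) \<in> filt (m + n)" for A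
          using a' b' by (induction A rule: infinite_finite_induct)
            (auto intro: O_filt.F_add filt_mult filt_zero)
        thus ?thesis using True by (simp add: conv_def)
      qed (simp add: conv_supp filt_zero)
      thus ?thesis unfolding a' b' lmul_conv[symmetric] using fixalg_conv[OF H Q] a' b' by blast
    qed
    show "z = 0" if zF: "\<And>n. z \<in> lmul ` {a \<in> fixalg H Q. \<forall>x. a x \<in> filt n}" for z
    proof -
      obtain a where "a \<in> fixalg H Q" "z = lmul a" using zF[of 0] by blast
      thus ?thesis using sep[of a] zF lmul_zero by simp
    qed
    fix x :: "nat \<Rightarrow> ('g \<Rightarrow> 'k) add_endo"
    assume x: "\<And>n. x n \<in> lmul ` fixalg H Q" 
      and xd: "\<And>n. x (Suc n) - x n \<in> lmul ` {a \<in> fixalg H Q. \<forall>x. a x \<in> filt n}"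
    define a where "a n = coef (x n)" for n
    have a: "a n \<in> fixalg H Q" "x n = lmul (a n)" for n
      using x[of n] Hs by (auto simp: a_def coef_lmul)
    have ad: "a (Suc n) y - a n y \<in> filt n" for n y
    proof -
      obtain d where d: "d \<in> fixalg H Q" "\<forall>x. d x \<in> filt n" "x (Suc n) - x n = lmul d" using xd[of n] by auto
      have "a (Suc n) - a n = d" unfolding a_def coef_diff[symmetric] d(3) using d(1) Hs by (auto simp: coef_lmul)
      thus ?thesis using d(2) by (metis fun_diff_def)
    qed
    have "\<exists>l\<in>\<O>. \<forall>n. l - a n y \<in> filt n" for y
      using filt_complete[of "\<lambda>n. a n y"] a(1) ad by (simp add: fixalg_def)
    then obtain l where l: "\<And>y. l y \<in> \<O>" "\<And>y n. l y - a n y \<in> filt n" by metis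
    have uniq: "l y = l z" if "\<And>n. a n y = a n z" for y z
    proof -
      have "l y - l z \<in> filt n" for n
        using filt_diff[OF l(2)[of y n] l(2)[of z n]] that by simp
      thus ?thesis using filt_separated[of "l y - l z"] by simp
    qed
    have l0: "l y = 0" if "y \<notin> H" for y
      using filt_separated[of "l y"] l(2)[of y] a(1) that by (simp add: fixalg_def)
    have "l (u \<otimes> y \<otimes> inv u) = l y" if uy: "u \<in> Q" "y \<in> carrier G" for u y
      by (rule uniq) (rule fixalg_inv[OF a(1) uy])
    hence lR: "l \<in> fixalg H Q" unfolding fixalg_def using l(1) l0 by blast
    have "lmul l - x n \<in> lmul ` {a \<in> fixalg H Q. \<forall>x. a x \<in> filt n}" for n
      unfolding a(2) lmul_diff[symmetric] using fixalg_diff[OF lR a(1)[of n]] l(2)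
      by (auto intro!: imageI)
    thus "\<exists>l\<in>lmul ` fixalg H Q. \<forall>n. l - x n \<in> lmul ` {a \<in> fixalg H Q. \<forall>x. a x \<in> filt n}"
      using lR by blast
  qed
qed

text \<open>Modulo \<open>\<pi>\<close> the algebra has finite dimension, so some power \<open>y\<^sup>n\<close> is a linear combination of higher
powers of \<open>y\<close>, which is what Fitting's lemma asks for.\<close>

lemma semipotent_fixalg:
  assumes H: "subgroup H G" and Q: "Q \<subseteq> carrier G"
  shows "semipotent (lmul ` fixalg H Q)"
proof -
  let ?R = "lmul ` fixalg H Q" and ?F = "\<lambda>n. lmul ` {a \<in> fixalg H Q. \<forall>x. a x \<in> filt n}"
  have Hs: "fixalg H Q \<subseteq> supp" using fixalg_supp[OF subgroup.subset[OF H]] .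
  interpret R: complete_filtered_ring ?R ?F by (rule complete_filtered_fixalg[OF H Q])
  define red where "red z = (\<lambda>x. res (coef z x))" for z
  have coefR: "coef z \<in> fixalg H Q" "z = lmul (coef z)" if "z \<in> ?R" for z
    using that Hs by (auto simp: coef_lmul)
  have coefO: "coef z x \<in> \<O>" if "z \<in> ?R" for z x using coefR(1)[OF that] by (simp add: fixalg_def)
  have red_add: "red (z + z') = red z + red z'" if "z \<in> ?R" "z' \<in> ?R" for z z'
    using coefO[OF that(1)] coefO[OF that(2)] by (simp add: red_def coef_add fun_eq_iff res_add)
  define scal where "scal c = lmul (fscale c (grp_elt \<one>))" for c :: 'k
  have scalR: "scal c \<in> ?R" if "c \<in> \<O>" for c
    unfolding scal_def using scale_fixalg[OF that grp_elt_one_fixalg[OF H Q]] by blast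
  have scal_mult: "scal c * z = lmul (fscale c (coef z))" "z * scal c = lmul (fscale c (coef z))" if "z \<in> ?R" for c z
    using coefR[OF that] Hs unfolding scal_def
    by (metis lmul_conv conv_scale_left conv_one_left subsetD, metis lmul_conv conv_scale_right conv_one_right subsetD)
  have coef_scal: "coef (scal c * z) = fscale c (coef z)" if "z \<in> ?R" "c \<in> \<O>" for c z
    using that coefR(1)[OF that(1)] Hs scale_fixalg[OF that(2)] by (simp add: scal_mult coef_lmul subsetD)
  show ?thesis
  proof (rule R.semipotent_if_fitting)
    fix y assume y: "y \<in> ?R"
    define w where "w n = red (y ^ n)" for n
    have wspan: "w n \<in> fvec.span (grp_elt ` carrier G)" for n
    proof -
      have "coef (y ^ n) \<in> supp" using coefR(1)[OF R.power_mem[OF y]] Hs by blast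
      hence "w n \<in> supp" by (simp add: w_def red_def supp_def res_zero)
      thus ?thesis by (simp add: supp_span)
    qed
    obtain n where n: "w n \<in> fvec.span (w ` {n<..})"
      using exists_dependent_tail[of "grp_elt ` carrier G" w] wspan fin by blast
    define U where "U = {v. \<exists>q\<in>?R. q * y = y * q \<and> v = red (y ^ Suc n * q)}"
    have "fvec.subspace U"
    proof (rule fvec.subspaceI)
      have "red 0 = 0" by (simp add: red_def coef_def zero_add_endo.rep_eq fun_eq_iff res_zero)
      thus "0 \<in> U" unfolding U_def using R.zero_mem by (intro CollectI bexI[of _ 0]) simp_all
      fix v v' assume v: "v \<in> U" "v' \<in> U"
      then obtain q q' where q: "q \<in> ?R" "q * y = y * q" "v = red (y ^ Suc n * q)"
        "q' \<in> ?R" "q' * y = y * q'" "v' = red (y ^ Suc n * q')" by (auto simp: U_def)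
      have "v + v' = red (y ^ Suc n * (q + q'))" unfolding q(3,6) distrib_left
        by (rule red_add[OF R.mult_mem[OF R.power_mem[OF y] q(1)] R.mult_mem[OF R.power_mem[OF y] q(4)], symmetric])
      moreover have "(q + q') * y = y * (q + q')" by (simp only: distrib_left distrib_right q(2,5))
      ultimately show "v + v' \<in> U" using R.add_mem[OF q(1,4)] unfolding U_def by blast
    next
      fix c v assume v: "v \<in> U"
      then obtain q where q: "q \<in> ?R" "q * y = y * q" "v = red (y ^ Suc n * q)" by (auto simp: U_def)
      obtain d where d: "d \<in> \<O>" "res d = c" using res_surj by (metis UNIV_I imageE)
      have yq: "y ^ Suc n * q \<in> ?R" by (rule R.mult_mem[OF R.power_mem[OF y] q(1)])
      have comm: "z * scal d = scal d * z" if "z \<in> ?R" for z using scal_mult[OF that] by simp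
      have "y ^ Suc n * (scal d * q) = scal d * (y ^ Suc n * q)"
        using comm[OF R.power_mem[OF y, of "Suc n"]] by (metis mult.assoc)
      hence "red (y ^ Suc n * (scal d * q)) = fscale c v"
        using coef_scal[OF yq d(1)] coefO[OF yq] d by (simp add: red_def q(3) fscale_def res_mult fun_eq_iff)
      moreover have "scal d * q * y = y * (scal d * q)"
        by (simp only: mult.assoc q(2)) (simp only: mult.assoc[symmetric] comm[OF y])
      ultimately show "fscale c v \<in> U" unfolding U_def using R.mult_mem[OF scalR[OF d(1)] q(1)]
        by (intro CollectI bexI[of _ "scal d * q"]) simp_all
    qed
    moreover have "w ` {n<..} \<subseteq> U"
    proof
      fix v assume "v \<in> w ` {n<..}"
      then obtain s where s: "n < s" "v = w s" by auto
      have "v = red (y ^ Suc n * y ^ (s - Suc n))" using s by (simp add: w_def flip: power_add power_Suc)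
      thus "v \<in> U" unfolding U_def using R.power_mem[OF y, of "s - Suc n"]
        by (intro CollectI bexI[of _ "y ^ (s - Suc n)"]) (simp_all only: power_commutes simp_thms)
    qed
    ultimately have "w n \<in> U" using n fvec.span_minimal by blast
    then obtain q where q: "q \<in> ?R" "q * y = y * q" "red (y ^ n) = red (y ^ Suc n * q)" by (auto simp: U_def w_def)
    have m: "y ^ n \<in> ?R" "y ^ Suc n * q \<in> ?R"
      by (rule R.power_mem[OF y]) (rule R.mult_mem[OF R.power_mem[OF y] q(1)])
    have "res (coef (y ^ n - y ^ Suc n * q) x) = 0" for x
      using fun_cong[OF q(3), of x] coefO[OF m(1)] coefO[OF m(2)] by (simp add: red_def coef_diff res_diff)
    hence "\<forall>x. coef (y ^ n - y ^ Suc n * q) x \<in> filt 1"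
      using coefO[OF R.diff_mem[OF m]] filt_1 by blast
    hence "y ^ n - y ^ Suc n * q \<in> ?F 1"
      using coefR[OF R.diff_mem[OF m]] by blast
    with q(2) have "q * y = y * q \<and> y ^ n - y ^ Suc n * q \<in> ?F 1" ..
    thus "\<exists>n. \<exists>q\<in>?R. q * y = y * q \<and> y ^ n - y ^ Suc n * q \<in> ?F 1" using q(1) by (intro exI bexI)
  qed
qed

end


section \<open>Actions of \<open>p\<close>-groups and the Brauer homomorphism\<close>

lemma group_action_restrict:
  assumes "group Q" and closed: "\<And>g y. g \<in> carrier Q \<Longrightarrow> y \<in> E \<Longrightarrow> \<phi> g y \<in> E"
    and one: "\<And>y. y \<in> E \<Longrightarrow> \<phi> \<one>\<^bsub>Q\<^esub> y = y"
    and mult: "\<And>g h y. g \<in> carrier Q \<Longrightarrow> h \<in> carrier Q \<Longrightarrow> y \<in> E \<Longrightarrow> \<phi> (g \<otimes>\<^bsub>Q\<^esub> h) y = \<phi> g (\<phi> h y)"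
  shows "group_action Q E (\<lambda>g. restrict (\<phi> g) E)"
proof -
  interpret Q: group Q by fact
  have bij: "restrict (\<phi> g) E \<in> Bij E" if g: "g \<in> carrier Q" for g
  proof -
    have "bij_betw (\<phi> g) E E"
    proof (rule bij_betw_byWitness[where f' = "\<phi> (inv\<^bsub>Q\<^esub> g)"])
      show "\<forall>a\<in>E. \<phi> (inv\<^bsub>Q\<^esub> g) (\<phi> g a) = a"
        using g by (simp add: mult[symmetric] one)
      show "\<forall>a\<in>E. \<phi> g (\<phi> (inv\<^bsub>Q\<^esub> g) a) = a"
        using g by (simp add: mult[symmetric] one)
    qed (use g closed in auto)
    thus ?thesis by (simp add: Bij_def bij_betw_restrict_eq)
  qed
  have "(\<lambda>g. restrict (\<phi> g) E) \<in> hom Q (BijGroup E)"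
  proof (rule homI)
    show "restrict (\<phi> g) E \<in> carrier (BijGroup E)" if "g \<in> carrier Q" for g
      using bij[OF that] by (simp add: BijGroup_def)
    show "restrict (\<phi> (g \<otimes>\<^bsub>Q\<^esub> h)) E = restrict (\<phi> g) E \<otimes>\<^bsub>BijGroup E\<^esub> restrict (\<phi> h) E"
      if "g \<in> carrier Q" "h \<in> carrier Q" for g h
      using that bij closed by (auto simp: BijGroup_def compose_def mult fun_eq_iff restrict_def)
  qed
  thus ?thesis
    by (intro group_action.intro group_hom.intro group_hom_axioms.intro group_BijGroup assms(1))
qed

text \<open>The length of an orbit that is not a fixed point is divisible by \<open>p\<close>. The set \<open>S\<close> records where the
quotient by \<open>p\<close> lies, so that the statement covers both cardinalities and sums in \<open>\<O>\<close>.\<close>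

lemma sum_mod_fixed_points:
  fixes F :: "'b \<Rightarrow> 'c::comm_semiring_1"
  assumes Q: "group Q" "card (carrier Q) = p ^ n" and p: "Factorial_Ring.prime p" and E: "finite E"
    and closed: "\<And>g y. g \<in> carrier Q \<Longrightarrow> y \<in> E \<Longrightarrow> \<phi> g y \<in> E"
    and one: "\<And>y. y \<in> E \<Longrightarrow> \<phi> \<one>\<^bsub>Q\<^esub> y = y"
    and mult: "\<And>g h y. g \<in> carrier Q \<Longrightarrow> h \<in> carrier Q \<Longrightarrow> y \<in> E \<Longrightarrow> \<phi> (g \<otimes>\<^bsub>Q\<^esub> h) y = \<phi> g (\<phi> h y)"
    and inv: "\<And>g y. g \<in> carrier Q \<Longrightarrow> y \<in> E \<Longrightarrow> F (\<phi> g y) = F y"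
    and S: "0 \<in> S" "\<And>s t. s \<in> S \<Longrightarrow> t \<in> S \<Longrightarrow> s + t \<in> S" "\<And>y. y \<in> E \<Longrightarrow> F y \<in> S"
  shows "\<exists>s\<in>S. sum F E = sum F {y \<in> E. \<forall>g\<in>carrier Q. \<phi> g y = y} + of_nat p * s"
proof -
  define \<psi> where "\<psi> g = restrict (\<phi> g) E" for g
  interpret group_action Q E \<psi>
    unfolding \<psi>_def by (rule group_action_restrict[OF Q(1) closed one mult])
  define Fx where "Fx = {y \<in> E. \<forall>g\<in>carrier Q. \<phi> g y = y}"
  have multS: "of_nat k * s \<in> S" if "s \<in> S" for k s
    by (induction k) (auto simp: distrib_right S that)
  have orb: "\<exists>s\<in>S. sum F B = (\<Sum>y\<in>B. if y \<in> Fx then F y else 0) + of_nat p * s"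
    if B: "B \<in> orbits Q E \<psi>" for B
  proof -
    obtain x where x: "x \<in> E" "B = orbit Q \<psi> x" using B by (auto simp: orbits_def)
    have BE: "B \<subseteq> E" using x closed by (auto simp: orbit_def \<psi>_def)
    have xB: "x \<in> B" using x orbit_refl by simp
    have finB: "finite B" using BE E finite_subset by blast
    have FB: "F y = F x" if "y \<in> B" for y using that x inv by (auto simp: orbit_def \<psi>_def)
    show ?thesis
    proof (cases "B = {x}")
      case True
      have "x \<in> Fx"
      proof -
        have "\<phi> g x = x" if "g \<in> carrier Q" for g
        proof -
          have "\<psi> g x \<in> B" using that x by (auto simp: orbit_def)
          thus ?thesis using True x by (simp add: \<psi>_def)
        qed
        thus ?thesis using x by (simp add: Fx_def)
      qed
      thus ?thesis using True S(1) by (intro bexI[of _ 0]) auto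
    next
      case False
      have "card B dvd p ^ n" using orbit_stabilizer_theorem[OF x(1)] Q(2) x(2)
        by (metis Coset.order_def dvd_triv_left)
      then obtain k where k: "card B = p ^ k" using divides_primepow_nat[OF p] by blast
      have "card B \<noteq> 1" using False xB by (metis card_1_singletonE singletonD)
      hence "p dvd card B" using k by (cases k) auto
      then obtain m where m: "card B = p * m" by blast
      have no: "y \<notin> Fx" if yB: "y \<in> B" for y
      proof
        assume y: "y \<in> Fx"
        have "x \<in> orbit Q \<psi> y" using orbit_sym[OF x(1), of y] yB x BE by auto
        hence "x = y" using y by (auto simp: orbit_def Fx_def \<psi>_def)
        hence "B = {x}" using y x xB by (auto simp: orbit_def Fx_def \<psi>_def)
        thus False using False by simp
      qed
      have "sum F B = (\<Sum>y\<in>B. F x)" by (rule sum.cong[OF refl FB])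
      also have "\<dots> = of_nat p * (of_nat m * F x)" by (simp add: m mult.assoc)
      finally show ?thesis using no multS[OF S(3)[OF x(1)], of m] by (intro bexI[of _ "of_nat m * F x"]) auto
    qed
  qed
  then obtain s where s: "\<And>B. B \<in> orbits Q E \<psi> \<Longrightarrow> s B \<in> S \<and>
      sum F B = (\<Sum>y\<in>B. if y \<in> Fx then F y else 0) + of_nat p * s B" by metis
  have "sum F E = (\<Sum>B\<in>orbits Q E \<psi>. sum F B)" using disjoint_sum[OF E, of F] by simp
  also have "\<dots> = (\<Sum>B\<in>orbits Q E \<psi>. (\<Sum>y\<in>B. if y \<in> Fx then F y else 0) + of_nat p * s B)"
    using s by (intro sum.cong) auto
  also have "\<dots> = (\<Sum>y\<in>E. if y \<in> Fx then F y else 0) + of_nat p * (\<Sum>B\<in>orbits Q E \<psi>. s B)"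
    using disjoint_sum[OF E, of "\<lambda>y. if y \<in> Fx then F y else 0"] by (simp add: sum.distrib sum_distrib_left)
  also have "(\<Sum>y\<in>E. if y \<in> Fx then F y else 0) = sum F Fx"
    using E by (simp add: sum.If_cases Fx_def Int_def)
  finally have "sum F E = sum F Fx + of_nat p * (\<Sum>B\<in>orbits Q E \<psi>. s B)" .
  moreover have "(\<Sum>B\<in>C. s B) \<in> S" if "C \<subseteq> orbits Q E \<psi>" for C
    using that s S by (induction C rule: infinite_finite_induct) auto
  ultimately show ?thesis unfolding Fx_def by blast
qed

lemma (in group) centralizer_sub_normalizer:
  assumes P: "subgroup P G"
  shows "centralizer G P \<subseteq> normalizer G P"
proof
  fix x assume "x \<in> centralizer G P"
  hence x: "x \<in> carrier G" "\<And>u. u \<in> P \<Longrightarrow> x \<otimes> u = u \<otimes> x" by (auto simp: centralizer_def)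
  have PG: "P \<subseteq> carrier G" using P by (rule subgroup.subset)
  have "x \<otimes> u \<otimes> inv x = u" if "u \<in> P" for u
    using x(1) x(2)[OF that] PG that by (simp add: m_assoc subset_iff)
  hence "x <# P #> inv x = P"
    by (force simp: l_coset_def r_coset_def)
  thus "x \<in> normalizer G P" using x PG by (simp add: normalizer_def stabilizer_def)
qed

lemma (in group) normalizer_conj:
  assumes P: "subgroup P G" and x: "x \<in> normalizer G P" and u: "u \<in> P"
  shows "x \<otimes> u \<otimes> inv x \<in> P" "inv x \<otimes> u \<otimes> x \<in> P"
proof -
  have N: "subgroup (normalizer G P) G" using P by (simp add: normalizer_imp_subgroup subgroup.subset)
  have c: "y \<otimes> u \<otimes> inv y \<in> P" if "y \<in> normalizer G P" for y
  proof -
    have yP: "y <# P #> inv y = P" using that P by (simp add: normalizer_def stabilizer_def subgroup.subset)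
    have "y \<otimes> u \<otimes> inv y \<in> y <# P #> inv y" using u by (auto simp: l_coset_def r_coset_def)
    thus ?thesis using yP by simp
  qed
  show "x \<otimes> u \<otimes> inv x \<in> P" using c[OF x] .
  have "inv x \<in> normalizer G P" using N x by (rule subgroup.m_inv_closed)
  from c[OF this] show "inv x \<otimes> u \<otimes> x \<in> P" using x N by (simp add: subgroup.mem_carrier)
qed

locale p_subgroup_algebra = group_algebra G \<O> \<pi> res p
  for G :: "('g, 'm) monoid_scheme" (structure) and \<O> :: "'k::field_char_0 set"
    and \<pi> and res :: "'k \<Rightarrow> 'r::field" and p +
  fixes P :: "'g set" and n :: nat
  assumes P_sub: "subgroup P G" and P_card: "card P = p ^ n"
begin

lemma P_carrier: "P \<subseteq> carrier G" using P_sub by (rule subgroup.subset)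

lemma P_group: "group (G\<lparr>carrier := P\<rparr>)" using P_sub subgroup_imp_group by blast

lemma P_order: "card (carrier (G\<lparr>carrier := P\<rparr>)) = p ^ n" by (simp add: P_card)

lemma P_fin: "finite P" using P_carrier fin finite_subset by blast

lemma sum_mod_fixed_points_P:
  fixes F :: "'b \<Rightarrow> 'c::comm_semiring_1"
  assumes E: "finite E"
    and "\<And>g y. g \<in> P \<Longrightarrow> y \<in> E \<Longrightarrow> \<phi> g y \<in> E"
    and "\<And>y. y \<in> E \<Longrightarrow> \<phi> \<one> y = y"
    and "\<And>g h y. g \<in> P \<Longrightarrow> h \<in> P \<Longrightarrow> y \<in> E \<Longrightarrow> \<phi> (g \<otimes> h) y = \<phi> g (\<phi> h y)"
    and "\<And>g y. g \<in> P \<Longrightarrow> y \<in> E \<Longrightarrow> F (\<phi> g y) = F y"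
    and "0 \<in> S" "\<And>s t. s \<in> S \<Longrightarrow> t \<in> S \<Longrightarrow> s + t \<in> S" "\<And>y. y \<in> E \<Longrightarrow> F y \<in> S"
  shows "\<exists>s\<in>S. sum F E = sum F {y \<in> E. \<forall>g\<in>P. \<phi> g y = y} + of_nat p * s"
  using sum_mod_fixed_points[OF P_group P_order prime_p E, of \<phi> F S] assms by simp

lemma sum_mod_centralizer:
  assumes E: "E \<subseteq> carrier G" "\<And>g y. g \<in> P \<Longrightarrow> y \<in> E \<Longrightarrow> g \<otimes> y \<otimes> inv g \<in> E"
    and F: "\<And>y. y \<in> E \<Longrightarrow> F y \<in> \<O>" "\<And>g y. g \<in> P \<Longrightarrow> y \<in> E \<Longrightarrow> F (g \<otimes> y \<otimes> inv g) = F y"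
    and F0: "\<And>y. y \<in> E \<Longrightarrow> y \<in> centralizer G P \<Longrightarrow> res (F y) = 0"
  shows "res (sum F E) = 0"
proof -
  have EG: "y \<in> carrier G" if "y \<in> E" for y using that E by blast
  have PG: "g \<in> carrier G" if "g \<in> P" for g using that P_carrier by blast
  have finE: "finite E" using E fin finite_subset by blast
  have "\<exists>s\<in>\<O>. sum F E = sum F {y \<in> E. \<forall>g\<in>P. g \<otimes> y \<otimes> inv g = y} + of_nat p * s"
    by (rule sum_mod_fixed_points_P[OF finE, where \<phi> = "\<lambda>g y. g \<otimes> y \<otimes> inv g"])
      ((rule E(2) F; assumption) | simp add: EG PG zero_mem add_mem m_assoc inv_mult_group)+
  then obtain s where s: "s \<in> \<O>" "sum F E = sum F {y \<in> E. \<forall>g\<in>P. g \<otimes> y \<otimes> inv g = y} + of_nat p * s"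
    by blast
  have "res (sum F {y \<in> E. \<forall>g\<in>P. g \<otimes> y \<otimes> inv g = y})
      = (\<Sum>y\<in>{y \<in> E. \<forall>g\<in>P. g \<otimes> y \<otimes> inv g = y}. res (F y))"
    using F by (intro res_sum) auto
  also have "\<dots> = 0"
  proof (rule sum.neutral, safe)
    fix y assume y: "y \<in> E" "\<forall>g\<in>P. g \<otimes> y \<otimes> inv g = y"
    have "y \<otimes> g = g \<otimes> y" if "g \<in> P" for g
    proof -
      have "g \<otimes> y \<otimes> inv g \<otimes> g = y \<otimes> g" using y that by simp
      thus ?thesis using y that EG PG by (simp add: m_assoc)
    qed
    hence "y \<in> centralizer G P" using y EG by (auto simp: centralizer_def)
    thus "res (F y) = 0" using F0 y by blast
  qed
  moreover have "sum F {y \<in> E. \<forall>g\<in>P. g \<otimes> y \<otimes> inv g = y} \<in> \<O>" using F by (intro sum_mem) auto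
  moreover have "res (of_nat p * s) = 0" "of_nat p * s \<in> \<O>" using p_times_mem[OF s(1)] by (auto simp: filt_Suc_0)
  ultimately show ?thesis unfolding s(2) by (simp add: res_add)
qed

text \<open>The kernel of the Brauer homomorphism on \<open>(\<O>H)\<^sup>P\<close>.\<close>

definition brauer_kernel :: "'g set \<Rightarrow> ('g \<Rightarrow> 'k) set" where
  "brauer_kernel H = {a \<in> fixalg H P. \<forall>x\<in>centralizer G P. res (a x) = 0}"

lemma centralizer_carrier: "x \<in> centralizer G P \<Longrightarrow> x \<in> carrier G"
  by (simp add: centralizer_def)

lemma centralizer_conj: "x \<in> centralizer G P \<Longrightarrow> u \<in> P \<Longrightarrow> u \<otimes> x \<otimes> inv u = x"
  using P_carrier by (auto simp: centralizer_def subset_iff) (metis inv_solve_right m_closed)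

lemma centralizer_inv_mult:
  assumes x: "x \<in> centralizer G P" and y: "y \<in> centralizer G P"
  shows "inv y \<otimes> x \<in> centralizer G P"
proof -
  have xG: "x \<in> carrier G" and yG: "y \<in> carrier G" using x y by (simp_all add: centralizer_carrier)
  have "inv y \<otimes> x \<otimes> u = u \<otimes> (inv y \<otimes> x)" if u: "u \<in> P" for u
  proof -
    have uG: "u \<in> carrier G" using u P_carrier by blast
    have xu: "x \<otimes> u = u \<otimes> x" "y \<otimes> u = u \<otimes> y" using x y u by (auto simp: centralizer_def)
    have "inv y \<otimes> u = inv y \<otimes> u \<otimes> y \<otimes> inv y" using uG yG by (simp add: m_assoc)
    also have "\<dots> = inv y \<otimes> (y \<otimes> u) \<otimes> inv y" using uG yG xu by (simp add: m_assoc)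
    also have "\<dots> = u \<otimes> inv y" using uG yG by (simp add: m_assoc[symmetric])
    finally have yu: "inv y \<otimes> u = u \<otimes> inv y" .
    have "inv y \<otimes> x \<otimes> u = (inv y \<otimes> u) \<otimes> x" using uG yG xG xu by (simp add: m_assoc)
    thus ?thesis using yu uG yG xG by (simp add: m_assoc)
  qed
  thus ?thesis using xG yG by (simp add: centralizer_def)
qed

text \<open>The multiplicativity of the Brauer homomorphism: in the convolution sum at a point \<open>x\<close> that centralizes
\<open>P\<close>, the group \<open>P\<close> permutes the summands by conjugation, and only those at its fixed points survive
modulo \<open>p\<close>.\<close>

lemma brauer_kernel_conv:
  assumes H: "subgroup H G" and a: "a \<in> fixalg H P" and b: "b \<in> fixalg H P"
    and k: "a \<in> brauer_kernel H \<or> b \<in> brauer_kernel H"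
  shows "conv G a b \<in> brauer_kernel H"
proof -
  have "res (conv G a b x) = 0" if x: "x \<in> centralizer G P" for x
  proof -
    have xG: "x \<in> carrier G" using x by (rule centralizer_carrier)
    have "res (\<Sum>y\<in>carrier G. a y * b (inv y \<otimes> x)) = 0"
    proof (rule sum_mod_centralizer)
      show "a y * b (inv y \<otimes> x) \<in> \<O>" for y using a b by (auto simp: fixalg_def mult_mem)
      fix g y assume g: "g \<in> P" and y: "y \<in> carrier G"
      have gG: "g \<in> carrier G" using g P_carrier by blast
      show "g \<otimes> y \<otimes> inv g \<in> carrier G" using gG y by simp
      have "inv (g \<otimes> y \<otimes> inv g) \<otimes> x = inv (g \<otimes> y \<otimes> inv g) \<otimes> (g \<otimes> x \<otimes> inv g)"
        using centralizer_conj[OF x g] by simp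
      also have "\<dots> = g \<otimes> (inv y \<otimes> x) \<otimes> inv g"
        using gG y xG by (simp add: inv_mult_group m_assoc) (simp add: m_assoc[symmetric])
      finally show "a (g \<otimes> y \<otimes> inv g) * b (inv (g \<otimes> y \<otimes> inv g) \<otimes> x) = a y * b (inv y \<otimes> x)"
        using fixalg_inv[OF a g y] fixalg_inv[OF b g, of "inv y \<otimes> x"] y xG by simp
    next
      fix y assume y: "y \<in> centralizer G P"
      have "res (a y) = 0 \<or> res (b (inv y \<otimes> x)) = 0"
        using k y centralizer_inv_mult[OF x y] by (auto simp: brauer_kernel_def)
      thus "res (a y * b (inv y \<otimes> x)) = 0"
        using a b by (subst res_mult) (auto simp: fixalg_def)
    qed auto
    thus ?thesis using xG by (simp add: conv_def)
  qed
  thus ?thesis using fixalg_conv[OF H P_carrier a b] by (simp add: brauer_kernel_def)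
qed

lemma brauer_kernel_diff: "a \<in> brauer_kernel H \<Longrightarrow> b \<in> brauer_kernel H \<Longrightarrow> a - b \<in> brauer_kernel H"
  using fixalg_diff by (auto simp: brauer_kernel_def res_diff fixalg_def)

lemma ring_ideal_brauer_kernel:
  assumes H: "subgroup H G"
  shows "ring_ideal (lmul ` fixalg H P) (lmul ` brauer_kernel H)"
proof -
  interpret S: subring_1 "lmul ` fixalg H P" by (rule subring_fixalg[OF H P_carrier])
  have sub: "brauer_kernel H \<subseteq> fixalg H P" by (auto simp: brauer_kernel_def)
  show ?thesis
  proof
    show "lmul ` brauer_kernel H \<subseteq> lmul ` fixalg H P" using sub by blast
    have "(0 :: 'g \<Rightarrow> 'k) \<in> brauer_kernel H" by (simp add: brauer_kernel_def fixalg_def zero_mem res_zero)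
    thus "0 \<in> lmul ` brauer_kernel H" using lmul_zero by (metis imageI)
    show "a - b \<in> lmul ` brauer_kernel H" if "a \<in> lmul ` brauer_kernel H" "b \<in> lmul ` brauer_kernel H" for a b
      using that brauer_kernel_diff by (auto simp flip: lmul_diff)
    show "r * a \<in> lmul ` brauer_kernel H" "a * r \<in> lmul ` brauer_kernel H"
      if "r \<in> lmul ` fixalg H P" "a \<in> lmul ` brauer_kernel H" for a r
      using that brauer_kernel_conv[OF H] sub by (auto simp flip: lmul_conv)
  qed
qed

text \<open>Let \<open>d\<close> be the reduction of \<open>e\<close> modulo \<open>\<pi>\<close>. Counting fixed points of \<open>P\<close> on the cosets of \<open>P\<close> shows
that the coefficients of \<open>d\<close> sum to \<open>0\<close> over each coset. If \<open>d \<noteq> 0\<close>, the span of the translates \<open>ud\<close>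
with \<open>u \<in> P\<close> over the prime field is a nonzero finite group of exponent \<open>p\<close>, on which \<open>P\<close> fixes a
nonzero \<open>v\<close>. Then \<open>v\<close> is constant on cosets, whence \<open>v = vd = 0\<close>, a contradiction. So \<open>e\<close> is
divisible by \<open>\<pi>\<close>, and being idempotent, by all powers of \<open>\<pi>\<close>.\<close>

lemma idempotent_in_brauer_kernel:
  assumes H: "subgroup H G" "P \<subseteq> H" and norm: "\<And>x u. x \<in> H \<Longrightarrow> u \<in> P \<Longrightarrow> inv x \<otimes> u \<otimes> x \<in> P"
    and e: "e \<in> brauer_kernel H" "conv G e e = e"
  shows "e = 0"
proof -
  define d where "d x = res (e x)" for x
  have eR: "e \<in> fixalg H P" using e by (simp add: brauer_kernel_def)
  have eO: "e x \<in> \<O>" for x using eR by (simp add: fixalg_def)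
  have HG: "x \<in> carrier G" if "x \<in> H" for x using that H(1) by (rule subgroup.mem_carrier[rotated])
  have PG: "x \<in> carrier G" if "x \<in> P" for x using that P_carrier by blast
  have dH: "d x = 0" if "x \<notin> H" for x using that eR by (simp add: d_def fixalg_def res_zero)
  have dd: "conv G d d = d"
  proof
    fix x
    show "conv G d d x = d x"
    proof (cases "x \<in> carrier G")
      case True
      have "conv G d d x = res (conv G e e x)"
        using True by (simp add: conv_def d_def res_sum res_mult eO mult_mem)
      thus ?thesis using e by (simp add: d_def)
    next
      case False
      thus ?thesis using HG dH by (auto simp: conv_supp)
    qed
  qed
  have coset: "(\<Sum>u\<in>P. d (u \<otimes> x)) = 0" if x: "x \<in> carrier G" for x
  proof (cases "x \<in> H")
    case True
    have inj: "inj_on (\<lambda>u. u \<otimes> x) P" using x PG by (auto simp: inj_on_def)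
    have norm': "x \<otimes> u \<otimes> inv x \<in> P" if "u \<in> P" for u
      using norm[of "inv x" u] that True x H by (simp add: subgroup.m_inv_closed)
    have "res (sum e ((\<lambda>u. u \<otimes> x) ` P)) = 0"
    proof (rule sum_mod_centralizer)
      show "(\<lambda>u. u \<otimes> x) ` P \<subseteq> carrier G" using x PG by auto
      show "e y \<in> \<O>" for y by (rule eO)
      show "res (e y) = 0" if "y \<in> centralizer G P" for y using e that by (simp add: brauer_kernel_def)
      fix g y assume g: "g \<in> P" and "y \<in> (\<lambda>u. u \<otimes> x) ` P"
      then obtain u where u: "u \<in> P" "y = u \<otimes> x" by blast
      have "g \<otimes> y \<otimes> inv g = (g \<otimes> u \<otimes> (x \<otimes> inv g \<otimes> inv x)) \<otimes> x"
        using g u x PG by (simp add: m_assoc)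
      moreover have "g \<otimes> u \<otimes> (x \<otimes> inv g \<otimes> inv x) \<in> P"
        using P_sub g u norm' by (simp add: subgroup.m_closed subgroup.m_inv_closed)
      ultimately show "g \<otimes> y \<otimes> inv g \<in> (\<lambda>u. u \<otimes> x) ` P" by blast
      show "e (g \<otimes> y \<otimes> inv g) = e y" using fixalg_inv[OF eR g] u x PG by simp
    qed
    moreover have "res (sum e ((\<lambda>u. u \<otimes> x) ` P)) = (\<Sum>u\<in>P. d (u \<otimes> x))"
      by (simp add: sum.reindex[OF inj] res_sum eO d_def)
    ultimately show ?thesis by simp
  next
    case False
    have "u \<otimes> x \<notin> H" if "u \<in> P" for u
    proof
      assume "u \<otimes> x \<in> H"
      hence "inv u \<otimes> (u \<otimes> x) \<in> H" using that H by (simp add: subgroup.m_closed subgroup.m_inv_closed subset_iff)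
      thus False using False that PG x by (simp add: m_assoc[symmetric])
    qed
    thus ?thesis using dH by simp
  qed
  have "d = (\<lambda>_. 0)"
  proof (rule ccontr)
    assume "d \<noteq> (\<lambda>_. 0)"
    then obtain x0 where x0: "d x0 \<noteq> 0" by blast
    \<comment> \<open>The coefficients \<open>of_nat\<close> run through the prime field, so \<open>W\<close> is its group algebra of \<open>P\<close>.\<close>
    define W :: "('g \<Rightarrow> 'r) set" where "W = {w. \<forall>x. (x \<in> P \<longrightarrow> w x \<in> range of_nat) \<and> (x \<notin> P \<longrightarrow> w x = 0)}"
    have rg: "range (of_nat :: nat \<Rightarrow> 'r) = of_nat ` {..<p}"
    proof -
      have "(of_nat k :: 'r) = of_nat (k mod p)" for k
        by (metis char_p of_nat_CHAR add.right_neutral mult_div_mod_eq mult_zero_left of_nat_add of_nat_mult add_0)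
      moreover have "k mod p < p" for k using prime_p prime_gt_0_nat by simp
      ultimately show ?thesis by blast
    qed
    have "finite W" unfolding W_def rg by (rule finite_set_of_finite_funs) (auto intro: P_fin)
    define \<Omega> where "\<Omega> = (\<lambda>w. conv G w d) ` W"
    have fin\<Omega>: "finite \<Omega>" unfolding \<Omega>_def using \<open>finite W\<close> by simp
    have Wadd: "w + w' \<in> W" if "w \<in> W" "w' \<in> W" for w w'
      using that unfolding W_def by (auto simp: image_iff) (metis of_nat_add)+
    have dsupp: "d \<in> supp" using dH HG by (auto simp: supp_def)
    have oneP: "\<one> \<in> P" using P_sub by (rule subgroup.one_closed)
    have W0: "0 \<in> W" unfolding W_def by (auto intro: range_eqI[of _ _ 0])
    have W1: "grp_elt \<one> \<in> W" using oneP unfolding W_def grp_elt_def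
      by (auto intro: range_eqI[of _ _ 0] range_eqI[of _ _ 1])
    have zero\<Omega>: "0 \<in> \<Omega>" unfolding \<Omega>_def by (rule image_eqI[OF _ W0]) (simp add: conv_def fun_eq_iff)
    have d\<Omega>: "v + d \<in> \<Omega>" if v: "v \<in> \<Omega>" for v
    proof -
      obtain w where "w \<in> W" "v = conv G w d" using v by (auto simp: \<Omega>_def)
      hence "v + d = conv G (w + grp_elt \<one>) d" by (simp only: conv_add_left conv_one_left[OF dsupp])
      thus ?thesis unfolding \<Omega>_def using Wadd[OF \<open>w \<in> W\<close> W1] by (metis imageI)
    qed
    have inj: "inj_on (\<lambda>v. v + d) \<Omega>" by (rule inj_onI) (metis add_right_cancel)
    have surj: "(\<lambda>v. v + d) ` \<Omega> = \<Omega>" by (rule endo_inj_surj[OF fin\<Omega> _ inj]) (use d\<Omega> in blast)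
    \<comment> \<open>Translation by \<open>d\<close> permutes \<open>\<Omega>\<close>; comparing sums of values at \<open>x0\<close> gives \<open>p dvd card \<Omega>\<close>.\<close>
    have "(\<Sum>v\<in>\<Omega>. v x0) = (\<Sum>v\<in>(\<lambda>v. v + d) ` \<Omega>. v x0)" using surj by simp
    also have "\<dots> = (\<Sum>v\<in>\<Omega>. v x0 + d x0)" by (simp add: sum.reindex[OF inj])
    also have "\<dots> = (\<Sum>v\<in>\<Omega>. v x0) + of_nat (card \<Omega>) * d x0" by (simp add: sum.distrib)
    finally have "of_nat (card \<Omega>) = (0 :: 'r)" using x0 by simp
    hence pd: "p dvd card \<Omega>" using char_p by (simp add: of_nat_eq_0_iff_char_dvd)
    have act: "conv G (grp_elt g) v \<in> \<Omega>" if g: "g \<in> P" and v: "v \<in> \<Omega>" for g v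
    proof -
      obtain w where w: "w \<in> W" "v = conv G w d" using v by (auto simp: \<Omega>_def)
      have "conv G (grp_elt g) w \<in> W"
      proof -
        have "conv G (grp_elt g) w x \<in> range of_nat" if "x \<in> P" for x
          using w(1) that g PG P_sub by (simp add: conv_grp_elt_left W_def subgroup.m_closed subgroup.m_inv_closed)
        moreover have "conv G (grp_elt g) w x = 0" if "x \<notin> P" for x
        proof (cases "x \<in> carrier G")
          case True
          have "inv g \<otimes> x \<notin> P"
          proof
            assume "inv g \<otimes> x \<in> P"
            hence "g \<otimes> (inv g \<otimes> x) \<in> P" using g P_sub by (simp add: subgroup.m_closed)
            thus False using that g True PG by (simp add: m_assoc[symmetric])
          qed
          thus ?thesis using w(1) True g PG by (simp add: conv_grp_elt_left W_def)
        qed (simp add: conv_supp)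
        ultimately show ?thesis by (simp add: W_def)
      qed
      thus ?thesis unfolding \<Omega>_def w(2) conv_assoc[symmetric] by blast
    qed
    have \<Omega>supp: "v \<in> supp" if "v \<in> \<Omega>" for v using that by (auto simp: \<Omega>_def)
    define Fx where "Fx = {v \<in> \<Omega>. \<forall>g\<in>P. conv G (grp_elt g) v = v}"
    have "\<exists>s\<in>UNIV. (\<Sum>v\<in>\<Omega>. 1) = (\<Sum>v\<in>{v \<in> \<Omega>. \<forall>g\<in>P. conv G (grp_elt g) v = v}. 1) + of_nat p * (s::nat)"
      by (rule sum_mod_fixed_points_P[OF fin\<Omega>, where \<phi> = "\<lambda>g v. conv G (grp_elt g) v"])
        (auto simp: act conv_one_left \<Omega>supp grp_elt_mult PG simp flip: conv_assoc)
    then obtain s where "card \<Omega> = card Fx + p * s" unfolding Fx_def by auto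
    hence pF: "p dvd card Fx" using pd by (metis dvd_add_left_iff dvd_triv_left)
    have finF: "finite Fx" unfolding Fx_def using fin\<Omega> by simp
    have "0 \<in> Fx" unfolding Fx_def using zero\<Omega> by (auto simp: conv_def fun_eq_iff)
    hence "card Fx > 0" using finF card_gt_0_iff by blast
    hence "card Fx \<ge> 2" using pF prime_p prime_ge_2_nat dvd_imp_le by (meson le_trans)
    hence "\<not> Fx \<subseteq> {0}" using card_mono[of "{0}" Fx] by auto
    then obtain v where v: "v \<in> Fx" "v \<noteq> 0" by blast
    have vd: "conv G v d = v"
      using v dd by (auto simp: Fx_def \<Omega>_def conv_assoc)
    have v\<Omega>: "v \<in> \<Omega>" using v by (simp add: Fx_def)
    have vinv: "v (u \<otimes> y) = v y" if u: "u \<in> P" and y: "y \<in> carrier G" for u y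
    proof -
      have "conv G (grp_elt u) v (u \<otimes> y) = v y" using u y PG by (simp add: conv_grp_elt_left m_assoc[symmetric])
      thus ?thesis using v u by (simp add: Fx_def)
    qed
    have vH: "v y = 0" if "y \<in> carrier G" "y \<notin> H" for y
    proof -
      obtain w where w: "w \<in> W" "v = conv G w d" using v\<Omega> by (auto simp: \<Omega>_def)
      have "w z * d (inv z \<otimes> y) = 0" if z: "z \<in> carrier G" for z
      proof (cases "z \<in> P")
        case True
        have "inv z \<otimes> y \<notin> H"
        proof
          assume "inv z \<otimes> y \<in> H"
          hence "z \<otimes> (inv z \<otimes> y) \<in> H" using True H by (simp add: subgroup.m_closed subset_iff)
          thus False using \<open>y \<notin> H\<close> \<open>y \<in> carrier G\<close> z by (simp add: m_assoc[symmetric])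
        qed
        thus ?thesis using dH by simp
      next
        case False
        thus ?thesis using w(1) by (simp add: W_def)
      qed
      hence "(\<Sum>z\<in>carrier G. w z * d (inv z \<otimes> y)) = 0" by (rule sum.neutral[OF ballI])
      thus ?thesis unfolding w(2) by (simp add: conv_def)
    qed
    have "v x = 0" for x
    proof (cases "x \<in> carrier G")
      case True
      have cos0: "(\<Sum>y\<in>D. v y * d (inv y \<otimes> x)) = 0" if D: "D \<in> rcosets P" for D
      proof -
        obtain y where y: "y \<in> carrier G" "D = P #> y" using D by (auto simp: RCOSETS_def)
        have D': "D = (\<lambda>u. u \<otimes> y) ` P" using y by (auto simp: r_coset_def)
        have inj: "inj_on (\<lambda>u. u \<otimes> y) P" using y PG by (auto simp: inj_on_def)
        have "(\<Sum>y\<in>D. v y * d (inv y \<otimes> x)) = (\<Sum>u\<in>P. v (u \<otimes> y) * d (inv (u \<otimes> y) \<otimes> x))"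
          unfolding D' by (simp add: sum.reindex[OF inj])
        also have "\<dots> = v y * (\<Sum>u\<in>P. d (inv (u \<otimes> y) \<otimes> x))"
          using y by (simp add: vinv sum_distrib_left)
        also have "\<dots> = 0"
        proof (cases "y \<in> H")
          case yH: True
          have norm': "y \<otimes> u \<otimes> inv y \<in> P" if "u \<in> P" for u
            using norm[of "inv y" u] that yH y H by (simp add: subgroup.m_inv_closed)
          have "(\<Sum>u\<in>P. d (inv (u \<otimes> y) \<otimes> x)) = (\<Sum>u\<in>P. d (u \<otimes> (inv y \<otimes> x)))"
          proof (rule sum.reindex_bij_witness[of _ "\<lambda>u. y \<otimes> inv u \<otimes> inv y" "\<lambda>u. inv y \<otimes> inv u \<otimes> y"])
            fix u assume u: "u \<in> P"
            have iu: "inv u \<in> P" using u P_sub by (simp add: subgroup.m_inv_closed)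
            show "y \<otimes> inv (inv y \<otimes> inv u \<otimes> y) \<otimes> inv y = u" "inv y \<otimes> inv (y \<otimes> inv u \<otimes> inv y) \<otimes> y = u"
              using u y PG by (simp_all add: inv_mult_group m_assoc) (simp_all add: m_assoc[symmetric])
            show "inv y \<otimes> inv u \<otimes> y \<in> P" using norm[OF yH iu] .
            show "y \<otimes> inv u \<otimes> inv y \<in> P" using norm'[OF iu] .
            have "inv y \<otimes> inv u \<otimes> y \<otimes> (inv y \<otimes> x) = inv y \<otimes> inv u \<otimes> (y \<otimes> inv y) \<otimes> x"
              using u y PG True by (simp only: m_assoc inv_closed m_closed)
            also have "\<dots> = inv (u \<otimes> y) \<otimes> x" using u y PG True by (simp add: inv_mult_group)
            finally show "d (inv y \<otimes> inv u \<otimes> y \<otimes> (inv y \<otimes> x)) = d (inv (u \<otimes> y) \<otimes> x)" by simp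
          qed
          thus ?thesis using coset[of "inv y \<otimes> x"] y True by simp
        qed (use vH y in simp)
        finally show ?thesis .
      qed
      have "v x = conv G v d x" using vd by simp
      also have "\<dots> = (\<Sum>y\<in>\<Union>(rcosets P). v y * d (inv y \<otimes> x))"
        using True by (simp add: conv_def rcosets_part_G[OF P_sub])
      also have "\<dots> = (\<Sum>D\<in>rcosets P. \<Sum>y\<in>D. v y * d (inv y \<otimes> x))"
        using rcos_disjoint[OF P_sub] rcosets_finite[OF _ P_carrier P_fin]
        by (subst sum.Union_disjoint) (auto simp: pairwise_def disjnt_def)
      also have "\<dots> = 0" using cos0 by simp
      finally show ?thesis .
    qed (use \<Omega>supp[OF v\<Omega>] in \<open>simp add: supp_def\<close>)
    thus False using v(2) by (auto simp: fun_eq_iff)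
  qed
  hence "\<forall>x. e x \<in> filt 1" using eO by (auto simp: filt_Suc_0 d_def fun_eq_iff)
  hence e1: "lmul e \<in> lmul ` {a \<in> fixalg H P. \<forall>x. a x \<in> filt 1}" using eR by blast
  interpret F: complete_filtered_ring "lmul ` fixalg H P" "\<lambda>n. lmul ` {a \<in> fixalg H P. \<forall>x. a x \<in> filt n}"
    by (rule complete_filtered_fixalg[OF H(1) P_carrier])
  have idem_e: "lmul e * lmul e = lmul e" using e(2) by (metis lmul_conv)
  have pw: "lmul e ^ Suc k = lmul e" for k
    using idem_e by (induction k) auto
  have "lmul e \<in> lmul ` {a \<in> fixalg H P. \<forall>x. a x \<in> filt k}" for k
    using F.F_power[OF e1, of "Suc k"] F.F_Suc[of k] unfolding pw by blast
  hence "lmul e = 0" by (rule F.separated)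
  hence "lmul e = lmul 0" by (simp only: lmul_zero)
  thus ?thesis using lmul_inj[of e 0] eR fixalg_supp[of H P] subgroup.subset[OF H(1)] by (auto simp: supp_def)
qed

end


section \<open>Dimensions cut out by idempotents\<close>

lemma independent_union:
  fixes B C :: "('b \<Rightarrow> 'k::field) set"
  assumes B: "finite B" "\<not> fvec.dependent B" and C: "finite C" "\<not> fvec.dependent C"
    and int: "fvec.span B \<inter> fvec.span C \<subseteq> {0}"
  shows "\<not> fvec.dependent (B \<union> C)" "B \<inter> C = {}"
proof -
  have nz: "0 \<notin> B" using B fvec.dependent_zero by blast
  show disj: "B \<inter> C = {}" using int nz fvec.span_base by blast
  show "\<not> fvec.dependent (B \<union> C)"
  proof
    assume "fvec.dependent (B \<union> C)"
    then obtain u where u: "\<exists>v\<in>B \<union> C. u v \<noteq> 0" "(\<Sum>v\<in>B \<union> C. fscale (u v) v) = 0"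
      using fvec.dependent_finite B(1) C(1) by blast
    define b where "b = (\<Sum>v\<in>B. fscale (u v) v)"
    define c where "c = (\<Sum>v\<in>C. fscale (u v) v)"
    have bc: "b + c = 0" using u(2) B(1) C(1) disj by (simp only: b_def c_def sum.union_disjoint)
    have bs: "b \<in> fvec.span B" unfolding b_def by (intro fvec.span_sum fvec.span_scale fvec.span_base)
    have cs: "c \<in> fvec.span C" unfolding c_def by (intro fvec.span_sum fvec.span_scale fvec.span_base)
    have "b = - c" using bc by (rule eq_neg_iff_add_eq_0[THEN iffD2])
    hence "b \<in> fvec.span C" using fvec.span_neg[OF cs] by simp
    hence b0: "b = 0" using int bs by blast
    hence c0: "c = 0" using bc by (simp only: add_0_left)
    have "\<forall>v\<in>B. u v = 0" using b0 B fvec.dependent_finite[OF B(1)] unfolding b_def by blast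
    moreover have "\<forall>v\<in>C. u v = 0" using c0 C fvec.dependent_finite[OF C(1)] unfolding c_def by blast
    ultimately show False using u(1) by blast
  qed
qed

lemma finite_basis:
  fixes V :: "('b \<Rightarrow> 'k::field) set"
  assumes "V \<subseteq> fvec.span S" "finite S"
  obtains B where "B \<subseteq> V" "finite B" "\<not> fvec.dependent B" "V \<subseteq> fvec.span B" "card B = fvec.dim V"
proof -
  obtain B where B: "B \<subseteq> V" "\<not> fvec.dependent B" "V \<subseteq> fvec.span B" "card B = fvec.dim V"
    using fvec.basis_exists by blast
  have "finite B" using fvec.independent_span_bound[OF assms(2) B(2)] B(1) assms(1) by blast
  thus ?thesis using that B by blast
qed

lemma dim_le_if_linear_image:
  fixes V :: "('b \<Rightarrow> 'k::field) set" and h :: "('b \<Rightarrow> 'k) \<Rightarrow> 'c \<Rightarrow> 'k"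
  assumes V: "fvec.subspace V" and S: "finite S" "V \<subseteq> fvec.span S"
    and add: "\<And>v w. v \<in> V \<Longrightarrow> w \<in> V \<Longrightarrow> h (v + w) = h v + h w"
    and scale: "\<And>c v. v \<in> V \<Longrightarrow> h (fscale c v) = fscale c (h v)"
    and U: "U \<subseteq> h ` V"
  shows "fvec.dim U \<le> fvec.dim V"
proof -
  obtain B where B: "B \<subseteq> V" "finite B" "\<not> fvec.dependent B" "V \<subseteq> fvec.span B" "card B = fvec.dim V"
    using finite_basis[OF S(2,1)] by blast
  define W where "W = {v \<in> V. h v \<in> fvec.span (h ` B)}"
  have "fvec.subspace W"
  proof (rule fvec.subspaceI)
    have 0: "0 \<in> V" by (rule fvec.subspace_0[OF V])
    have "h 0 = 0" using add[OF 0 0] by (metis add.right_neutral add_left_cancel)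
    thus "0 \<in> W" unfolding W_def using 0 fvec.span_zero by simp
    show "v + w \<in> W" if "v \<in> W" "w \<in> W" for v w
    proof -
      have *: "v \<in> V" "w \<in> V" "h v \<in> fvec.span (h ` B)" "h w \<in> fvec.span (h ` B)"
        using \<open>v \<in> W\<close> \<open>w \<in> W\<close> by (auto simp: W_def)
      show ?thesis unfolding W_def
        using fvec.subspace_add[OF V *(1,2)] fvec.span_add[OF *(3,4)]
        unfolding add[OF *(1,2), symmetric] by blast
    qed
    show "fscale c v \<in> W" if "v \<in> W" for c v
    proof -
      have *: "v \<in> V" "h v \<in> fvec.span (h ` B)" using \<open>v \<in> W\<close> by (auto simp: W_def)
      show ?thesis unfolding W_def
        using fvec.subspace_scale[OF V *(1)] fvec.span_scale[OF *(2)]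
        unfolding scale[OF *(1), symmetric] by blast
    qed
  qed
  moreover have "B \<subseteq> W" unfolding W_def using B(1) fvec.span_base by blast
  ultimately have "V \<subseteq> W" using fvec.span_minimal B(4) by blast
  hence "U \<subseteq> fvec.span (h ` B)" using U by (auto simp: W_def)
  hence "fvec.dim U \<le> card (h ` B)" using B(2) by (intro fvec.dim_le_card) auto
  also have "\<dots> \<le> card B" using B(2) by (rule card_image_le)
  finally show ?thesis using B(5) by simp
qed

text \<open>A module of finite dimension over a unital subalgebra \<open>A\<close> of the group algebra over the field. It takes
the form of the regular module and of modules over block algebras of \<open>G\<close> and of \<open>N\<^sub>G(P)\<close>.\<close>

locale group_rep = finite_group G
  for G :: "('g, 'm) monoid_scheme" (structure) +
  fixes A :: "('g \<Rightarrow> 'k::field) set" and \<rho> :: "('g \<Rightarrow> 'k) \<Rightarrow> ('b \<Rightarrow> 'k) \<Rightarrow> 'b \<Rightarrow> 'k"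
    and M :: "('b \<Rightarrow> 'k) set"
  assumes M_fin: "\<exists>S. finite S \<and> M = fvec.span S"
    and A_one: "grp_elt \<one> \<in> A" and A_zero: "0 \<in> A"
    and A_conv: "a \<in> A \<Longrightarrow> b \<in> A \<Longrightarrow> conv G a b \<in> A"
    and A_add: "a \<in> A \<Longrightarrow> b \<in> A \<Longrightarrow> a + b \<in> A"
    and \<rho>_mem: "a \<in> A \<Longrightarrow> v \<in> M \<Longrightarrow> \<rho> a v \<in> M"
    and \<rho>_vadd: "a \<in> A \<Longrightarrow> v \<in> M \<Longrightarrow> w \<in> M \<Longrightarrow> \<rho> a (v + w) = \<rho> a v + \<rho> a w"
    and \<rho>_vscale: "a \<in> A \<Longrightarrow> v \<in> M \<Longrightarrow> \<rho> a (fscale c v) = fscale c (\<rho> a v)"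
    and \<rho>_add: "a \<in> A \<Longrightarrow> b \<in> A \<Longrightarrow> v \<in> M \<Longrightarrow> \<rho> (a + b) v = \<rho> a v + \<rho> b v"
    and \<rho>_conv: "a \<in> A \<Longrightarrow> b \<in> A \<Longrightarrow> v \<in> M \<Longrightarrow> \<rho> (conv G a b) v = \<rho> a (\<rho> b v)"
    and \<rho>_one: "v \<in> M \<Longrightarrow> \<rho> (grp_elt \<one>) v = v"
begin

definition mult_dim :: "('g \<Rightarrow> 'k) \<Rightarrow> nat" where
  "mult_dim a = fvec.dim (\<rho> a ` M)"

lemma M_subspace: "fvec.subspace M"
  using M_fin fvec.subspace_span by blast

lemma \<rho>_zero: "v \<in> M \<Longrightarrow> \<rho> 0 v = 0"
  using \<rho>_add[OF A_zero A_zero] by (metis add.right_neutral add_left_cancel)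

lemma \<rho>_vzero: "a \<in> A \<Longrightarrow> \<rho> a 0 = 0"
  using \<rho>_vadd[of a 0 0] fvec.subspace_0[OF M_subspace] by (metis add.right_neutral add_left_cancel)

lemma image_subspace: "a \<in> A \<Longrightarrow> fvec.subspace (\<rho> a ` M)"
proof (rule fvec.subspaceI)
  assume a: "a \<in> A"
  show "0 \<in> \<rho> a ` M" using \<rho>_vzero[OF a] fvec.subspace_0[OF M_subspace] by (metis imageI)
  show "v + w \<in> \<rho> a ` M" if "v \<in> \<rho> a ` M" "w \<in> \<rho> a ` M" for v w
  proof -
    obtain v' w' where *: "v' \<in> M" "v = \<rho> a v'" "w' \<in> M" "w = \<rho> a w'"
      using \<open>v \<in> \<rho> a ` M\<close> \<open>w \<in> \<rho> a ` M\<close> by blast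
    show ?thesis unfolding *(2,4) \<rho>_vadd[OF a *(1,3), symmetric]
      using fvec.subspace_add[OF M_subspace *(1,3)] by (rule imageI)
  qed
  show "fscale c v \<in> \<rho> a ` M" if "v \<in> \<rho> a ` M" for c v
  proof -
    obtain v' where *: "v' \<in> M" "v = \<rho> a v'" using \<open>v \<in> \<rho> a ` M\<close> by blast
    show ?thesis unfolding *(2) \<rho>_vscale[OF a *(1), symmetric]
      using fvec.subspace_scale[OF M_subspace *(1)] by (rule imageI)
  qed
qed

lemma image_fin: "a \<in> A \<Longrightarrow> \<exists>S. finite S \<and> \<rho> a ` M \<subseteq> fvec.span S"
  using M_fin \<rho>_mem by blast

lemma mult_dim_add:
  assumes e: "e \<in> A" "conv G e e = e" and h: "h \<in> A" "conv G h h = h"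
    and orth: "conv G e h = 0" "conv G h e = 0"
  shows "mult_dim (e + h) = mult_dim e + mult_dim h"
proof -
  obtain S T where S: "\<rho> e ` M \<subseteq> fvec.span S" "finite S" and T: "\<rho> h ` M \<subseteq> fvec.span T" "finite T"
    using image_fin e h by meson
  obtain B where B: "B \<subseteq> \<rho> e ` M" "finite B" "\<not> fvec.dependent B" "\<rho> e ` M \<subseteq> fvec.span B" "card B = mult_dim e"
    unfolding mult_dim_def using finite_basis[OF S] by blast
  obtain C where C: "C \<subseteq> \<rho> h ` M" "finite C" "\<not> fvec.dependent C" "\<rho> h ` M \<subseteq> fvec.span C" "card C = mult_dim h"
    unfolding mult_dim_def using finite_basis[OF T] by blast
  have sB: "fvec.span B \<subseteq> \<rho> e ` M" using fvec.span_minimal[OF B(1) image_subspace[OF e(1)]] .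
  have sC: "fvec.span C \<subseteq> \<rho> h ` M" using fvec.span_minimal[OF C(1) image_subspace[OF h(1)]] .
  have int: "fvec.span B \<inter> fvec.span C \<subseteq> {0}"
  proof
    fix v assume "v \<in> fvec.span B \<inter> fvec.span C"
    then obtain v' w' where v: "v' \<in> M" "v = \<rho> e v'" "w' \<in> M" "v = \<rho> h w'" using sB sC by blast
    have "v = \<rho> e (\<rho> e v')" using \<rho>_conv[OF e(1) e(1) v(1)] e(2) v(2) by simp
    also have "\<dots> = \<rho> e (\<rho> h w')" using v(2,4) by simp
    also have "\<dots> = 0" using \<rho>_conv[OF e(1) h(1) v(3)] orth(1) \<rho>_zero[OF v(3)] by simp
    finally show "v \<in> {0}" by simp
  qed
  note ind = independent_union[OF B(2,3) C(2,3) int]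
  have eh: "\<rho> (e + h) v = \<rho> e v + \<rho> h v" if "v \<in> M" for v using \<rho>_add[OF e(1) h(1) that] .
  have 1: "\<rho> e v = \<rho> (e + h) (\<rho> e v)" if v: "v \<in> M" for v
    using eh[OF \<rho>_mem[OF e(1) v]] \<rho>_conv[OF e(1) e(1) v] \<rho>_conv[OF h(1) e(1) v] e(2) orth(2) \<rho>_zero[OF v]
    by (simp del: plus_fun_apply)
  have 2: "\<rho> h v = \<rho> (e + h) (\<rho> h v)" if v: "v \<in> M" for v
    using eh[OF \<rho>_mem[OF h(1) v]] \<rho>_conv[OF h(1) h(1) v] \<rho>_conv[OF e(1) h(1) v] h(2) orth(1) \<rho>_zero[OF v]
    by (simp del: plus_fun_apply)
  have "B \<union> C \<subseteq> \<rho> (e + h) ` M"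
  proof
    fix v assume "v \<in> B \<union> C"
    then consider w where "w \<in> M" "v = \<rho> e w" | w where "w \<in> M" "v = \<rho> h w" using B(1) C(1) by blast
    thus "v \<in> \<rho> (e + h) ` M"
    proof cases
      case 1
      show ?thesis unfolding 1(2) by (subst \<open>\<And>v. v \<in> M \<Longrightarrow> \<rho> e v = \<rho> (e + h) (\<rho> e v)\<close>[OF 1(1)])
          (rule imageI[OF \<rho>_mem[OF e(1) 1(1)]])
    next
      case 2
      show ?thesis unfolding 2(2) by (subst \<open>\<And>v. v \<in> M \<Longrightarrow> \<rho> h v = \<rho> (e + h) (\<rho> h v)\<close>[OF 2(1)])
          (rule imageI[OF \<rho>_mem[OF h(1) 2(1)]])
    qed
  qed
  moreover have "\<rho> (e + h) ` M \<subseteq> fvec.span (B \<union> C)"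
  proof
    fix v assume "v \<in> \<rho> (e + h) ` M"
    then obtain w where w: "w \<in> M" "v = \<rho> e w + \<rho> h w" using eh by auto
    have "\<rho> e w \<in> fvec.span (B \<union> C)" using B(4) w(1) fvec.span_mono[of B "B \<union> C"] by blast
    moreover have "\<rho> h w \<in> fvec.span (B \<union> C)" using C(4) w(1) fvec.span_mono[of C "B \<union> C"] by blast
    ultimately show "v \<in> fvec.span (B \<union> C)" unfolding w(2) by (rule fvec.span_add)
  qed
  ultimately have "card (B \<union> C) = mult_dim (e + h)"
    unfolding mult_dim_def using ind(1) by (rule fvec.basis_card_eq_dim)
  thus ?thesis using card_Un_disjoint[OF B(2) C(2) ind(2)] B(5) C(5) by simp
qed

text \<open>Multiplication by \<open>g\<close> maps \<open>eM\<close> onto a space that contains \<open>gehM\<close>.\<close>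

lemma mult_dim_le:
  assumes A: "g \<in> A" "e \<in> A" "h \<in> A"
  shows "mult_dim (conv G g (conv G e h)) \<le> mult_dim e"
proof -
  obtain S where S: "finite S" "\<rho> e ` M \<subseteq> fvec.span S" using image_fin[OF A(2)] by blast
  have eM: "v \<in> M" if "v \<in> \<rho> e ` M" for v using that \<rho>_mem[OF A(2)] by blast
  show ?thesis unfolding mult_dim_def
  proof (rule dim_le_if_linear_image[OF image_subspace[OF A(2)] S])
    show "\<rho> g (v + w) = \<rho> g v + \<rho> g w" if "v \<in> \<rho> e ` M" "w \<in> \<rho> e ` M" for v w
      using \<rho>_vadd[OF A(1) eM[OF that(1)] eM[OF that(2)]] .
    show "\<rho> g (fscale c v) = fscale c (\<rho> g v)" if "v \<in> \<rho> e ` M" for c v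
      using \<rho>_vscale[OF A(1) eM[OF that]] .
    show "\<rho> (conv G g (conv G e h)) ` M \<subseteq> \<rho> g ` \<rho> e ` M"
    proof
      fix v assume "v \<in> \<rho> (conv G g (conv G e h)) ` M"
      then obtain m where m: "m \<in> M" "v = \<rho> (conv G g (conv G e h)) m" by blast
      have "v = \<rho> g (\<rho> e (\<rho> h m))"
        unfolding m(2) \<rho>_conv[OF A(1) A_conv[OF A(2,3)] m(1)] \<rho>_conv[OF A(2,3) m(1)] ..
      thus "v \<in> \<rho> g ` \<rho> e ` M" using \<rho>_mem[OF A(3) m(1)] by blast
    qed
  qed
qed

lemma mult_dim_one: "mult_dim (grp_elt \<one>) = fvec.dim M"
  unfolding mult_dim_def by (simp add: \<rho>_one)

lemma mult_dim_zero: "mult_dim 0 = 0"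
proof -
  have "\<rho> 0 ` M \<subseteq> fvec.span {}" using \<rho>_zero by auto
  from fvec.dim_le_card[OF this] show ?thesis by (simp add: mult_dim_def)
qed

lemma mult_dim_le_dim:
  assumes e: "e \<in> A" "e \<in> supp"
  shows "mult_dim e \<le> fvec.dim M"
  using mult_dim_le[OF e(1) A_one A_one]
  unfolding conv_one_right[OF grp_elt_in_supp[OF one_closed]] conv_one_right[OF e(2)] mult_dim_one .

end

lemma (in finite_group) regular_rep: "group_rep G (supp :: ('a \<Rightarrow> 'k::field) set) (conv G) supp"
proof
  show "\<exists>S. finite S \<and> (supp :: ('a \<Rightarrow> 'k) set) = fvec.span S" using supp_span fin by blast
qed (auto simp: grp_elt_in_supp conv_add_left conv_add_right conv_scale_right conv_assoc conv_one_left
      simp del: plus_fun_apply, auto simp: supp_def)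

context group_algebra
begin

interpretation reg: group_rep G "supp :: ('g \<Rightarrow> 'k) set" "conv G" supp
  by (rule regular_rep)

text \<open>The rank of an idempotent \<open>e\<close> is the dimension of the right ideal \<open>eKG\<close>.\<close>

definition idem_rank :: "('g \<Rightarrow> 'k) \<Rightarrow> nat" where
  "idem_rank = reg.mult_dim"

lemma idem_rank_add:
  assumes "e \<in> supp" "conv G e e = e" "h \<in> supp" "conv G h h = h" "conv G e h = 0" "conv G h e = 0"
  shows "idem_rank (e + h) = idem_rank e + idem_rank h"
  unfolding idem_rank_def by (rule reg.mult_dim_add) (fact assms)+

lemma idem_rank_pos:
  assumes h: "h \<in> supp" "h \<noteq> 0"
  shows "idem_rank h > 0"
proof (rule ccontr)
  assume "\<not> idem_rank h > 0"
  hence 0: "fvec.dim (conv G h ` supp) = 0" by (simp add: idem_rank_def reg.mult_dim_def)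
  obtain S where S: "conv G h ` supp \<subseteq> fvec.span S" "finite S" using reg.image_fin[OF h(1)] by blast
  obtain B where "finite B" "conv G h ` supp \<subseteq> fvec.span B" "card B = 0"
    using finite_basis[OF S] 0 by metis
  hence "conv G h ` supp \<subseteq> {0}" by simp
  moreover have "h \<in> conv G h ` supp"
    using conv_one_right[OF h(1)] grp_elt_in_supp[OF one_closed] by (metis imageI)
  ultimately show False using h(2) by blast
qed

lemma idem_rank_le: "h \<in> supp \<Longrightarrow> idem_rank h \<le> fvec.dim (supp :: ('g \<Rightarrow> 'k) set)"
  unfolding idem_rank_def by (rule reg.mult_dim_le_dim)

lemma lmul_eq_zero: "a \<in> supp \<Longrightarrow> lmul a = 0 \<Longrightarrow> a = 0"
  using lmul_inj[of a 0] lmul_zero by (simp add: supp_def)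

lemma finite_length_supp:
  assumes R: "R \<subseteq> lmul ` (supp :: ('g \<Rightarrow> 'k) set)"
  shows "\<exists>\<mu> M. \<forall>e\<in>R. \<forall>h\<in>R. idem e \<and> idem h \<and> e * h = 0 \<and> h * e = 0 \<and> h \<noteq> 0 \<longrightarrow>
          \<mu> e < \<mu> (e + h) \<and> \<mu> (e + h) \<le> (M::nat)"
proof (intro exI ballI impI)
  fix e h assume "e \<in> R" "h \<in> R" and *: "idem e \<and> idem h \<and> e * h = 0 \<and> h * e = 0 \<and> h \<noteq> 0"
  then obtain a b where a: "a \<in> supp" "e = lmul a" and b: "b \<in> supp" "h = lmul b" using R by blast
  have "conv G a a = a" "conv G b b = b"
    using * a b by (auto intro: lmul_inj simp: idem_def lmul_conv)
  moreover have "conv G a b = 0" "conv G b a = 0"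
    using * a b by (auto intro: lmul_eq_zero simp: lmul_conv)
  moreover have "b \<noteq> 0" using * b lmul_zero by auto
  ultimately have "idem_rank (a + b) = idem_rank a + idem_rank b" "idem_rank b > 0"
    using a b idem_rank_add idem_rank_pos by auto
  moreover have s: "a + b \<in> supp" using a b by (auto simp: supp_def)
  ultimately show "idem_rank (coef e) < idem_rank (coef (e + h)) \<and>
      idem_rank (coef (e + h)) \<le> fvec.dim (supp :: ('g \<Rightarrow> 'k) set)"
    unfolding a b lmul_add[symmetric] coef_lmul[OF s] coef_lmul[OF a(1)] using idem_rank_le[OF s] by simp
qed

lemma lmul_idem_iff: "e \<in> supp \<Longrightarrow> idem (lmul e) \<longleftrightarrow> conv G e e = e"
  unfolding idem_def lmul_conv[symmetric] using lmul_inj[of "conv G e e" e] by auto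

text \<open>Primitivity for coefficient functions; the map \<open>lmul\<close> turns it into primitivity in the sense of type class rings.\<close>

definition primitive_in :: "('g \<Rightarrow> 'k) set \<Rightarrow> ('g \<Rightarrow> 'k) \<Rightarrow> bool" where
  "primitive_in A i \<longleftrightarrow> i \<in> A \<and> conv G i i = i \<and> i \<noteq> 0 \<and>
     (\<forall>e\<in>A. conv G e e = e \<and> conv G e i = e \<and> conv G i e = e \<longrightarrow> e = 0 \<or> e = i)"

lemma prim_idem_lmul:
  assumes A: "A \<subseteq> supp" and i: "primitive_in A i"
  shows "prim_idem (lmul ` A) (lmul i)"
proof -
  have iA: "i \<in> A" "conv G i i = i" "i \<noteq> 0" using i by (auto simp: primitive_in_def)
  have "lmul i \<noteq> 0" using lmul_eq_zero[of i] iA A by blast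
  moreover have "idem (lmul i)" using iA A by (auto simp: lmul_idem_iff)
  moreover have "lmul e = 0 \<or> lmul e = lmul i"
    if e: "e \<in> A" "idem (lmul e)" "lmul e * lmul i = lmul e" "lmul i * lmul e = lmul e" for e
  proof -
    have es: "e \<in> supp" using e A by blast
    have "conv G e e = e" using e(2) es by (simp add: lmul_idem_iff)
    moreover have "conv G e i = e" by (rule lmul_inj[OF conv_in_supp es]) (simp only: lmul_conv e(3))
    moreover have "conv G i e = e" by (rule lmul_inj[OF conv_in_supp es]) (simp only: lmul_conv e(4))
    ultimately have "e = 0 \<or> e = i" using i e(1) unfolding primitive_in_def by blast
    thus ?thesis using lmul_zero by auto
  qed
  ultimately show ?thesis using iA unfolding prim_idem_def by blast
qed

lemma fixalg_add: "a \<in> fixalg H Q \<Longrightarrow> b \<in> fixalg H Q \<Longrightarrow> a + b \<in> fixalg H Q"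
  by (auto simp: fixalg_def add_mem)

lemma fixalg_zero: "0 \<in> fixalg H Q"
  by (auto simp: fixalg_def zero_mem)

lemma fixalg_sum: "(\<And>x. x \<in> A \<Longrightarrow> h x \<in> fixalg H Q) \<Longrightarrow> sum h A \<in> fixalg H Q"
proof (induction A rule: infinite_finite_induct)
  case (insert x F)
  show ?case unfolding sum.insert[OF insert(1,2)] by (rule fixalg_add) (use insert in auto)
qed (simp_all only: sum.infinite sum.empty fixalg_zero not_False_eq_True)

lemma fixalg_mono: "H \<subseteq> H' \<Longrightarrow> Q' \<subseteq> Q \<Longrightarrow> fixalg H Q \<subseteq> fixalg H' Q'"
  by (auto simp: fixalg_def)

definition alg :: "'g set \<Rightarrow> ('g \<Rightarrow> 'k) set" where
  "alg H = {a. \<forall>x. x \<notin> H \<longrightarrow> a x = 0}"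

lemma fixalg_alg: "a \<in> fixalg H Q \<Longrightarrow> a \<in> alg H"
  by (auto simp: fixalg_def alg_def)

lemma alg_conv: "subgroup H G \<Longrightarrow> a \<in> alg H \<Longrightarrow> b \<in> alg H \<Longrightarrow> conv G a b \<in> alg H"
  using conv_supp_subgroup[of H a b] by (auto simp: alg_def)

text \<open>Elements invariant under \<open>Q\<close> commute with the elements of \<open>Q\<close> and their linear combinations.\<close>

lemma conv_commute_invariant:
  assumes Q: "Q \<subseteq> carrier G" and a: "\<And>u x. u \<in> Q \<Longrightarrow> x \<in> carrier G \<Longrightarrow> a (u \<otimes> x \<otimes> inv u) = a x"
    and b: "\<And>x. x \<notin> Q \<Longrightarrow> b x = 0"
  shows "conv G a b = conv G b a"
proof
  fix x
  show "conv G a b x = conv G b a x"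
  proof (cases "x \<in> carrier G")
    case True
    have "(\<Sum>y\<in>carrier G. a y * b (inv y \<otimes> x)) = (\<Sum>z\<in>carrier G. b z * a (inv z \<otimes> x))"
    proof (rule sum.reindex_bij_witness[of _ "\<lambda>z. x \<otimes> inv z" "\<lambda>y. inv y \<otimes> x"])
      fix y assume y: "y \<in> carrier G"
      show "x \<otimes> inv (inv y \<otimes> x) = y" "inv (x \<otimes> inv y) \<otimes> x = y"
        using y True by (simp_all add: inv_mult_group m_assoc) (simp_all add: m_assoc[symmetric])
      show "inv y \<otimes> x \<in> carrier G" "x \<otimes> inv y \<in> carrier G" using y True by simp_all
      define z where "z = inv y \<otimes> x"
      have z: "z \<in> carrier G" "y = x \<otimes> inv z"
        using y True by (simp_all add: z_def inv_mult_group m_assoc[symmetric])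
      show "b (inv y \<otimes> x) * a (inv (inv y \<otimes> x) \<otimes> x) = a y * b (inv y \<otimes> x)"
      proof (cases "z \<in> Q")
        case zQ: True
        have "a (z \<otimes> (inv z \<otimes> x) \<otimes> inv z) = a (inv z \<otimes> x)" using a[OF zQ, of "inv z \<otimes> x"] z True by simp
        moreover have "z \<otimes> (inv z \<otimes> x) \<otimes> inv z = y" using z True by (simp add: m_assoc[symmetric])
        ultimately have "a y = a (inv z \<otimes> x)" by simp
        thus ?thesis unfolding z_def[symmetric] by simp
      next
        case False
        thus ?thesis using b by (simp add: z_def[symmetric])
      qed
    qed
    thus ?thesis using True by (simp add: conv_def)
  qed (simp add: conv_supp)
qed

end

section \<open>Factoring a primitive idempotent through another one\<close>

context p_subgroup_algebra
begin

abbreviation N where "N \<equiv> normalizer G P"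

lemma N_sub: "subgroup N G"
  using P_carrier by (simp add: normalizer_imp_subgroup)

lemma N_carrier: "N \<subseteq> carrier G" using N_sub by (rule subgroup.subset)

lemma P_sub_N: "P \<subseteq> N"
proof
  fix x assume x: "x \<in> P"
  have xG: "x \<in> carrier G" using x P_carrier by blast
  have "x <# P = P" using x P_sub by (simp add: xG coset_join3)
  moreover have "P #> inv x = P" using x P_sub by (simp add: coset_join2 subgroup.m_inv_closed xG)
  ultimately show "x \<in> N" using xG P_carrier by (simp add: normalizer_def stabilizer_def)
qed

definition conj_op :: "'g \<Rightarrow> ('g \<Rightarrow> 'k) add_endo \<Rightarrow> ('g \<Rightarrow> 'k) add_endo" where
  "conj_op x z = lmul (grp_elt x) * z * lmul (grp_elt (inv x))"

lemma conj_op_lmul: "conj_op x (lmul a) = lmul (conj_act G x a)"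
  by (simp add: conj_op_def conj_act_def lmul_conv)

lemma lmul_grp_elt_mult: "x \<in> carrier G \<Longrightarrow> y \<in> carrier G \<Longrightarrow>
    lmul (grp_elt x) * lmul (grp_elt y) = (lmul (grp_elt (x \<otimes> y)) :: ('g \<Rightarrow> 'k) add_endo)"
  by (simp add: grp_elt_mult flip: lmul_conv)

lemma conj_op_comp: "x \<in> carrier G \<Longrightarrow> y \<in> carrier G \<Longrightarrow> conj_op x (conj_op y a) = conj_op (x \<otimes> y) a"
proof -
  assume xy: "x \<in> carrier G" "y \<in> carrier G"
  have "conj_op x (conj_op y a) = (lmul (grp_elt x) * lmul (grp_elt y)) * a * (lmul (grp_elt (inv y)) * lmul (grp_elt (inv x)))"
    by (simp add: conj_op_def mult.assoc)
  thus ?thesis using xy by (simp add: conj_op_def lmul_grp_elt_mult inv_mult_group)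
qed

lemma conj_op_one: "conj_op \<one> a = a"
  by (simp add: conj_op_def lmul_one)

lemma conj_fixalg:
  assumes H: "subgroup H G" "N \<subseteq> H" and x: "x \<in> N" and a: "a \<in> fixalg H P"
  shows "conj_act G x a \<in> fixalg H P"
proof -
  have xG: "x \<in> carrier G" and xH: "x \<in> H" using x N_carrier H by auto
  have "conj_act G x a y \<in> \<O>" for y
    using a xG by (cases "y \<in> carrier G") (auto simp: conj_act_apply conj_act_supp fixalg_def zero_mem)
  moreover have "conj_act G x a y = 0" if y: "y \<notin> H" for y
  proof (cases "y \<in> carrier G")
    case True
    have "inv x \<otimes> y \<otimes> x \<notin> H"
    proof
      assume "inv x \<otimes> y \<otimes> x \<in> H"
      hence "x \<otimes> (inv x \<otimes> y \<otimes> x) \<otimes> inv x \<in> H" using xH H(1) by (simp add: subgroup.m_closed subgroup.m_inv_closed)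
      thus False using y conj_inv_cancel(2)[OF xG True] by simp
    qed
    thus ?thesis using a xG True by (simp add: conj_act_apply fixalg_def)
  qed (simp add: conj_act_supp)
  moreover have "conj_act G x a (u \<otimes> y \<otimes> inv u) = conj_act G x a y" if u: "u \<in> P" and y: "y \<in> carrier G" for u y
  proof -
    have uG: "u \<in> carrier G" using u P_carrier by blast
    define u' where "u' = inv x \<otimes> u \<otimes> x"
    have u': "u' \<in> P" unfolding u'_def using normalizer_conj(2)[OF P_sub x u] .
    have "inv x \<otimes> (u \<otimes> y \<otimes> inv u) \<otimes> x = u' \<otimes> (inv x \<otimes> y \<otimes> x) \<otimes> inv u'"
      unfolding u'_def using xG uG y by (simp add: inv_mult_group m_assoc) (simp add: m_assoc[symmetric])
    thus ?thesis using fixalg_inv[OF a u', of "inv x \<otimes> y \<otimes> x"] xG uG y by (simp add: conj_act_apply)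
  qed
  ultimately show ?thesis by (simp add: fixalg_def)
qed

lemma conj_brauer_kernel:
  assumes H: "subgroup H G" "N \<subseteq> H" and x: "x \<in> N" and a: "a \<in> brauer_kernel H"
  shows "conj_act G x a \<in> brauer_kernel H"
proof -
  have aR: "a \<in> fixalg H P" using a by (simp add: brauer_kernel_def)
  have xG: "x \<in> carrier G" using x N_carrier by auto
  have "res (conj_act G x a y) = 0" if y: "y \<in> centralizer G P" for y
  proof -
    have yG: "y \<in> carrier G" using y by (rule centralizer_carrier)
    have "inv x \<otimes> y \<otimes> x \<in> centralizer G P"
      unfolding centralizer_def
    proof safe
      show "inv x \<otimes> y \<otimes> x \<in> carrier G" using xG yG by simp
      fix u assume u: "u \<in> P"
      have uG: "u \<in> carrier G" using u P_carrier by blast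
      have "x \<otimes> u \<otimes> inv x \<in> P" using normalizer_conj(1)[OF P_sub x u] .
      hence c: "y \<otimes> (x \<otimes> u \<otimes> inv x) = (x \<otimes> u \<otimes> inv x) \<otimes> y" using y by (simp add: centralizer_def)
      have "inv x \<otimes> y \<otimes> x \<otimes> u = inv x \<otimes> (y \<otimes> (x \<otimes> u \<otimes> inv x)) \<otimes> x"
        using xG yG uG by (simp add: m_assoc)
      also have "\<dots> = u \<otimes> (inv x \<otimes> y \<otimes> x)"
        unfolding c using xG yG uG by (simp add: m_assoc) (simp add: m_assoc[symmetric])
      finally show "inv x \<otimes> y \<otimes> x \<otimes> u = u \<otimes> (inv x \<otimes> y \<otimes> x)" .
    qed
    thus ?thesis using a xG yG by (simp add: conj_act_apply brauer_kernel_def)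
  qed
  thus ?thesis using conj_fixalg[OF H x aR] by (simp add: brauer_kernel_def)
qed

lemma centralizer_sub_N: "centralizer G P \<subseteq> N"
  using centralizer_sub_normalizer[OF P_sub] .

text \<open>The part of \<open>a\<close> supported on \<open>C\<^sub>G(P)\<close> has the same image as \<open>a\<close> under the Brauer homomorphism, and it
lies in \<open>\<O>N\<close> for \<open>N = N\<^sub>G(P)\<close>.\<close>

definition central_part :: "('g \<Rightarrow> 'k) \<Rightarrow> 'g \<Rightarrow> 'k" where
  "central_part a = (\<lambda>x. if x \<in> centralizer G P then a x else 0)"

lemma central_part_fixalg:
  assumes a: "a \<in> fixalg H P"
  shows "central_part a \<in> fixalg N P"
proof -
  have iff: "u \<otimes> x \<otimes> inv u \<in> centralizer G P \<longleftrightarrow> x \<in> centralizer G P" if u: "u \<in> P" and x: "x \<in> carrier G" for u x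
  proof
    have uG: "u \<in> carrier G" using u P_carrier by blast
    assume "u \<otimes> x \<otimes> inv u \<in> centralizer G P"
    hence c: "inv u \<otimes> (u \<otimes> x \<otimes> inv u) \<otimes> inv (inv u) = u \<otimes> x \<otimes> inv u"
      using centralizer_conj[of _ "inv u"] u P_sub by (simp add: subgroup.m_inv_closed)
    have "inv u \<otimes> (u \<otimes> x \<otimes> inv u) \<otimes> inv (inv u) = x"
      using conj_inv_cancel(1)[OF uG x] uG by simp
    thus "x \<in> centralizer G P" using c \<open>u \<otimes> x \<otimes> inv u \<in> centralizer G P\<close> by simp
  qed (simp add: centralizer_conj u)
  thus ?thesis using a centralizer_sub_N by (auto simp: fixalg_def central_part_def zero_mem)
qed

lemma central_part_diff:
  assumes a: "a \<in> fixalg H P" and H: "N \<subseteq> H"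
  shows "central_part a - a \<in> brauer_kernel H"
  using fixalg_diff[OF subsetD[OF fixalg_mono[OF H subset_refl] central_part_fixalg[OF a]] a]
  by (auto simp: brauer_kernel_def central_part_def res_zero)

text \<open>The set \<open>T\<close> of coset representatives enters only by the fact that summing over \<open>T\<close> gives the relative
trace \<open>Tr\<^sub>P\<^sup>N\<close>. In characteristic zero that is expressed by the sum over all of \<open>N\<close>, which is
visibly \<open>N\<close>-invariant.\<close>

definition trace_transversal :: "'g set \<Rightarrow> bool" where
  "trace_transversal T \<longleftrightarrow> T \<subseteq> N \<and> (\<forall>a\<in>fixalg N P. \<forall>y.
     of_nat (card P) * (\<Sum>x\<in>T. conj_act G x a y) = (\<Sum>x\<in>N. conj_act G x a y))"

lemma trace_in_center:
  assumes T: "trace_transversal T" and a: "a \<in> fixalg N P"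
  shows "(\<Sum>x\<in>T. conj_act G x a) \<in> fixalg N N"
proof -
  have TN: "T \<subseteq> N" using T by (simp add: trace_transversal_def)
  define z where "z = (\<Sum>x\<in>T. conj_act G x a)"
  have "z \<in> fixalg N P" unfolding z_def using TN by (intro fixalg_sum conj_fixalg[OF N_sub subset_refl _ a]) auto
  moreover have "z (u \<otimes> y \<otimes> inv u) = z y" if u: "u \<in> N" and y: "y \<in> carrier G" for u y
  proof -
    have uG: "u \<in> carrier G" using u N_carrier by blast
    have zN: "of_nat (card P) * z y = (\<Sum>x\<in>N. conj_act G x a y)" for y
      using T a unfolding z_def sum_fun_apply trace_transversal_def by blast
    have "(\<Sum>x\<in>N. conj_act G x a (u \<otimes> y \<otimes> inv u)) = (\<Sum>x\<in>N. conj_act G x a y)"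
    proof (rule sum.reindex_bij_witness[of _ "\<lambda>x. u \<otimes> x" "\<lambda>x. inv u \<otimes> x"])
      fix x assume x: "x \<in> N"
      have xG: "x \<in> carrier G" using x N_carrier by blast
      show "u \<otimes> (inv u \<otimes> x) = x" "inv u \<otimes> (u \<otimes> x) = x" using uG xG by (simp_all add: m_assoc[symmetric])
      show "inv u \<otimes> x \<in> N" "u \<otimes> x \<in> N" using u x N_sub by (simp_all add: subgroup.m_closed subgroup.m_inv_closed)
      show "conj_act G (inv u \<otimes> x) a y = conj_act G x a (u \<otimes> y \<otimes> inv u)"
        using uG xG y by (simp add: conj_act_apply inv_mult_group m_assoc)
    qed
    hence "of_nat (card P) * z (u \<otimes> y \<otimes> inv u) = of_nat (card P) * z y" by (simp only: zN)
    moreover have "card P \<noteq> 0" using P_fin subgroup.one_closed[OF P_sub] by auto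
    ultimately show ?thesis by simp
  qed
  ultimately show ?thesis unfolding z_def[symmetric] by (simp add: fixalg_def)
qed

text \<open>The instance of \<open>primitive_divides_conjugate\<close> for the algebra of \<open>P\<close>-fixed points of \<open>\<O>H\<close>, where \<open>H\<close>
contains \<open>N = N\<^sub>G(P)\<close>. Traces of elements of this algebra lie in \<open>Z(\<O>N)\<close> modulo the Brauer kernel, since
each element may be replaced by its part supported on \<open>C\<^sub>G(P)\<close>.\<close>

theorem primitive_factors_through:
  assumes H: "subgroup H G" "N \<subseteq> H"
    and c: "primitive_in (fixalg N N) c"
    and T: "trace_transversal T" and a: "a \<in> fixalg N P" "c = (\<Sum>x\<in>T. conj_act G x a)"
    and e: "e \<in> fixalg H P" "conv G e e = e" "e \<notin> brauer_kernel H" "conv G e c - e \<in> brauer_kernel H"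
    and i: "primitive_in (fixalg H P) i" "i \<notin> brauer_kernel H" "conv G i c - i \<in> brauer_kernel H"
  shows "\<exists>g\<in>alg H. \<exists>h\<in>alg H. i = conv G g (conv G e h)"
proof -
  let ?R = "lmul ` fixalg H P" and ?I = "lmul ` brauer_kernel H" and ?L = "lmul ` fixalg N N"
  have HG: "H \<subseteq> carrier G" using H(1) by (rule subgroup.subset)
  have Rs: "fixalg H P \<subseteq> supp" using fixalg_supp[OF HG] .
  have kR: "brauer_kernel H \<subseteq> fixalg H P" by (auto simp: brauer_kernel_def)
  have LR: "fixalg N N \<subseteq> fixalg H P" using fixalg_mono[OF H(2) P_sub_N] .
  interpret ring_ideal ?R ?I by (rule ring_ideal_brauer_kernel[OF H(1)])
  have TN: "T \<subseteq> N" using T by (simp add: trace_transversal_def)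
  have notI: "lmul b \<notin> ?I" if "b \<in> fixalg H P" "b \<notin> brauer_kernel H" for b
    using that lmul_inj[of b] Rs kR by blast
  interpret semipotent_ring_action ?R ?I conj_op N ?L
  proof (intro semipotent_ring_action.intro semipotent_ring_action_axioms.intro)
    show "ring_ideal ?R ?I" by (rule ring_ideal_brauer_kernel[OF H(1)])
    show "semipotent ?R" by (rule semipotent_fixalg[OF H(1) P_carrier])
    show "semipotent ?L" by (rule semipotent_fixalg[OF N_sub N_carrier])
    show "subring_1 ?L" by (rule subring_fixalg[OF N_sub N_carrier])
    show "?L \<subseteq> ?R" using LR by blast
    show "conj_op x z \<in> ?R" if "x \<in> N" "z \<in> ?R" for x z
      using that conj_fixalg[OF H] by (auto simp: conj_op_lmul)
    show "conj_op x z \<in> ?I" if "x \<in> N" "z \<in> ?I" for x z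
      using that conj_brauer_kernel[OF H] by (auto simp: conj_op_lmul)
    show "conj_op x (z + z') = conj_op x z + conj_op x z'" for x z z'
      by (simp add: conj_op_def distrib_left distrib_right)
    have inv1: "lmul (grp_elt (inv x)) * lmul (grp_elt x) = (1 :: ('g \<Rightarrow> 'k) add_endo)"
      "lmul (grp_elt x) * lmul (grp_elt (inv x)) = (1 :: ('g \<Rightarrow> 'k) add_endo)" if "x \<in> N" for x
      using that N_carrier by (auto simp: lmul_grp_elt_mult lmul_one subset_iff)
    show "conj_op x (z * z') = conj_op x z * conj_op x z'" if "x \<in> N" for x z z'
    proof -
      have "conj_op x z * conj_op x z' = lmul (grp_elt x) * z * (lmul (grp_elt (inv x)) * lmul (grp_elt x)) * z' * lmul (grp_elt (inv x))"
        by (simp only: conj_op_def mult.assoc)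
      thus ?thesis using inv1[OF that] by (simp add: conj_op_def mult.assoc)
    qed
    show "conj_op x 1 = 1" if "x \<in> N" for x using inv1[OF that] by (simp add: conj_op_def)
    show "\<exists>x\<in>N. \<forall>a\<in>?R. conj_op x a = a"
      using conj_op_one subgroup.one_closed[OF N_sub] by blast
    show "\<exists>z\<in>N. \<forall>a\<in>?R. conj_op x (conj_op y a) = conj_op z a" if "x \<in> N" "y \<in> N" for x y
      using that conj_op_comp N_carrier subgroup.m_closed[OF N_sub that] by blast
    show "\<exists>y\<in>N. \<forall>a\<in>?R. conj_op x (conj_op y a) = a" if x: "x \<in> N" for x
    proof
      show "inv x \<in> N" using x N_sub by (simp add: subgroup.m_inv_closed)
      show "\<forall>a\<in>?R. conj_op x (conj_op (inv x) a) = a"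
        using x N_carrier by (auto simp: conj_op_comp conj_op_one subset_iff)
    qed
    show "\<exists>\<mu> M. \<forall>e\<in>?R. \<forall>h\<in>?R. idem e \<and> idem h \<and> e * h = 0 \<and> h * e = 0 \<and> h \<noteq> 0 \<longrightarrow>
          \<mu> e < \<mu> (e + h) \<and> \<mu> (e + h) \<le> (M::nat)"
      using Rs by (intro finite_length_supp) auto
    show "z * z' = z' * z" if "z \<in> ?L" "z' \<in> ?L" for z z'
    proof -
      obtain b b' where b: "b \<in> fixalg N N" "z = lmul b" and b': "b' \<in> fixalg N N" "z' = lmul b'"
        using \<open>z \<in> ?L\<close> \<open>z' \<in> ?L\<close> by blast
      have "conv G b b' = conv G b' b"
        using b(1) b'(1) by (intro conv_commute_invariant[OF N_carrier]) (auto simp: fixalg_def)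
      thus ?thesis unfolding b b' by (simp flip: lmul_conv)
    qed
  qed
  have iR: "i \<in> fixalg H P" using i by (simp add: primitive_in_def)
  have aR: "a \<in> fixalg H P" using a(1) fixalg_mono[OF H(2), of P P] by blast
  have "\<exists>x\<in>N. \<exists>w\<in>?R. \<exists>r\<in>?R. \<exists>r'\<in>?R. w * (lmul i * r * conj_op x (lmul e) * r' * lmul i) = lmul i"
  proof (rule primitive_divides_conjugate[OF _ TN])
    show "prim_idem ?L (lmul c)" using LR Rs by (intro prim_idem_lmul c) auto
    show "prim_idem ?R (lmul i)" by (rule prim_idem_lmul[OF Rs i(1)])
    show "lmul a \<in> ?R" using aR by blast
    show "lmul c = (\<Sum>x\<in>T. conj_op x (lmul a))" unfolding a(2) by (simp only: lmul_sum conj_op_lmul)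
    show "lmul e \<in> ?R" "idem (lmul e)" using e by (auto simp: idem_def simp flip: lmul_conv)
    show "lmul e \<notin> ?I" "lmul i \<notin> ?I" using notI e i iR by auto
    show "lmul e * lmul c - lmul e \<in> ?I" "lmul i * lmul c - lmul i \<in> ?I"
      using e(4) i(3) by (auto simp flip: lmul_conv lmul_diff)
    fix t assume "t \<in> ?R"
    then obtain b where b: "b \<in> fixalg H P" "t = lmul b" by blast
    define z where "z = (\<Sum>x\<in>T. conj_act G x (central_part b))"
    have "lmul z - (\<Sum>x\<in>T. conj_op x t) = (\<Sum>x\<in>T. conj_op x (lmul (central_part b - b)))"
      unfolding z_def b(2) lmul_sum lmul_diff conj_op_lmul[symmetric]
      by (simp add: conj_op_def left_diff_distrib right_diff_distrib flip: sum_subtractf)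
    also have "\<dots> \<in> ?I"
    proof -
      have "conj_op x (lmul (central_part b - b)) \<in> ?I" if "x \<in> T" for x
        unfolding conj_op_lmul using that TN
        by (intro imageI conj_brauer_kernel[OF H _ central_part_diff[OF b(1) H(2)]]) auto
      thus ?thesis by (induction T rule: infinite_finite_induct) (auto intro: I_add I_zero)
    qed
    finally show "\<exists>z\<in>?L. z - (\<Sum>x\<in>T. conj_op x t) \<in> ?I"
      using trace_in_center[OF T central_part_fixalg[OF b(1)]] unfolding z_def by blast
  qed
  then obtain x w r r' where x: "x \<in> N" and R: "w \<in> fixalg H P" "r \<in> fixalg H P" "r' \<in> fixalg H P"
    and eq: "lmul w * (lmul i * lmul r * conj_op x (lmul e) * lmul r' * lmul i) = lmul i" by auto
  define g where "g = conv G w (conv G i (conv G r (grp_elt x)))"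
  define h where "h = conv G (grp_elt (inv x)) (conv G r' i)"
  have "lmul (conv G g (conv G e h)) = lmul w * (lmul i * lmul r * conj_op x (lmul e) * lmul r' * lmul i)"
    unfolding g_def h_def conj_op_def lmul_conv by (simp only: mult.assoc)
  also have "\<dots> = lmul i" by (rule eq)
  finally have "lmul (conv G g (conv G e h)) = lmul i" .
  hence "i = conv G g (conv G e h)" using lmul_inj[of "conv G g (conv G e h)" i] iR Rs by auto
  moreover have xH: "grp_elt y \<in> alg H" if "y \<in> N" for y using that H(2) by (auto simp: alg_def grp_elt_def)
  have ix: "inv x \<in> N" using x N_sub by (simp add: subgroup.m_inv_closed)
  have "g \<in> alg H" "h \<in> alg H" unfolding g_def h_def
    using fixalg_alg[OF R(1)] fixalg_alg[OF R(2)] fixalg_alg[OF R(3)] fixalg_alg[OF iR] xH[OF x] xH[OF ix]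
    by (auto intro!: alg_conv H(1))
  ultimately show ?thesis by blast
qed

end


section \<open>Blocks, defect groups and modules over blocks\<close>

context finite_group
begin

lemma conj_act_comp:
  assumes "x \<in> carrier G" "y \<in> carrier G"
  shows "conj_act G (x \<otimes> y) a = conj_act G x (conj_act G y a)"
proof
  fix z
  show "conj_act G (x \<otimes> y) a z = conj_act G x (conj_act G y a) z"
    using assms by (cases "z \<in> carrier G") (simp_all add: conj_act_apply conj_act_supp inv_mult_group m_assoc)
qed

definition coset_reps :: "'a set \<Rightarrow> 'a set" where
  "coset_reps P = (\<lambda>D. SOME x. x \<in> D) ` (lcosets P)"

text \<open>The three facts turn the sum over arbitrarily chosen representatives into one over a fixed set of them,
and express it by the sum over the whole group.\<close>

lemma coset_reps:
  assumes P: "subgroup P G"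
  shows "coset_reps P \<subseteq> carrier G"
    and "rel_trace G P a = (\<Sum>x\<in>coset_reps P. conj_act G x a)"
    and "(\<And>u. u \<in> P \<Longrightarrow> conj_act G u a = a) \<Longrightarrow>
      of_nat (card P) * rel_trace G P a y = (\<Sum>x\<in>carrier G. conj_act G x a y)"
proof -
  define rp where "rp D = (SOME x. x \<in> D)" for D :: "'a set"
  have rpD: "rp D \<in> D" if D: "D \<in> lcosets P" for D
  proof -
    obtain x where "x \<in> carrier G" "D = x <# P" using D by (auto simp: LCOSETS_def)
    hence "x \<in> D" using P by (simp add: lcos_self)
    thus ?thesis unfolding rp_def by (rule someI)
  qed
  have DG: "D \<subseteq> carrier G" if "D \<in> lcosets P" for D using lcosets_subset_PowG[OF P] that by blast
  show "coset_reps P \<subseteq> carrier G" unfolding coset_reps_def rp_def[symmetric] using rpD DG by blast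
  have inj: "inj_on rp (lcosets P)"
  proof (rule inj_onI)
    fix D E assume "D \<in> lcosets P" "E \<in> lcosets P" "rp D = rp E"
    thus "D = E" using rpD[of D] rpD[of E] lcos_disjoint[OF P, of D E] by auto
  qed
  show "rel_trace G P a = (\<Sum>x\<in>coset_reps P. conj_act G x a)"
    unfolding coset_reps_def rp_def[symmetric] rel_trace_def sum.reindex[OF inj] o_def ..
  assume inv: "\<And>u. u \<in> P \<Longrightarrow> conj_act G u a = a"
  have "(\<Sum>x\<in>carrier G. conj_act G x a y) = (\<Sum>x\<in>\<Union>(lcosets P). conj_act G x a y)"
    by (simp add: lcosets_part_G[OF P])
  also have "\<dots> = (\<Sum>D\<in>lcosets P. \<Sum>x\<in>D. conj_act G x a y)"
    using lcos_disjoint[OF P] finite_subset[OF DG fin] by (subst sum.Union_disjoint) auto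
  also have "\<dots> = (\<Sum>D\<in>lcosets P. of_nat (card P) * conj_act G (rp D) a y)"
  proof (rule sum.cong[OF refl])
    fix D assume D: "D \<in> lcosets P"
    obtain g where g: "g \<in> carrier G" "D = g <# P" using D by (auto simp: LCOSETS_def)
    have PG: "P \<subseteq> carrier G" using P by (rule subgroup.subset)
    have "conj_act G x a = conj_act G (rp D) a" if "x \<in> D" for x
    proof -
      have *: "conj_act G x a = conj_act G g a" if "x \<in> D" for x
      proof -
        obtain u where "u \<in> P" "x = g \<otimes> u" using \<open>x \<in> D\<close> g by (auto simp: l_coset_def)
        thus ?thesis using conj_act_comp[of g u a] inv[of u] g PG by auto
      qed
      show ?thesis using *[OF that] *[OF rpD[OF D]] by simp
    qed
    hence "(\<Sum>x\<in>D. conj_act G x a y) = of_nat (card D) * conj_act G (rp D) a y" by simp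
    thus "(\<Sum>x\<in>D. conj_act G x a y) = of_nat (card P) * conj_act G (rp D) a y"
      using l_card_cosets_equal[OF D PG fin] by simp
  qed
  finally show "of_nat (card P) * rel_trace G P a y = (\<Sum>x\<in>carrier G. conj_act G x a y)"
    by (simp add: rel_trace_def sum_fun_apply rp_def sum_distrib_left)
qed

end

lemma group_ring_simps [simp]:
  "carrier (group_ring S G) = {a. (\<forall>x\<in>carrier G. a x \<in> S) \<and> (\<forall>x. x \<notin> carrier G \<longrightarrow> a x = 0)}"
  "monoid.mult (group_ring S G) = conv G" "one (group_ring S G) = grp_elt \<one>\<^bsub>G\<^esub>"
  "zero (group_ring S G) = 0" "add (group_ring S G) = (+)"
  by (simp_all add: group_ring_def)

lemma (in finite_group) conj_act_scale: "conj_act G x (fscale c a) = fscale c (conj_act G x a)"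
  by (simp add: conj_act_def conv_scale_left conv_scale_right)

context group_algebra
begin

lemma conj_act_eq_iff:
  assumes u: "u \<in> carrier G" and a: "a \<in> supp"
  shows "conj_act G u a = a \<longleftrightarrow> (\<forall>x\<in>carrier G. a (u \<otimes> x \<otimes> inv u) = a x)"
proof
  assume eq: "conj_act G u a = a"
  show "\<forall>x\<in>carrier G. a (u \<otimes> x \<otimes> inv u) = a x"
  proof
    fix x assume x: "x \<in> carrier G"
    have "conj_act G u a (u \<otimes> x \<otimes> inv u) = a (inv u \<otimes> (u \<otimes> x \<otimes> inv u) \<otimes> u)"
      using u x by (simp add: conj_act_apply)
    also have "inv u \<otimes> (u \<otimes> x \<otimes> inv u) \<otimes> u = x" by (rule conj_inv_cancel[OF u x])
    finally show "a (u \<otimes> x \<otimes> inv u) = a x" using eq by simp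
  qed
next
  assume inv: "\<forall>x\<in>carrier G. a (u \<otimes> x \<otimes> inv u) = a x"
  show "conj_act G u a = a"
  proof
    fix x
    show "conj_act G u a x = a x"
    proof (cases "x \<in> carrier G")
      case True
      show ?thesis
        using inv[rule_format, of "inv u \<otimes> x \<otimes> u"] conj_inv_cancel(2)[OF u True] u True by (simp add: conj_act_apply)
    next
      case False
      thus ?thesis using a by (simp add: conj_act_supp supp_def)
    qed
  qed
qed

lemma fixalg_carrier:
  assumes Q: "Q \<subseteq> carrier G"
  shows "fixalg (carrier G) Q = {a \<in> carrier (group_ring \<O> G). \<forall>u\<in>Q. conj_act G u a = a}"
proof -
  have "(\<forall>x\<in>carrier G. a x \<in> \<O>) \<and> (\<forall>x. x \<notin> carrier G \<longrightarrow> a x = 0) \<longleftrightarrow>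
      (\<forall>x. a x \<in> \<O>) \<and> (\<forall>x. x \<notin> carrier G \<longrightarrow> a x = 0)" for a :: "'g \<Rightarrow> 'k"
    using zero_mem by metis
  thus ?thesis using Q by (auto simp: fixalg_def conj_act_eq_iff supp_def subset_iff)
qed

text \<open>If \<open>b = Tr\<^sub>P\<^sup>G(a)\<close> and \<open>Q\<close> is a Sylow subgroup of \<open>P\<close>, the index \<open>m\<close> of \<open>Q\<close> in \<open>P\<close> is invertible
in \<open>\<O>\<close> and \<open>b = Tr\<^sub>Q\<^sup>G(a/m)\<close>. By minimality \<open>Q = P\<close>.\<close>

lemma defect_group_is_p_group:
  assumes "defect_group \<O> G b P"
  shows "\<exists>n. card P = p ^ n"
proof -
  have P: "subgroup P G" and proj: "rel_projective \<O> G b P"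
    and min: "\<And>Q. subgroup Q G \<Longrightarrow> Q \<subset> P \<Longrightarrow> \<not> rel_projective \<O> G b Q"
    using assms by (auto simp: defect_group_def)
  have PG: "P \<subseteq> carrier G" using P by (rule subgroup.subset)
  have finP: "finite P" using PG fin finite_subset by blast
  have "card P \<noteq> 0" using finP subgroup.one_closed[OF P] by auto
  then obtain m n where m: "card P = p ^ n * m" "\<not> p dvd m"
    using multiplicity_decompose'[of "card P" p] prime_p
    by (metis not_prime_unit mult.commute)
  have "\<exists>Q. subgroup Q (G\<lparr>carrier := P\<rparr>) \<and> card Q = p ^ n"
    using sylow_thm[OF prime_p, of "G\<lparr>carrier := P\<rparr>" n m] subgroup_imp_group[OF P] finP m(1)
    by (simp add: Coset.order_def)
  then obtain Q where Q: "subgroup Q (G\<lparr>carrier := P\<rparr>)" "card Q = p ^ n" by blast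
  have QG: "subgroup Q G" using incl_subgroup[OF P Q(1)] .
  have QP: "Q \<subseteq> P" using subgroup.subset[OF Q(1)] by simp
  have QC: "Q \<subseteq> carrier G" using QP PG by blast
  obtain a where a: "a \<in> carrier (group_ring \<O> G)" "\<forall>u\<in>P. conj_act G u a = a" "b = rel_trace G P a"
    using proj by (auto simp: rel_projective_def fixed_points_def)
  define a' where "a' = fscale (inverse (of_nat m)) a"
  have a': "a' \<in> carrier (group_ring \<O> G)" "\<forall>u\<in>Q. conj_act G u a' = a'"
    using a QP inverse_of_nat_mem[OF m(2)] mult_mem
    by (auto simp: a'_def conj_act_scale) (auto simp: fscale_def)
  have m0: "(of_nat m :: 'k) \<noteq> 0" using m(2) by (metis dvd_0_right of_nat_eq_0_iff)
  have q0: "(of_nat (card Q) :: 'k) \<noteq> 0" using Q(2) prime_p by (simp add: prime_gt_0_nat)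
  have "rel_trace G Q a' = b"
  proof
    fix y
    have "of_nat (card Q) * rel_trace G Q a' y = (\<Sum>x\<in>carrier G. conj_act G x a' y)"
      by (rule coset_reps(3)[OF QG]) (use a' in blast)
    also have "\<dots> = inverse (of_nat m) * (\<Sum>x\<in>carrier G. conj_act G x a y)"
      by (simp add: a'_def conj_act_scale) (simp add: fscale_def sum_distrib_left)
    also have "(\<Sum>x\<in>carrier G. conj_act G x a y) = of_nat (card P) * b y"
      unfolding a(3) by (rule coset_reps(3)[OF P, symmetric]) (use a in blast)
    also have "inverse (of_nat m) * (of_nat (card P) * b y) = of_nat (card Q) * b y"
      using m0 by (simp add: m(1) Q(2))
    finally show "rel_trace G Q a' y = b y" using q0 by simp
  qed
  hence "rel_projective \<O> G b Q"
    using a' unfolding rel_projective_def fixed_points_def by (auto intro!: image_eqI[of _ _ a'])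
  hence "Q = P" using min[OF QG] QP by blast
  thus ?thesis using Q(2) by blast
qed

lemma center_group_ring: "center (group_ring \<O> G) = fixalg (carrier G) (carrier G)"
proof
  show "center (group_ring \<O> G) \<subseteq> fixalg (carrier G) (carrier G)"
  proof
    fix z assume z: "z \<in> center (group_ring \<O> G)"
    hence zR: "z \<in> carrier (group_ring \<O> G)"
      and comm: "\<And>a. a \<in> carrier (group_ring \<O> G) \<Longrightarrow> conv G z a = conv G a z"
      by (auto simp: center_def)
    have zs: "z \<in> supp" using zR by (simp add: supp_def)
    have "conj_act G u z = z" if u: "u \<in> carrier G" for u
    proof -
      have "grp_elt u \<in> carrier (group_ring \<O> G)" using u zero_mem one_mem by (auto simp: grp_elt_def)
      hence "conj_act G u z = conv G (conv G z (grp_elt u)) (grp_elt (inv u))"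
        using comm by (simp add: conj_act_def)
      also have "\<dots> = conv G z (conv G (grp_elt u) (grp_elt (inv u)))" by (rule conv_assoc)
      also have "conv G (grp_elt u) (grp_elt (inv u)) = (grp_elt \<one> :: 'g \<Rightarrow> 'k)"
        using u by (simp add: grp_elt_mult)
      finally show ?thesis using conv_one_right[OF zs] by simp
    qed
    thus "z \<in> fixalg (carrier G) (carrier G)" using zR unfolding fixalg_carrier[OF subset_refl] by blast
  qed
  show "fixalg (carrier G) (carrier G) \<subseteq> center (group_ring \<O> G)"
  proof
    fix z assume z: "z \<in> fixalg (carrier G) (carrier G)"
    have "conv G z a = conv G a z" if "a \<in> carrier (group_ring \<O> G)" for a
      using z that by (intro conv_commute_invariant[of "carrier G"]) (auto simp: fixalg_def)
    thus "z \<in> center (group_ring \<O> G)"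
      using z unfolding center_def fixalg_carrier[OF subset_refl] by auto
  qed
qed

lemma fixalg_commutes:
  assumes "z \<in> fixalg (carrier G) (carrier G)" "a \<in> supp"
  shows "conv G z a = conv G a z"
  using assms by (intro conv_commute_invariant[of "carrier G"]) (auto simp: fixalg_def supp_def)

text \<open>An idempotent \<open>e\<close> with \<open>ie = e = ei\<close> gives the orthogonal decomposition \<open>i = e + (i - e)\<close>.\<close>

lemma primitive_in_if_primitive_idempotent:
  assumes prim: "primitive_idempotent A i"
    and A: "monoid.mult A = conv G" "zero A = 0" "add A = (+)"
    and iR: "i \<in> R" and R: "\<And>e. e \<in> R \<Longrightarrow> conv G i e = e \<Longrightarrow> conv G e i = e \<Longrightarrow> e \<in> carrier A \<and> i - e \<in> carrier A"
  shows "primitive_in R i"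
  unfolding primitive_in_def
proof (intro conjI ballI impI)
  have i: "conv G i i = i" "i \<noteq> 0"
    and dec: "\<And>e h. e \<in> carrier A \<Longrightarrow> h \<in> carrier A \<Longrightarrow> conv G e e = e \<Longrightarrow> conv G h h = h \<Longrightarrow>
      conv G e h = 0 \<Longrightarrow> conv G h e = 0 \<Longrightarrow> i = e + h \<Longrightarrow> e = 0 \<or> h = 0"
    using prim by (auto simp: primitive_idempotent_def A simp del: plus_fun_apply)
  show "i \<in> R" "conv G i i = i" "i \<noteq> 0" using iR i by auto
  fix e assume e: "e \<in> R" "conv G e e = e \<and> conv G e i = e \<and> conv G i e = e"
  have "e = 0 \<or> i - e = 0"
  proof (rule dec)
    show "e \<in> carrier A" "i - e \<in> carrier A" using R e by auto
    show "conv G e e = e" using e by simp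
    show "conv G (i - e) (i - e) = i - e" "conv G e (i - e) = 0" "conv G (i - e) e = 0"
      using e i by (simp_all only: conv_diff_left conv_diff_right) simp_all
    show "i = e + (i - e)" by (metis add.commute diff_add_cancel)
  qed
  thus "e = 0 \<or> e = i" by (metis eq_iff_diff_eq_0)
qed

lemma block_idempotent_primitive:
  assumes "block_idempotent \<O> G b"
  shows "primitive_in (fixalg (carrier G) (carrier G)) b"
proof (rule primitive_in_if_primitive_idempotent)
  show "primitive_idempotent (group_ring \<O> G\<lparr>carrier := center (group_ring \<O> G)\<rparr>) b"
    using assms by (simp add: block_idempotent_def)
  thus b: "b \<in> fixalg (carrier G) (carrier G)" by (simp add: primitive_idempotent_def center_group_ring)
  show "e \<in> carrier (group_ring \<O> G\<lparr>carrier := center (group_ring \<O> G)\<rparr>) \<and>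
      b - e \<in> carrier (group_ring \<O> G\<lparr>carrier := center (group_ring \<O> G)\<rparr>)"
    if "e \<in> fixalg (carrier G) (carrier G)" for e
    using that fixalg_diff[OF b that] by (simp add: center_group_ring)
qed simp_all

lemma block_algebra_carrier:
  assumes b: "primitive_in (fixalg (carrier G) (carrier G)) b"
  shows "carrier (block_algebra \<O> G b) = {a \<in> carrier (group_ring \<O> G). conv G b a = a}"
proof -
  have bR: "b \<in> fixalg (carrier G) (carrier G)" and bb: "conv G b b = b" using b by (auto simp: primitive_in_def)
  have supp: "a \<in> supp" if "a \<in> carrier (group_ring \<O> G)" for a :: "'g \<Rightarrow> 'k" using that by (simp add: supp_def)
  have bG: "b \<in> carrier (group_ring \<O> G)" using bR unfolding fixalg_carrier[OF subset_refl] by blast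
  have closed: "conv G a a' \<in> carrier (group_ring \<O> G)"
    if "a \<in> carrier (group_ring \<O> G)" "a' \<in> carrier (group_ring \<O> G)" for a a'
    using fixalg_conv[OF subgroup_self empty_subsetI, of a a'] that
    unfolding fixalg_carrier[OF empty_subsetI] by blast
  have bab: "conv G (conv G b a) b = conv G b a" if "a \<in> carrier (group_ring \<O> G)" for a
    using fixalg_commutes[OF bR supp[OF that]] conv_assoc[of b b a] bb conv_assoc[of b a b] by metis
  have "conv G b (conv G b a) = conv G b a" for a by (metis conv_assoc bb)
  thus ?thesis unfolding block_algebra_def corner_def
    using bab closed[OF bG] by (auto simp del: group_ring_simps(1) simp: group_ring_simps(2)) metis
qed

lemma source_idempotent_primitive:
  assumes b: "primitive_in (fixalg (carrier G) (carrier G)) b" and P: "P \<subseteq> carrier G"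
    and i: "primitive_idempotent (fixed_points G P (block_algebra \<O> G b)) i"
  shows "primitive_in (fixalg (carrier G) P) i \<and> conv G b i = i \<and> conv G i b = i"
proof -
  have bR: "b \<in> fixalg (carrier G) (carrier G)" using b by (auto simp: primitive_in_def)
  have C: "carrier (fixed_points G P (block_algebra \<O> G b)) = {a \<in> fixalg (carrier G) P. conv G b a = a}"
    unfolding fixalg_carrier[OF P] by (auto simp: fixed_points_def block_algebra_carrier[OF b] simp del: group_ring_simps(1))
  have iC: "i \<in> fixalg (carrier G) P" "conv G b i = i" using i unfolding primitive_idempotent_def C by auto
  have "primitive_in (fixalg (carrier G) P) i"
  proof (rule primitive_in_if_primitive_idempotent[OF i])
    show "i \<in> fixalg (carrier G) P" by (rule iC)
    fix e assume e: "e \<in> fixalg (carrier G) P" "conv G i e = e"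
    have "conv G b e = e" using e(2) iC(2) by (metis conv_assoc)
    thus "e \<in> carrier (fixed_points G P (block_algebra \<O> G b)) \<and> i - e \<in> carrier (fixed_points G P (block_algebra \<O> G b))"
      unfolding C using e iC fixalg_diff[OF iC(1) e(1)] by (simp add: conv_diff_right)
  qed (simp_all add: fixed_points_def block_algebra_def corner_def)
  moreover have "i \<in> supp" using iC fixalg_supp[OF subset_refl] by blast
  hence "conv G i b = i" using fixalg_commutes[OF bR] iC by metis
  ultimately show ?thesis using iC by blast
qed

text \<open>A module over the block algebra of \<open>b\<close> is a \<open>KG\<close>-module, on which \<open>a\<close> acts as \<open>ba\<close>.\<close>

lemma block_module_rep:
  assumes b: "primitive_in (fixalg (carrier G) (carrier G)) b"
    and V: "is_module (scalar_ext (block_algebra \<O> G b)) V"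
  shows "group_rep G supp (\<lambda>a. maction V (conv G b a)) (mspace V)"
proof -
  have bR: "b \<in> fixalg (carrier G) (carrier G)" and bb: "conv G b b = b" using b by (auto simp: primitive_in_def)
  have bs: "b \<in> supp" using bR fixalg_supp[OF subset_refl] by blast
  let ?K = "carrier (scalar_ext (block_algebra \<O> G b))"
  have K: "?K = fvec.span (carrier (block_algebra \<O> G b))" by (simp add: scalar_ext_def)
  have mult: "monoid.mult (scalar_ext (block_algebra \<O> G b)) = conv G"
    and one: "one (scalar_ext (block_algebra \<O> G b)) = b"
    and add: "add (scalar_ext (block_algebra \<O> G b)) = (+)"
    by (simp_all add: scalar_ext_def block_algebra_def corner_def)
  have bbb: "conv G b (conv G b a) = conv G b a" for a by (metis conv_assoc bb)
  have mem: "conv G b a \<in> ?K" if a: "a \<in> supp" for a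
  proof -
    have "conv G b a = conv G b (\<Sum>x\<in>carrier G. fscale (a x) (grp_elt x))"
      using supp_expansion[OF a] by simp
    also have "\<dots> = (\<Sum>x\<in>carrier G. fscale (a x) (conv G b (grp_elt x)))"
    proof -
      have "conv G b (\<Sum>x\<in>F. fscale (a x) (grp_elt x)) = (\<Sum>x\<in>F. fscale (a x) (conv G b (grp_elt x)))" for F
      proof (induction F rule: infinite_finite_induct)
        case (insert x F)
        show ?case unfolding sum.insert[OF insert(1,2)] conv_add_right insert(3) conv_scale_right ..
      qed (simp_all add: conv_def fun_eq_iff)
      thus ?thesis .
    qed
    also have "\<dots> \<in> ?K" unfolding K
    proof (intro fvec.span_sum fvec.span_scale fvec.span_base)
      fix x assume x: "x \<in> carrier G"
      have "grp_elt x \<in> fixalg (carrier G) {}" using x zero_mem one_mem by (auto simp: fixalg_def grp_elt_def)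
      moreover have "b \<in> fixalg (carrier G) {}" using bR by (auto simp: fixalg_def)
      ultimately have "conv G b (grp_elt x) \<in> carrier (group_ring \<O> G)"
        using fixalg_conv[OF subgroup_self empty_subsetI] unfolding fixalg_carrier[OF empty_subsetI] by blast
      thus "conv G b (grp_elt x) \<in> carrier (block_algebra \<O> G b)"
        unfolding block_algebra_carrier[OF b] using bbb by blast
    qed
    finally show ?thesis .
  qed
  have Kscale: "fscale c a \<in> ?K" if "a \<in> ?K" for c a using that unfolding K by (rule fvec.span_scale)
  have bK: "b \<in> ?K" using mem[OF bs] bb by simp
  note V' = V[unfolded is_module_def mult one add]
  have Vfin: "\<exists>F. finite F \<and> mspace V = fvec.span F" using V' by blast
  have Vmem: "maction V a v \<in> mspace V" if "a \<in> ?K" "v \<in> mspace V" for a v using V' that by blast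
  have Vvadd: "maction V a (v + w) = maction V a v + maction V a w"
    if "a \<in> ?K" "v \<in> mspace V" "w \<in> mspace V" for a v w using V' that by blast
  have Vadd: "maction V (a + a') v = maction V a v + maction V a' v"
    if "a \<in> ?K" "a' \<in> ?K" "v \<in> mspace V" for a a' v using V' that by blast
  have Vconv: "maction V (conv G a a') v = maction V a (maction V a' v)"
    if "a \<in> ?K" "a' \<in> ?K" "v \<in> mspace V" for a a' v using V' that by blast
  have Vone: "maction V b v = v" if "v \<in> mspace V" for v using V' that by blast
  have Vscale: "maction V (fscale c a) v = fscale c (maction V a v)"
    if "a \<in> ?K" "v \<in> mspace V" for c a v using V' that by blast
  show ?thesis
  proof
    show "\<exists>S. finite S \<and> mspace V = fvec.span S" by (rule Vfin)
    show "grp_elt \<one> \<in> supp" by (simp add: grp_elt_in_supp)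
    show "0 \<in> supp" by (simp add: supp_def)
    show "conv G a a' \<in> supp" for a a' :: "'g \<Rightarrow> 'k" by (rule conv_in_supp)
    show "a + a' \<in> supp" if "a \<in> supp" "a' \<in> supp" for a a' :: "'g \<Rightarrow> 'k"
      using that by (simp add: supp_def)
    fix a :: "'g \<Rightarrow> 'k" and v assume a: "a \<in> supp" and v: "v \<in> mspace V"
    note aK = mem[OF a]
    show "maction V (conv G b a) v \<in> mspace V" using Vmem[OF aK v] .
    show "maction V (conv G b a) (v + w) = maction V (conv G b a) v + maction V (conv G b a) w"
      if "w \<in> mspace V" for w using Vvadd[OF aK v that] .
    show "maction V (conv G b (a + a')) v = maction V (conv G b a) v + maction V (conv G b a') v"
      if "a' \<in> supp" for a' using Vadd[OF aK mem[OF that] v] by (simp only: conv_add_right)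
    show "maction V (conv G b (conv G a a')) v = maction V (conv G b a) (maction V (conv G b a') v)"
      if a': "a' \<in> supp" for a'
    proof -
      have "conv G (conv G b a) (conv G b a') = conv G b (conv G (conv G a b) a')" by (simp only: conv_assoc)
      also have "conv G a b = conv G b a" using fixalg_commutes[OF bR a] by simp
      also have "conv G b (conv G (conv G b a) a') = conv G b (conv G a a')" by (simp only: conv_assoc bbb)
      finally show ?thesis using Vconv[OF aK mem[OF a'] v] by simp
    qed
    show "maction V (conv G b a) (fscale c v) = fscale c (maction V (conv G b a) v)" for c
    proof -
      have "maction V (conv G b a) (fscale c v) = maction V (conv G b a) (maction V (fscale c b) v)"
        using Vscale[OF bK v] Vone[OF v] by simp
      also have "\<dots> = maction V (conv G (conv G b a) (fscale c b)) v"
        using Vconv[OF aK Kscale[OF bK] v] by simp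
      also have "conv G (conv G b a) (fscale c b) = fscale c (conv G b a)"
        using fixalg_commutes[OF bR a] bbb[of a] by (metis conv_assoc conv_scale_right)
      finally show ?thesis using Vscale[OF aK v] by simp
    qed
  next
    fix v assume "v \<in> mspace V"
    thus "maction V (conv G b (grp_elt \<one>)) v = v" using Vone conv_one_right[OF bs] by simp
  qed
qed

end


section \<open>Passing to a subgroup\<close>

context group_algebra
begin

lemma conv_subgroup:
  assumes H: "subgroup H G" and a: "a \<in> alg H" and b: "b \<in> alg H"
  shows "conv (G\<lparr>carrier := H\<rparr>) a b = conv G a b"
proof
  fix x
  have HG: "H \<subseteq> carrier G" using H by (rule subgroup.subset)
  show "conv (G\<lparr>carrier := H\<rparr>) a b x = conv G a b x"
  proof (cases "x \<in> H")
    case True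
    have "conv G a b x = (\<Sum>y\<in>carrier G. a y * b (inv y \<otimes> x))" using True HG by (auto simp: conv_def)
    also have "\<dots> = (\<Sum>y\<in>H. a y * b (inv y \<otimes> x))"
      using HG fin a by (intro sum.mono_neutral_right) (auto simp: alg_def)
    finally show ?thesis using True by (simp add: conv_def m_inv_consistent[OF H])
  next
    case False
    hence "conv (G\<lparr>carrier := H\<rparr>) a b x = 0" by (simp add: conv_def)
    moreover have "conv G a b x = 0" using conv_supp_subgroup[OF H _ _ False] a b by (simp only: alg_def mem_Collect_eq)
    ultimately show ?thesis by simp
  qed
qed

lemma conj_act_subgroup:
  assumes H: "subgroup H G" and x: "x \<in> H" and a: "a \<in> alg H"
  shows "conj_act (G\<lparr>carrier := H\<rparr>) x a = conj_act G x a"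
proof -
  have g: "grp_elt y \<in> alg H" if "y \<in> H" for y using that by (auto simp: alg_def grp_elt_def)
  have ix: "inv x \<in> H" using H x by (rule subgroup.m_inv_closed)
  show ?thesis unfolding conj_act_def m_inv_consistent[OF H x]
    using conv_subgroup[OF H g[OF x] a] conv_subgroup[OF H alg_conv[OF H g[OF x] a] g[OF ix]] by simp
qed

lemma group_algebra_subgroup:
  assumes H: "subgroup H G"
  shows "group_algebra (G\<lparr>carrier := H\<rparr>) \<O> \<pi> res p"
proof -
  interpret H: group "G\<lparr>carrier := H\<rparr>" using subgroup_imp_group[OF H] .
  have "finite H" using subgroup.subset[OF H] fin finite_subset by blast
  thus ?thesis by unfold_locales simp
qed

lemma fixalg_subgroup:
  assumes H: "subgroup H G" and Q: "Q \<subseteq> H"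
  shows "group_algebra.fixalg (G\<lparr>carrier := H\<rparr>) \<O> H Q = fixalg H Q"
proof -
  interpret H: group_algebra "G\<lparr>carrier := H\<rparr>" \<O> \<pi> res p by (rule group_algebra_subgroup[OF H])
  have HG: "H \<subseteq> carrier G" using H by (rule subgroup.subset)
  have out: "u \<otimes> x \<otimes> inv u \<notin> H" if u: "u \<in> Q" and x: "x \<in> carrier G" "x \<notin> H" for u x
  proof
    assume *: "u \<otimes> x \<otimes> inv u \<in> H"
    have uH: "u \<in> H" using u Q by blast
    hence uG: "u \<in> carrier G" using HG by blast
    have "inv u \<otimes> (u \<otimes> x \<otimes> inv u) \<otimes> u \<in> H" using * uH H by (simp add: subgroup.m_closed subgroup.m_inv_closed)
    thus False using conj_inv_cancel(1)[OF uG x(1)] x by simp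
  qed
  show ?thesis
  proof (intro equalityI subsetI)
    fix a assume "a \<in> fixalg H Q"
    thus "a \<in> H.fixalg H Q" using Q HG by (auto simp: fixalg_def H.fixalg_def m_inv_consistent[OF H] subset_iff)
  next
    fix a assume a: "a \<in> H.fixalg H Q"
    have "a (u \<otimes> x \<otimes> inv u) = a x" if u: "u \<in> Q" and x: "x \<in> carrier G" for u x
    proof (cases "x \<in> H")
      case True
      thus ?thesis using a u Q by (auto simp: H.fixalg_def m_inv_consistent[OF H] subset_iff)
    next
      case False
      thus ?thesis using a out[OF u x False] by (simp add: H.fixalg_def)
    qed
    thus "a \<in> fixalg H Q" using a by (simp add: fixalg_def H.fixalg_def)
  qed
qed

lemma primitive_in_subgroup:
  assumes H: "subgroup H G" and A: "A \<subseteq> alg H" and i: "group_algebra.primitive_in (G\<lparr>carrier := H\<rparr>) A i"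
  shows "primitive_in A i"
proof -
  interpret H: group_algebra "G\<lparr>carrier := H\<rparr>" \<O> \<pi> res p by (rule group_algebra_subgroup[OF H])
  have c: "conv (G\<lparr>carrier := H\<rparr>) a a' = conv G a a'" if "a \<in> A" "a' \<in> A" for a a'
    using conv_subgroup[OF H] that A by blast
  have iA: "i \<in> A" using i by (simp add: H.primitive_in_def)
  show ?thesis using i unfolding primitive_in_def H.primitive_in_def by (auto simp: c iA)
qed

lemma group_rep_subgroup:
  assumes H: "subgroup H G" and rep: "group_rep (G\<lparr>carrier := H\<rparr>) (alg H) \<rho> M"
  shows "group_rep G (alg H) \<rho> M"
proof -
  interpret H: group_rep "G\<lparr>carrier := H\<rparr>" "alg H" \<rho> M by (rule rep)
  note c = conv_subgroup[OF H]
  show ?thesis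
  proof
    show "\<exists>S. finite S \<and> M = fvec.span S" by (rule H.M_fin)
    show "grp_elt \<one> \<in> alg H" using H.A_one by simp
    show "conv G a b \<in> alg H" if "a \<in> alg H" "b \<in> alg H" for a b using alg_conv[OF H that] .
    show "\<rho> (conv G a b) v = \<rho> a (\<rho> b v)" if "a \<in> alg H" "b \<in> alg H" "v \<in> M" for a b v
      using H.\<rho>_conv[OF that] c[OF that(1,2)] by simp
    show "\<rho> (grp_elt \<one>) v = v" if "v \<in> M" for v using H.\<rho>_one[OF that] by simp
  qed (fact H.A_zero H.A_add H.\<rho>_mem H.\<rho>_vadd H.\<rho>_vscale H.\<rho>_add)+
qed

end

section \<open>Degrees of characters and the comparison of dimensions\<close>

lemma
  assumes "is_module A V"
  shows is_module_fin: "\<exists>F. finite F \<and> mspace V = fvec.span F"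
    and is_module_one: "v \<in> mspace V \<Longrightarrow> maction V \<one>\<^bsub>A\<^esub> v = v"
  using assms by (auto simp: is_module_def)

lemma lin_trace_identity:
  assumes T: "\<And>v. v \<in> M \<Longrightarrow> T v = v" and M: "M = fvec.span F"
  shows "lin_trace M T = of_nat (fvec.dim M)"
proof -
  have "\<exists>E. \<not> fvec.dependent E \<and> fvec.span E = M"
  proof -
    obtain E where E: "E \<subseteq> M" "\<not> fvec.dependent E" "M \<subseteq> fvec.span E" "card E = fvec.dim M"
      using fvec.basis_exists by blast
    moreover have "fvec.span E \<subseteq> M" using fvec.span_minimal[OF E(1)] fvec.subspace_span M by blast
    ultimately show ?thesis by blast
  qed
  hence "\<not> fvec.dependent (SOME E. \<not> fvec.dependent E \<and> fvec.span E = M) \<and>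
      fvec.span (SOME E. \<not> fvec.dependent E \<and> fvec.span E = M) = M" (is "_ \<and> fvec.span ?E = M")
    by (rule someI_ex)
  hence E: "\<not> fvec.dependent ?E" "fvec.span ?E = M" by blast+
  have "lin_trace M T = (\<Sum>e\<in>?E. fvec.representation ?E (T e) e)"
    unfolding lin_trace_def Let_def ..
  also have "\<dots> = (\<Sum>e\<in>?E. 1)"
  proof (rule sum.cong[OF refl])
    fix e assume e: "e \<in> ?E"
    have "e \<in> M" using fvec.span_base[OF e] unfolding E(2) .
    thus "fvec.representation ?E (T e) e = 1" using fvec.representation_basis[OF E(1) e] T by simp
  qed
  also have "\<dots> = of_nat (fvec.dim M)"
    using fvec.dim_span_eq_card_independent[OF E(1)] E(2) by simp
  finally show ?thesis .
qed

lemma char_degree_character: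
  fixes V :: "('g, 'k::field_char_0) amodule"
  assumes G: "group G" and B: "B = block_algebra S G b" and b: "conv G b (grp_elt \<one>\<^bsub>G\<^esub>) = b"
    and V: "is_module (scalar_ext B) V"
  shows "char_degree G (character G B V) = mdim V"
proof -
  interpret group G by (rule G)
  have oneB: "one B = b" "monoid.mult B = conv G" and oneS: "one (scalar_ext B) = b"
    by (simp_all add: B scalar_ext_def block_algebra_def corner_def)
  obtain F where F: "mspace V = fvec.span F" using is_module_fin[OF V] by blast
  have "character G B V \<one>\<^bsub>G\<^esub> = lin_trace (mspace V) (maction V b)"
    by (simp add: character_def oneB b)
  also have "\<dots> = of_nat (mdim V)" unfolding mdim_def
    by (rule lin_trace_identity[OF _ F]) (use is_module_one[OF V] oneS in simp)
  finally have "character G B V \<one>\<^bsub>G\<^esub> = of_nat (mdim V)" .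
  thus ?thesis unfolding char_degree_def by (intro the_equality) auto
qed

lemma mdim_module_iso:
  fixes V W :: "('g, 'k::field) amodule"
  assumes iso: "module_iso A V W" and V: "\<exists>F. finite F \<and> mspace V = fvec.span F"
    and W: "\<exists>F. finite F \<and> mspace W = fvec.span F"
  shows "mdim V = mdim W"
proof -
  obtain h where h: "module_hom_on A V W h" "bij_betw h (mspace V) (mspace W)"
    using iso by (auto simp: module_iso_def)
  obtain S T where S: "finite S" "mspace V = fvec.span S" and T: "finite T" "mspace W = fvec.span T"
    using V W by blast
  have add: "h (v + w) = h v + h w" if "v \<in> mspace V" "w \<in> mspace V" for v w
    using h(1) that unfolding module_hom_on_def by blast
  have scale: "h (fscale c v) = fscale c (h v)" if "v \<in> mspace V" for c v
    using h(1) that unfolding module_hom_on_def by blast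
  have sV: "fvec.subspace (mspace V)" and sW: "fvec.subspace (mspace W)"
    unfolding S(2) T(2) by (rule fvec.subspace_span)+
  have "fvec.dim (mspace W) \<le> fvec.dim (mspace V)"
    by (rule dim_le_if_linear_image[OF sV S(1) _ add scale])
      (use S(2) h(2) in \<open>auto simp: bij_betw_def\<close>)
  moreover have "fvec.dim (mspace V) \<le> fvec.dim (mspace W)"
  proof -
    define k where "k = inv_into (mspace V) h"
    have k: "k w \<in> mspace V" "h (k w) = w" if "w \<in> mspace W" for w
      using inv_into_into[of w h "mspace V"] f_inv_into_f[of w h "mspace V"] h(2) that
      unfolding k_def bij_betw_def by auto
    have inj: "v = v'" if "v \<in> mspace V" "v' \<in> mspace V" "h v = h v'" for v v'
      using h(2) that unfolding bij_betw_def inj_on_def by blast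
    show ?thesis
    proof (rule dim_le_if_linear_image[OF sW T(1)])
      show "mspace W \<subseteq> fvec.span T" using T by simp
      show "k (v + w) = k v + k w" if v: "v \<in> mspace W" "w \<in> mspace W" for v w
      proof (rule inj)
        show "h (k (v + w)) = h (k v + k w)"
          unfolding add[OF k(1)[OF v(1)] k(1)[OF v(2)]] k(2)[OF v(1)] k(2)[OF v(2)]
          by (rule k(2)[OF fvec.subspace_add[OF sW v]])
        show "k (v + w) \<in> mspace V" by (rule k(1)[OF fvec.subspace_add[OF sW v]])
        show "k v + k w \<in> mspace V" by (rule fvec.subspace_add[OF sV k(1)[OF v(1)] k(1)[OF v(2)]])
      qed
      show "k (fscale c v) = fscale c (k v)" if v: "v \<in> mspace W" for c v
      proof (rule inj)
        show "h (k (fscale c v)) = h (fscale c (k v))"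
          unfolding scale[OF k(1)[OF v]] k(2)[OF v] by (rule k(2)[OF fvec.subspace_scale[OF sW v]])
        show "k (fscale c v) \<in> mspace V" by (rule k(1)[OF fvec.subspace_scale[OF sW v]])
        show "fscale c (k v) \<in> mspace V" by (rule fvec.subspace_scale[OF sV k(1)[OF v]])
      qed
      show "mspace V \<subseteq> k ` mspace W"
      proof
        fix v assume v: "v \<in> mspace V"
        hence hv: "h v \<in> mspace W" using h(2) by (auto simp: bij_betw_def)
        have "v = k (h v)" by (rule inj[OF v k(1)[OF hv]]) (simp add: k(2)[OF hv])
        thus "v \<in> k ` mspace W" using hv by blast
      qed
    qed
  qed
  ultimately show ?thesis by (simp add: mdim_def)
qed

context p_subgroup_algebra
begin

text \<open>The inequality \<open>dim eU \<le> dim (be)M\<close> is shown for all idempotents \<open>e\<close> of \<open>(\<O>N)\<^sup>P\<close> below \<open>c\<close>, by induction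
on the rank of \<open>e\<close>. If \<open>e\<close> is primitive, it factors through \<open>j\<close>, and \<open>i\<close> factors through \<open>be\<close>; otherwise
it is a sum of two orthogonal idempotents of smaller rank.\<close>

theorem dim_le_if_source_dim_le:
  assumes c: "primitive_in (fixalg N N) c"
    and T: "trace_transversal T" and a: "a \<in> fixalg N P" "c = (\<Sum>x\<in>T. conj_act G x a)"
    and b: "primitive_in (fixalg (carrier G) (carrier G)) b"
    and bc: "\<And>x. x \<in> centralizer G P \<Longrightarrow> res (b x) = res (c x)"
    and j: "primitive_in (fixalg N P) j" "conv G j c = j" "j \<notin> brauer_kernel N"
    and i: "primitive_in (fixalg (carrier G) P) i" "conv G i b = i" "i \<notin> brauer_kernel (carrier G)"
    and V: "group_rep G supp \<rho> M" and Y: "group_rep G (alg N) \<eta> U"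
    and ij: "group_rep.mult_dim \<eta> U j \<le> group_rep.mult_dim \<rho> M i"
  shows "group_rep.mult_dim \<eta> U c \<le> fvec.dim M"
proof -
  interpret V: group_rep G supp \<rho> M by (rule V)
  interpret Y: group_rep G "alg N" \<eta> U by (rule Y)
  let ?G = "carrier G"
  have G: "subgroup ?G G" by (rule subgroup_self)
  have NG: "fixalg N P \<subseteq> fixalg ?G P" by (rule fixalg_mono[OF N_carrier subset_refl])
  have kNG: "brauer_kernel ?G \<inter> fixalg N P = brauer_kernel N" using NG by (auto simp: brauer_kernel_def)
  have Gs: "fixalg ?G P \<subseteq> supp" by (rule fixalg_supp[OF subset_refl])
  have bR: "b \<in> fixalg ?G ?G" and bb: "conv G b b = b" using b by (auto simp: primitive_in_def)
  have cR: "c \<in> fixalg N N" and cc: "conv G c c = c" using c by (auto simp: primitive_in_def)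
  have jR: "j \<in> fixalg N P" and jj: "conv G j j = j" using j by (auto simp: primitive_in_def)
  have iR: "i \<in> fixalg ?G P" using i by (simp add: primitive_in_def)
  have bP: "b \<in> fixalg ?G P" using bR fixalg_mono[OF subset_refl P_carrier] by blast
  have cP: "c \<in> fixalg N P" using cR fixalg_mono[OF subset_refl P_sub_N] by blast
  have cG: "c \<in> fixalg ?G P" using cP NG by blast
  have kz: "0 \<in> brauer_kernel H" for H by (simp add: brauer_kernel_def fixalg_zero res_zero)
  have cb: "c - b \<in> brauer_kernel ?G"
    using fixalg_diff[OF cG bP] bc cG bP by (simp add: brauer_kernel_def fixalg_def res_diff)
  have ic: "conv G i c - i \<in> brauer_kernel ?G"
    using brauer_kernel_conv[OF G iR fixalg_diff[OF cG bP] disjI2[OF cb]]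
    by (simp only: conv_diff_right i(2))
  have main: "Y.mult_dim e \<le> V.mult_dim (conv G b e)"
    if "e \<in> fixalg N P" "conv G e e = e" "conv G e c = e" for e
    using that
  proof (induction "idem_rank e" arbitrary: e rule: less_induct)
    case less
    have eG: "e \<in> fixalg ?G P" using less.prems NG by blast
    have es: "e \<in> supp" using eG Gs by blast
    have be: "conv G b e = conv G e b" using fixalg_commutes[OF bR es] .
    have beR: "conv G b e \<in> fixalg ?G P" by (rule fixalg_conv[OF G P_carrier bP eG])
    show ?case
    proof (cases "e = 0")
      case True
      thus ?thesis using Y.mult_dim_zero by simp
    next
      case e0: False
      have ek: "e \<notin> brauer_kernel N"
      proof
        assume "e \<in> brauer_kernel N"
        from idempotent_in_brauer_kernel[OF N_sub P_sub_N normalizer_conj(2)[OF P_sub] this less.prems(2)]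
        show False using e0 by simp
      qed
      show ?thesis
      proof (cases "primitive_in (fixalg N P) e")
        case prim: True
        have "\<exists>g\<in>alg N. \<exists>h\<in>alg N. e = conv G g (conv G j h)"
          using primitive_factors_through[OF N_sub subset_refl c T a jR jj j(3) _ prim ek] kz j(2) less.prems(3)
          by simp
        then obtain g h where gh: "g \<in> alg N" "h \<in> alg N" "e = conv G g (conv G j h)" by blast
        have 1: "Y.mult_dim e \<le> Y.mult_dim j"
          unfolding gh(3) by (rule Y.mult_dim_le[OF gh(1) fixalg_alg[OF jR] gh(2)])
        have bece: "conv G (conv G b e) (conv G b e) = conv G b e"
          using be less.prems(2) bb by (metis conv_assoc)
        have bec: "conv G (conv G b e) c = conv G b e" using less.prems(3) by (simp add: conv_assoc)
        \<comment> \<open>\<open>be\<close> and \<open>e = ce\<close> agree modulo the Brauer kernel, because \<open>b\<close> and \<open>c\<close> do.\<close>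
        have bek: "conv G b e \<notin> brauer_kernel ?G"
        proof
          assume k: "conv G b e \<in> brauer_kernel ?G"
          have "conv G c e = e"
            using conv_commute_invariant[OF N_carrier, of c e] cR less.prems
            by (simp add: fixalg_def)
          moreover have "conv G (c - b) e \<in> brauer_kernel ?G"
            using brauer_kernel_conv[OF G fixalg_diff[OF cG bP] eG] cb by blast
          ultimately have "e - conv G b e \<in> brauer_kernel ?G" by (simp only: conv_diff_left)
          hence "e - conv G b e - (0 - conv G b e) \<in> brauer_kernel ?G"
            using brauer_kernel_diff[OF _ brauer_kernel_diff[OF kz k]] by blast
          hence "e \<in> brauer_kernel ?G" by (simp only: diff_diff_eq2 add_0_left diff_add_cancel diff_0 diff_minus_eq_add)
          thus False using ek kNG less.prems(1) by blast
        qed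
        have "\<exists>g\<in>alg ?G. \<exists>h\<in>alg ?G. i = conv G g (conv G (conv G b e) h)"
          using primitive_factors_through[OF G N_carrier c T a beR bece bek _ i(1) i(3) ic] kz bec by simp
        then obtain g' h' where gh': "g' \<in> supp" "h' \<in> supp" "i = conv G g' (conv G (conv G b e) h')"
          by (auto simp: alg_def supp_def)
        have "V.mult_dim i \<le> V.mult_dim (conv G b e)"
          using V.mult_dim_le[OF gh'(1) _ gh'(2), of "conv G b e"] gh'(3) by simp
        thus ?thesis using 1 ij by simp
      next
        case False
        then obtain e1 where e1: "e1 \<in> fixalg N P" "conv G e1 e1 = e1" "conv G e1 e = e1" "conv G e e1 = e1"
          "e1 \<noteq> 0" "e1 \<noteq> e"
          using less.prems e0 unfolding primitive_in_def by blast
        define e2 where "e2 = e - e1"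
        have e2R: "e2 \<in> fixalg N P" unfolding e2_def by (rule fixalg_diff[OF less.prems(1) e1(1)])
        have e2: "conv G e2 e2 = e2" "conv G e1 e2 = 0" "conv G e2 e1 = 0"
          unfolding e2_def by (simp_all only: conv_diff_left conv_diff_right e1 less.prems(2)) simp_all
        have e2n: "e2 \<noteq> 0" using e1(6) unfolding e2_def by (metis eq_iff_diff_eq_0)
        have sum: "e1 + e2 = e" unfolding e2_def by (metis add.commute diff_add_cancel)
        have s: "e1 \<in> supp" "e2 \<in> supp" using e1(1) e2R NG Gs by blast+
        have c1: "conv G e1 c = e1" using e1(3) less.prems(3) by (metis conv_assoc)
        have c2: "conv G e2 c = e2" unfolding e2_def by (simp only: conv_diff_left c1 less.prems(3))
        have rk: "idem_rank e = idem_rank e1 + idem_rank e2"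
          unfolding sum[symmetric] by (rule idem_rank_add[OF s(1) e1(2) s(2) e2])
        have "idem_rank e1 > 0" "idem_rank e2 > 0" using idem_rank_pos s e1(5) e2n by auto
        hence IH: "Y.mult_dim e1 \<le> V.mult_dim (conv G b e1)" "Y.mult_dim e2 \<le> V.mult_dim (conv G b e2)"
          using less.hyps[of e1] less.hyps[of e2] rk e1 e2R e2 c1 c2 by auto
        have bm: "conv G (conv G b x) (conv G b y) = conv G b (conv G x y)" if "x \<in> supp" for x y
          using fixalg_commutes[OF bR that] bb by (metis conv_assoc)
        have bz: "conv G b 0 = 0" by (simp add: conv_def fun_eq_iff)
        have "Y.mult_dim e = Y.mult_dim e1 + Y.mult_dim e2"
          unfolding sum[symmetric]
          by (rule Y.mult_dim_add[OF fixalg_alg[OF e1(1)] e1(2) fixalg_alg[OF e2R] e2])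
        moreover have "V.mult_dim (conv G b e) = V.mult_dim (conv G b e1) + V.mult_dim (conv G b e2)"
          unfolding sum[symmetric] conv_add_right
          by (rule V.mult_dim_add) (simp_all only: conv_in_supp bm[OF s(1)] bm[OF s(2)] e1 e2 bz)
        ultimately show ?thesis using IH by simp
      qed
    qed
  qed
  have "Y.mult_dim c \<le> V.mult_dim (conv G b c)" by (rule main[OF cP cc cc])
  also have "\<dots> \<le> fvec.dim M" by (rule V.mult_dim_le_dim) simp_all
  finally show ?thesis .
qed

end

theorem theorem3p1:
  fixes p :: nat
    and \<O> :: "'k::field_char_0 set"
    and res :: "'k \<Rightarrow> 'r::alg_closed_field"
    and G :: "('g, 'm) monoid_scheme"
    and P :: "'g set"
    and b c i j :: "'g \<Rightarrow> 'k"
    and B C :: "('g \<Rightarrow> 'k) ring"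
    and g :: "('g, 'k) amodule set \<Rightarrow> ('g, 'k) amodule set"
    and f :: "('g \<Rightarrow> 'k) \<Rightarrow> ('g \<Rightarrow> 'k)"
  assumes "Factorial_Ring.prime p"
    and "complete_dvr (subring_record \<O>)"
    and "is_fraction_field_of \<O>"
    and "is_residue_map \<O> res"
    and "CHAR('r) = p"
    and "group G" and "finite (carrier G)"
    and "block_idempotent \<O> G b" and "defect_group \<O> G b P"
    and "brauer_correspondent \<O> res G P b c"
    and "B = block_algebra \<O> G b"
    and "C = block_algebra \<O> (normalizer_group G P) c"
    and "split_algebra (scalar_ext B)" and "split_algebra (scalar_ext C)"
    and "source_idempotent res G P B i"
    and "source_idempotent res (normalizer_group G P) P C j"
    and "bij_betw g (irr_p' p (corner B i)) (irr_p' p (corner C j))"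
    and "\<And>W U. simple_module (scalar_ext (corner B i)) W \<Longrightarrow> coprime p (mdim W) \<Longrightarrow>
           U \<in> g (iso_class (scalar_ext (corner B i)) W) \<Longrightarrow> mdim U \<le> mdim W"
    and "induced_bijection p G (normalizer_group G P) P B C i j g f"
  shows "\<forall>\<chi>\<in>irr_chars_ht0 p G P B.
           char_degree (normalizer_group G P) (f \<chi>) \<le> char_degree G \<chi>"
proof
  let ?N = "normalizer G P" and ?H = "normalizer_group G P"
  obtain \<pi> where "residue_ring \<O> \<pi> res p"
    using residue_ring_if_complete_dvr assms(1,2,4,5) by blast
  then interpret residue_ring \<O> \<pi> res p .
  interpret group G by (rule assms(6))
  interpret group_algebra G \<O> \<pi> res p by unfold_locales (rule assms(7))
  have P: "subgroup P G" using assms(9) by (simp add: defect_group_def)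
  have PG: "P \<subseteq> carrier G" using P by (rule subgroup.subset)
  obtain n where n: "card P = p ^ n" using defect_group_is_p_group[OF assms(9)] by blast
  interpret p_subgroup_algebra G \<O> \<pi> res p P n
    by (intro p_subgroup_algebra.intro p_subgroup_algebra_axioms.intro group_algebra_axioms P n)
  interpret H: group_algebra ?H \<O> \<pi> res p by (rule group_algebra_subgroup[OF N_sub])
  have cblock: "block_idempotent \<O> ?H c" and cdef: "defect_group \<O> ?H c P"
    and cbr: "brauer_map ?H P res c = brauer_map G P res b"
    using assms(10) by (auto simp: brauer_correspondent_def)
  have PH: "subgroup P ?H" using cdef by (simp add: defect_group_def)
  have Hs: "H.supp = (alg ?N :: ('g \<Rightarrow> 'k) set)" by (simp add: H.supp_def alg_def)
  have inN: "x \<in> alg ?N" if "x \<in> fixalg ?N Q" for x Q using fixalg_alg[OF that] .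
  note fixH = fixalg_subgroup[OF N_sub]

  have b: "primitive_in (fixalg (carrier G) (carrier G)) b" by (rule block_idempotent_primitive[OF assms(8)])
  have cH: "H.primitive_in (H.fixalg ?N ?N) c" using H.block_idempotent_primitive[OF cblock] by simp
  have c: "primitive_in (fixalg ?N ?N) c"
    using primitive_in_subgroup[OF N_sub _ cH] inN unfolding fixH[OF subset_refl] by blast

  \<comment> \<open>That \<open>c\<close> is a relative trace from \<open>P\<close> is part of \<open>P\<close> being a defect group of \<open>c\<close>.\<close>
  define T where "T = H.coset_reps P"
  have TN: "T \<subseteq> ?N" using H.coset_reps(1)[OF PH] by (simp add: T_def)
  have conjH: "conj_act ?H x a = conj_act G x a" if "x \<in> ?N" "a \<in> alg ?N" for x and a :: "'g \<Rightarrow> 'k"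
    by (rule conj_act_subgroup[OF N_sub that])
  have HfixP: "{a \<in> carrier (group_ring \<O> ?H). \<forall>u\<in>P. conj_act ?H u a = a} = fixalg ?N P"
    using H.fixalg_carrier[of P] fixH[OF P_sub_N] P_sub_N by simp
  have T: "trace_transversal T"
    unfolding trace_transversal_def
  proof (intro conjI TN ballI allI)
    fix a y assume a: "a \<in> fixalg ?N P"
    have "of_nat (card P) * rel_trace ?H P a y = (\<Sum>x\<in>carrier ?H. conj_act ?H x a y)"
      by (rule H.coset_reps(3)[OF PH]) (use a HfixP in blast)
    also have "\<dots> = (\<Sum>x\<in>?N. conj_act G x a y)" using conjH[OF _ inN[OF a]] by simp
    also have "rel_trace ?H P a = (\<Sum>x\<in>T. conj_act ?H x a)" unfolding T_def by (rule H.coset_reps(2)[OF PH])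
    also have "\<dots> = (\<Sum>x\<in>T. conj_act G x a)" using conjH[OF _ inN[OF a]] TN by (intro sum.cong) auto
    finally show "of_nat (card P) * (\<Sum>x\<in>T. conj_act G x a y) = (\<Sum>x\<in>?N. conj_act G x a y)"
      by (simp add: sum_fun_apply)
  qed
  obtain a where a: "a \<in> fixalg ?N P" "c = (\<Sum>x\<in>T. conj_act G x a)"
  proof -
    obtain a where a: "a \<in> carrier (group_ring \<O> ?H)" "\<forall>u\<in>P. conj_act ?H u a = a" "c = rel_trace ?H P a"
      using cdef by (auto simp: defect_group_def rel_projective_def fixed_points_def)
    have aN: "a \<in> fixalg ?N P" using a HfixP by blast
    have "c = (\<Sum>x\<in>T. conj_act ?H x a)" unfolding a(3) T_def by (rule H.coset_reps(2)[OF PH])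
    also have "\<dots> = (\<Sum>x\<in>T. conj_act G x a)" using conjH[OF _ inN[OF aN]] TN by (intro sum.cong) auto
    finally show thesis using that aN by blast
  qed
  have centH: "centralizer ?H P = centralizer G P"
    using centralizer_sub_N N_carrier by (auto simp: centralizer_def)
  have bc: "res (b x) = res (c x)" if "x \<in> centralizer G P" for x
    using fun_cong[OF cbr, of x] that by (simp add: brauer_map_def centH)

  have i: "primitive_in (fixalg (carrier G) P) i" "conv G b i = i" "conv G i b = i"
    using source_idempotent_primitive[OF b PG, of i] assms(11,15) by (auto simp: source_idempotent_def)
  have ik: "i \<notin> brauer_kernel (carrier G)"
    using assms(15) by (auto simp: source_idempotent_def brauer_map_def brauer_kernel_def fun_eq_iff split: if_splits)
  have jH: "H.primitive_in (H.fixalg ?N P) j" "conv ?H c j = j" "conv ?H j c = j"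
    using H.source_idempotent_primitive[of c P j] cH P_sub_N assms(12,16) by (auto simp: source_idempotent_def)
  have j: "primitive_in (fixalg ?N P) j"
    using primitive_in_subgroup[OF N_sub _ jH(1)] inN unfolding fixH[OF P_sub_N] by blast
  have jN: "j \<in> alg ?N" and cN: "c \<in> alg ?N" using j c inN by (auto simp: primitive_in_def)
  have jc: "conv G j c = j" "conv G c j = j"
    using jH(2,3) conv_subgroup[OF N_sub jN cN] conv_subgroup[OF N_sub cN jN] by auto
  have jk: "j \<notin> brauer_kernel ?N"
    using assms(16) by (auto simp: source_idempotent_def brauer_map_def brauer_kernel_def fun_eq_iff centH split: if_splits)

  fix \<chi> assume \<chi>: "\<chi> \<in> irr_chars_ht0 p G P B"
  then obtain V where V: "simple_module (scalar_ext B) V" "\<chi> = character G B V"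
    by (auto simp: irr_chars_ht0_def irr_chars_def)
  then obtain w Y where w: "w \<in> irr_p' p (corner B i)" "cut_module i V \<in> w"
    and Y: "simple_module (scalar_ext C) Y" "character ?H C Y = f \<chi>" "cut_module j Y \<in> g w"
    using assms(19) \<chi> unfolding induced_bijection_def by metis
  obtain W where W: "w = iso_class (scalar_ext (corner B i)) W"
    "simple_module (scalar_ext (corner B i)) W" "coprime p (mdim W)"
    using w(1) by (auto simp: irr_p'_def)
  have Vm: "is_module (scalar_ext B) V" and Ym: "is_module (scalar_ext C) Y"
    using V Y by (auto simp: simple_module_def)
  have "mdim W = mdim (cut_module i V)"
    using w(2) W by (intro mdim_module_iso is_module_fin) (auto simp: iso_class_def simple_module_def)
  moreover have "mdim (cut_module j Y) \<le> mdim W"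
    using assms(18)[OF W(2,3)] Y(3) W(1) by simp
  ultimately have cut: "mdim (cut_module j Y) \<le> mdim (cut_module i V)" by simp

  have repV: "group_rep G supp (\<lambda>a. maction V (conv G b a)) (mspace V)"
    using block_module_rep[OF b] Vm assms(11) by simp
  have "group_rep ?H H.supp (\<lambda>a. maction Y (conv ?H c a)) (mspace Y)"
    using H.block_module_rep[of c] cH Ym assms(12) by simp
  hence repY: "group_rep G (alg ?N) (\<lambda>a. maction Y (conv ?H c a)) (mspace Y)"
    unfolding Hs by (rule group_rep_subgroup[OF N_sub])
  interpret V: group_rep G supp "\<lambda>a. maction V (conv G b a)" "mspace V" by (rule repV)
  interpret Y: group_rep G "alg ?N" "\<lambda>a. maction Y (conv ?H c a)" "mspace Y" by (rule repY)
  have "Y.mult_dim j \<le> V.mult_dim i"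
    using cut unfolding V.mult_dim_def Y.mult_dim_def i(2) jH(2) by (simp add: mdim_def cut_module_def)
  hence "Y.mult_dim c \<le> fvec.dim (mspace V)"
    by (intro dim_le_if_source_dim_le[OF c T a b bc j jc(1) jk i(1,3) ik repV repY])
  moreover have "Y.mult_dim c = fvec.dim (mspace Y)"
  proof -
    have "one (scalar_ext C) = c" by (simp add: assms(12) scalar_ext_def block_algebra_def corner_def)
    hence "maction Y c v = v" if "v \<in> mspace Y" for v using is_module_one[OF Ym that] by simp
    hence "maction Y c ` mspace Y = mspace Y" by simp
    moreover have "conv ?H c c = c" using cH by (simp add: H.primitive_in_def)
    ultimately show ?thesis by (simp add: Y.mult_dim_def)
  qed
  ultimately have le: "mdim Y \<le> mdim V" by (simp add: mdim_def)

  have bs: "b \<in> supp" using b fixalg_supp[OF subset_refl] by (auto simp: primitive_in_def)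
  have cs: "c \<in> H.supp" using cN Hs by simp
  have "char_degree G \<chi> = mdim V" unfolding V(2)
    by (rule char_degree_character[OF assms(6,11) _ Vm]) (rule conv_one_right[OF bs])
  moreover have "char_degree ?H (f \<chi>) = mdim Y" unfolding Y(2)[symmetric]
    by (rule char_degree_character[OF H.group_axioms assms(12) _ Ym]) (rule H.conv_one_right[OF cs])
  ultimately show "char_degree ?H (f \<chi>) \<le> char_degree G \<chi>" using le by simp
qed

end
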